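(* The $\mathrm{F}_{4(-20)}$-orbits on $\mathcal{J}^1$ are given as follows. ("$X$ can be transformed to $Y$" means $Y=gX$ for some $g\in\mathrm{F}_{4(-20)}$.) (1) Assume $X\in\mathcal{J}^1$ has characteristic roots $\lambda_1>\lambda_2>\lambda_3$ (real). Then there is a unique $i\in\{1,2,3\}$ such that, with indices counted modulo $3$, (i) $\mathcal{H}(\mathbf{O})\cap V_X=\{E_{X,\lambda_i}\}$ and (ii) $\mathcal{H}'(\mathbf{O})\cap V_X=\{E_{X,\lambda_{i+1}},E_{X,\lambda_{i+2}}\}$ with $E_{X,\lambda_{i+1}}\neq E_{X,\lambda_{i+2}}$. In this case $X$ can be transformed to one of the following canonical forms: 1. if $E_{X,\lambda_1}\in\mathcal{H}(\mathbf{O})$: $\mathrm{diag}(\lambda_1,\lambda_2,\lambda_3)$; 2. if $E_{X,\lambda_2}\in\mathcal{H}(\mathbf{O})$: $\mathrm{diag}(\lambda_2,\lambda_3,\lambda_1)$; 3. if $E_{X,\lambda_3}\in\mathcal{H}(\mathbf{O})$: $\mathrm{diag}(\lambda_3,\lambda_1,\lambda_2)$. (2) Assume $X\in\mathcal{J}^1$ has characteristic roots $\lambda_1\in\mathbb{R}$ and $p\pm\sqrt{-1}q$ with $p\in\mathbb{R}$, $q>0$. Then $X$ can be transformed to the canonical form 4. $\mathrm{diag}(p,p,\lambda_1)+F_3^1(q)$. (3) Assume $X\in\mathcal{J}^1$ has a characteristic root $\lambda_1$ of multiplicity $1$ and a characteristic root $\lambda_2$ of multiplicity $2$. Then (i)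 $E_{X,\lambda_1}\in\mathcal{H}(\mathbf{O})\coprod\mathcal{H}'(\mathbf{O})$; (ii) $W_{X,\lambda_1}\in\{0\}\coprod\mathcal{N}_1^+(\mathbf{O})\coprod\mathcal{N}_1^-(\mathbf{O})$; (iii) $E_{X,\lambda_1}\in\mathcal{H}(\mathbf{O})\Rightarrow W_{X,\lambda_1}=0$; (iv) $W_{X,\lambda_1}\neq0\Rightarrow E_{X,\lambda_1}\in\mathcal{H}'(\mathbf{O})$. In this case $X$ can be transformed to one of the following canonical forms: 5. if $E_{X,\lambda_1}\in\mathcal{H}(\mathbf{O})$: $\mathrm{diag}(\lambda_1,\lambda_2,\lambda_2)$; 6. if $E_{X,\lambda_1}\in\mathcal{H}'(\mathbf{O})$ and $W_{X,\lambda_1}=0$: $\mathrm{diag}(\lambda_2,\lambda_2,\lambda_1)$; 7. if $W_{X,\lambda_1}\in\mathcal{N}_1^+(\mathbf{O})$: $\mathrm{diag}(\lambda_2,\lambda_2,\lambda_1)+P^+$; 8. if $W_{X,\lambda_1}\in\mathcal{N}_1^-(\mathbf{O})$: $\mathrm{diag}(\lambda_2,\lambda_2,\lambda_1)+P^-$. (4) Assume $X\in\mathcal{J}^1$ has a characteristic root of multiplicity $3$. Then $p(X)\in\{0\}\coprod\mathcal{N}_1^+(\mathbf{O})\coprod\mathcal{N}_1^-(\mathbf{O})\coprod\mathcal{N}_2(\mathbf{O})$, and $X$ can be transformed to one of the following canonical forms: 9. if $p(X)=0$: $\frac13\mathrm{tr}(X)E$; 10. if $p(X)\in\mathcal{N}_1^+(\mathbf{O})$: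 $\frac13\mathrm{tr}(X)E+P^+$; 11. if $p(X)\in\mathcal{N}_1^-(\mathbf{O})$: $\frac13\mathrm{tr}(X)E+P^-$; 12. if $p(X)\in\mathcal{N}_2(\mathbf{O})$: $\frac13\mathrm{tr}(X)E+Q^+(1)$. (5) Under the action of $\mathrm{F}_{4(-20)}$ the canonical forms 1--12 cannot be transformed from each other: two canonical forms with different numbers in the list 1--12 never lie in the same $\mathrm{F}_{4(-20)}$-orbit.
   Context: Octonions. $\mathbf{O}$ is the real octonion algebra with basis $1=e_0,e_1,\dots,e_7$: $1$ is the unit, $e_i^2=-1$ and $e_ie_j=-e_je_i$ for distinct $i,j\ge 1$, and $e_le_m=e_n$, $e_me_n=e_l$, $e_ne_l=e_m$ for $(l,m,n)\in\{(1,2,3),(3,5,6),(6,7,1),(1,4,5),(3,4,7),(6,4,2),(2,5,7)\}$. For $x=\sum x_ie_i$, $y=\sum y_ie_i$: $\overline{x}=x_0-\sum_{i\ge1}x_ie_i$, $(x|y)=\sum x_iy_i$. $\mathbf{O}^{\mathbb{C}}=\mathbf{O}\otimes_{\mathbb{R}}\mathbb{C}$, with all operations extended $\mathbb{C}$-linearly. Jordan algebra. For $\xi\in\mathbb{R}^3$, $x\in\mathbf{O}^3$ put $h^1(\xi_1,\xi_2,\xi_3;x_1,x_2,x_3)=\begin{pmatrix}\xi_1&\sqrt{-1}x_3&\sqrt{-1}\,\overline{x_2}\\ \sqrt{-1}\,\overline{x_3}&\xi_2&x_1\\ \sqrt{-1}x_2&\overline{x_1}&\xi_3\end{pmatrix}\in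 M(3,\mathbf{O}^{\mathbb{C}})$. $\mathcal{J}^1$ is the real vector space of all these matrices with Jordan product $X\circ Y=\frac12(XY+YX)$; $E$ is the identity matrix, $E_i$ the diagonal matrix with $1$ in position $(i,i)$ and $0$ elsewhere, $\mathrm{diag}(a,b,c)=aE_1+bE_2+cE_3$, and $F_3^1(x)=h^1(0,0,0;0,0,x)$. $\mathrm{tr}(X)=\xi_1+\xi_2+\xi_3$, $(X|Y)=\mathrm{tr}(X\circ Y)$, $X\times Y=\frac12\bigl(2X\circ Y-\mathrm{tr}(X)Y-\mathrm{tr}(Y)X+(\mathrm{tr}(X)\mathrm{tr}(Y)-(X|Y))E\bigr)$, $X^{\times2}=X\times X$, $\det(X)=\frac13(X|X\times X)$. The characteristic polynomial is $\Phi_X(\lambda)=\det(\lambda E-X)$ (a real cubic polynomial), and its roots in $\mathbb{C}$ are the characteristic roots of $X$ (with multiplicity). Group. $\mathrm{F}_{4(-20)}=\{g\in\mathrm{GL}_{\mathbb{R}}(\mathcal{J}^1)\mid g(X\circ Y)=gX\circ gY\ \text{for all }X,Y\in\mathcal{J}^1\}$. Elements. $P^+=h^1(1,-1,0;0,0,1)$, $P^-=h^1(-1,1,0;0,0,1)$, $Q^+(x)=h^1(0,0,0;x,\overline{x},0)$ for $x\in\mathbf{O}$. Objects attached to $X\in\mathcal{J}^1$. $V_X=\{aX^{\times2}+bX+cE\mid a,b,c\in\mathbb{R}\}$; $p(X)=X-\frac13\mathrm{tr}(X)E$. For $\lambda_0\in\mathbb{R}$ with $\mathrm{tr}((\lambda_0E-X)^{\times2})\ne0$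 (automatically true when $\lambda_0$ is a characteristic root of multiplicity $1$): $E_{X,\lambda_0}=\mathrm{tr}((\lambda_0E-X)^{\times2})^{-1}(\lambda_0E-X)^{\times2}$ and $W_{X,\lambda_0}=X-\bigl(\lambda_0E_{X,\lambda_0}+\frac12(\mathrm{tr}(X)-\lambda_0)(E-E_{X,\lambda_0})\bigr)$. Subsets of $\mathcal{J}^1$. $\mathcal{H}(\mathbf{O})=\{X\mid X^{\times2}=0,\ \mathrm{tr}(X)=1,\ (X|E_1)\ge1\}$; $\mathcal{H}'(\mathbf{O})=\{X\mid X^{\times2}=0,\ \mathrm{tr}(X)=1,\ (X|E_1)\le0\}$; $\mathcal{N}_1^+(\mathbf{O})=\{X\mid X^{\times2}=0,\ \mathrm{tr}(X)=0,\ (X|E_1)>0\}$; $\mathcal{N}_1^-(\mathbf{O})=\{X\mid X^{\times2}=0,\ \mathrm{tr}(X)=0,\ (X|E_1)<0\}$; $\mathcal{N}_2(\mathbf{O})=\{X\mid \mathrm{tr}(X)=\mathrm{tr}(X^{\times2})=\det(X)=0,\ X^{\times2}\ne0\}$. $\coprod$ denotes disjoint union. *)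

theory Defs
  imports "HOL-Analysis.Analysis" "HOL-Computational_Algebra.Polynomial"
begin

text \<open>The basis \<open>e\<^sub>0, \<dots>, e\<^sub>7\<close> is indexed by the numeral type \<open>8\<close>. Octonions are vectors in
  \<open>real^8\<close>; their complexification is \<open>complex^8\<close>. The product is defined over any commutative
  ring by the same integral structure constants, which makes the product on \<open>complex^8\<close> the
  complex bilinear extension. The library's componentwise product on vectors is never used.\<close>

type_synonym oct = "real^8"
type_synonym coct = "complex^8"
type_synonym cmat = "coct^3^3"

definition oct_lines :: "(8 \<times> 8 \<times> 8) set" where
  "oct_lines = {(1,2,3), (3,5,6), (6,7,1), (1,4,5), (3,4,7), (6,4,2), (2,5,7)}"

definition oct_triples :: "(8 \<times> 8 \<times> 8) set" where
  "oct_triples = {(l, m, n). (l, m, n) \<in> oct_lines \<or> (n, l, m) \<in> oct_lines \<or> (m, n, l) \<in> oct_lines}"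

text \<open>\<open>oct_const i j k\<close> is the coefficient of \<open>e\<^sub>k\<close> in \<open>e\<^sub>i e\<^sub>j\<close>.\<close>

definition oct_const :: "8 \<Rightarrow> 8 \<Rightarrow> 8 \<Rightarrow> int" where
  "oct_const i j k =
    (if i = 0 then (if k = j then 1 else 0)
     else if j = 0 then (if k = i then 1 else 0)
     else if i = j then (if k = 0 then -1 else 0)
     else if (i, j, k) \<in> oct_triples then 1
     else if (j, i, k) \<in> oct_triples then -1
     else 0)"

definition oct_mult :: "'a::comm_ring_1^8 \<Rightarrow> 'a^8 \<Rightarrow> 'a^8" where
  "oct_mult x y = (\<chi> k. \<Sum>i\<in>UNIV. \<Sum>j\<in>UNIV. of_int (oct_const i j k) * x$i * y$j)"

definition oct_of :: "'a::comm_ring_1 \<Rightarrow> 'a^8" where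
  "oct_of a = axis 0 a"

definition oct_cnj :: "'a::comm_ring_1^8 \<Rightarrow> 'a^8" where
  "oct_cnj x = (\<chi> i. if i = 0 then x$0 else - x$i)"

definition oct_complex :: "oct \<Rightarrow> coct" where
  "oct_complex x = (\<chi> i. complex_of_real (x$i))"

text \<open>Matrix indices range over the numeral type \<open>3\<close>, in which \<open>3 = 0\<close>. The library's matrix
  product requires an associative ring of entries, so it is not available here.\<close>

definition cmat_mult :: "cmat \<Rightarrow> cmat \<Rightarrow> cmat" where
  "cmat_mult X Y = (\<chi> i j. \<Sum>k\<in>UNIV. oct_mult (X$i$k) (Y$k$j))"

definition h1 :: "real \<Rightarrow> real \<Rightarrow> real \<Rightarrow> oct \<Rightarrow> oct \<Rightarrow> oct \<Rightarrow> cmat" where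
  "h1 \<xi>1 \<xi>2 \<xi>3 x1 x2 x3 = vector
    [vector [oct_of (of_real \<xi>1), \<i> *s oct_complex x3, \<i> *s oct_complex (oct_cnj x2)],
     vector [\<i> *s oct_complex (oct_cnj x3), oct_of (of_real \<xi>2), oct_complex x1],
     vector [\<i> *s oct_complex x2, oct_complex (oct_cnj x1), oct_of (of_real \<xi>3)]]"

definition J1 :: "cmat set" where
  "J1 = {h1 \<xi>1 \<xi>2 \<xi>3 x1 x2 x3 | \<xi>1 \<xi>2 \<xi>3 x1 x2 x3. True}"

definition jmult :: "cmat \<Rightarrow> cmat \<Rightarrow> cmat" where
  "jmult X Y = (1/2) *\<^sub>R (cmat_mult X Y + cmat_mult Y X)"

definition jE :: cmat where
  "jE = (\<chi> i j. if i = j then oct_of 1 else 0)"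

definition jEi :: "3 \<Rightarrow> cmat" where
  "jEi k = (\<chi> i j. if i = k \<and> j = k then oct_of 1 else 0)"

definition jdiag :: "real \<Rightarrow> real \<Rightarrow> real \<Rightarrow> cmat" where
  "jdiag a b c = a *\<^sub>R jEi 1 + b *\<^sub>R jEi 2 + c *\<^sub>R jEi 3"

definition jF3 :: "oct \<Rightarrow> cmat" where
  "jF3 x = h1 0 0 0 0 0 x"

text \<open>The diagonal entries of an element of \<open>J1\<close> are real multiples of \<open>e\<^sub>0\<close>, so on \<open>J1\<close> this
  is \<open>\<xi>\<^sub>1 + \<xi>\<^sub>2 + \<xi>\<^sub>3\<close>.\<close>

definition jtr :: "cmat \<Rightarrow> real" where
  "jtr X = (\<Sum>i\<in>UNIV. Re (X$i$i$0))"

definition jform :: "cmat \<Rightarrow> cmat \<Rightarrow> real" where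
  "jform X Y = jtr (jmult X Y)"

definition jcross :: "cmat \<Rightarrow> cmat \<Rightarrow> cmat" where
  "jcross X Y = (1/2) *\<^sub>R (2 *\<^sub>R jmult X Y - jtr X *\<^sub>R Y - jtr Y *\<^sub>R X
      + (jtr X * jtr Y - jform X Y) *\<^sub>R jE)"

definition jdet :: "cmat \<Rightarrow> real" where
  "jdet X = (1/3) * jform X (jcross X X)"

text \<open>The polynomial exists; see \<open>poly_jcharpoly\<close> below.\<close>

definition jcharpoly :: "cmat \<Rightarrow> real poly" where
  "jcharpoly X = (THE p. \<forall>t. poly p t = jdet (t *\<^sub>R jE - X))"

definition jcharroots :: "cmat \<Rightarrow> complex multiset" where
  "jcharroots X = proots (map_poly complex_of_real (jcharpoly X))"

text \<open>Elements are maps on the carrier \<open>J1\<close>; as is usual for such function groups they are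
  normalised to be \<open>undefined\<close> outside it.\<close>

definition F4 :: "(cmat \<Rightarrow> cmat) set" where
  "F4 = {g \<in> extensional J1. bij_betw g J1 J1
      \<and> (\<forall>X\<in>J1. \<forall>Y\<in>J1. g (X + Y) = g X + g Y)
      \<and> (\<forall>c::real. \<forall>X\<in>J1. g (c *\<^sub>R X) = c *\<^sub>R g X)
      \<and> (\<forall>X\<in>J1. \<forall>Y\<in>J1. g (jmult X Y) = jmult (g X) (g Y))}"

definition F4_orbit :: "cmat \<Rightarrow> cmat set" where
  "F4_orbit X = {g X | g. g \<in> F4}"

definition Pplus :: cmat where
  "Pplus = h1 1 (-1) 0 0 0 (oct_of 1)"

definition Pminus :: cmat where
  "Pminus = h1 (-1) 1 0 0 0 (oct_of 1)"

definition Qplus :: "oct \<Rightarrow> cmat" where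
  "Qplus x = h1 0 0 0 x (oct_cnj x) 0"

definition jV :: "cmat \<Rightarrow> cmat set" where
  "jV X = {a *\<^sub>R jcross X X + b *\<^sub>R X + c *\<^sub>R jE | a b c. True}"

definition jp :: "cmat \<Rightarrow> cmat" where
  "jp X = X - ((1/3) * jtr X) *\<^sub>R jE"

text \<open>Only meaningful when \<open>jtr (jcross Z Z) \<noteq> 0\<close> for \<open>Z = t *\<^sub>R jE - X\<close>; otherwise the value is \<open>0\<close>.\<close>

definition jEX :: "cmat \<Rightarrow> real \<Rightarrow> cmat" where
  "jEX X t = (let Z = t *\<^sub>R jE - X in inverse (jtr (jcross Z Z)) *\<^sub>R jcross Z Z)"

definition jWX :: "cmat \<Rightarrow> real \<Rightarrow> cmat" where
  "jWX X t = X - (t *\<^sub>R jEX X t + ((1/2) * (jtr X - t)) *\<^sub>R (jE - jEX X t))"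

definition HO :: "cmat set" where
  "HO = {X \<in> J1. jcross X X = 0 \<and> jtr X = 1 \<and> jform X (jEi 1) \<ge> 1}"

definition HO' :: "cmat set" where
  "HO' = {X \<in> J1. jcross X X = 0 \<and> jtr X = 1 \<and> jform X (jEi 1) \<le> 0}"

definition N1plus :: "cmat set" where
  "N1plus = {X \<in> J1. jcross X X = 0 \<and> jtr X = 0 \<and> jform X (jEi 1) > 0}"

definition N1minus :: "cmat set" where
  "N1minus = {X \<in> J1. jcross X X = 0 \<and> jtr X = 0 \<and> jform X (jEi 1) < 0}"

definition N2 :: "cmat set" where
  "N2 = {X \<in> J1. jtr X = 0 \<and> jtr (jcross X X) = 0 \<and> jdet X = 0 \<and> jcross X X \<noteq> 0}"

definition canonical_forms :: "nat \<Rightarrow> cmat set" where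
  "canonical_forms n =
    (if n = 1 then {jdiag l1 l2 l3 | l1 l2 l3. l1 > l2 \<and> l2 > l3}
     else if n = 2 then {jdiag l2 l3 l1 | l1 l2 l3. l1 > l2 \<and> l2 > l3}
     else if n = 3 then {jdiag l3 l1 l2 | l1 l2 l3. l1 > l2 \<and> l2 > l3}
     else if n = 4 then {jdiag p p l1 + jF3 (oct_of q) | p q l1. q > 0}
     else if n = 5 then {jdiag l1 l2 l2 | l1 l2. l1 \<noteq> l2}
     else if n = 6 then {jdiag l2 l2 l1 | l1 l2. l1 \<noteq> l2}
     else if n = 7 then {jdiag l2 l2 l1 + Pplus | l1 l2. l1 \<noteq> l2}
     else if n = 8 then {jdiag l2 l2 l1 + Pminus | l1 l2. l1 \<noteq> l2}
     else if n = 9 then {r *\<^sub>R jE | r. True}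
     else if n = 10 then {r *\<^sub>R jE + Pplus | r. True}
     else if n = 11 then {r *\<^sub>R jE + Pminus | r. True}
     else if n = 12 then {r *\<^sub>R jE + Qplus (oct_of 1) | r. True}
     else {})"

lemma jtr_linear: "linear jtr"
  by (rule linearI) (simp_all add: jtr_def sum.distrib sum_distrib_left)

lemma oct_mult_add_left: "oct_mult (x + y) z = oct_mult x z + oct_mult y z"
  by (simp add: oct_mult_def vec_eq_iff algebra_simps sum.distrib)

lemma oct_mult_add_right: "oct_mult z (x + y) = oct_mult z x + oct_mult z y"
  by (simp add: oct_mult_def vec_eq_iff algebra_simps sum.distrib)

lemma oct_mult_scaleR_left: "oct_mult (c *\<^sub>R x) (z::coct) = c *\<^sub>R oct_mult x z"
  by (simp add: oct_mult_def vec_eq_iff scaleR_sum_right)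

lemma oct_mult_scaleR_right: "oct_mult (z::coct) (c *\<^sub>R x) = c *\<^sub>R oct_mult z x"
  by (simp add: oct_mult_def vec_eq_iff scaleR_sum_right)

lemma jmult_add_left: "jmult (X + Y) Z = jmult X Z + jmult Y Z"
  by (simp add: jmult_def cmat_mult_def vec_eq_iff oct_mult_add_left oct_mult_add_right
      sum.distrib algebra_simps)

lemma jmult_scaleR_left: "jmult (c *\<^sub>R X) Z = c *\<^sub>R jmult X Z"
  by (simp add: jmult_def cmat_mult_def vec_eq_iff oct_mult_scaleR_left oct_mult_scaleR_right
      sum_distrib_left scaleR_sum_right algebra_simps)

lemma jmult_commute: "jmult X Y = jmult Y X"
  by (simp add: jmult_def add.commute)

lemma jcross_commute: "jcross X Y = jcross Y X"
  by (simp add: jcross_def jform_def jmult_commute[of X Y] algebra_simps)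

lemma jform_commute: "jform X Y = jform Y X"
  by (simp add: jform_def jmult_commute)

lemma jform_add_left: "jform (X + Y) Z = jform X Z + jform Y Z"
  by (simp add: jform_def jmult_add_left linear_add[OF jtr_linear])

lemma jform_scaleR_left: "jform (c *\<^sub>R X) Z = c * jform X Z"
  by (simp add: jform_def jmult_scaleR_left linear_scale[OF jtr_linear])

lemma jcross_add_left: "jcross (X + Y) Z = jcross X Z + jcross Y Z"
  by (simp add: jcross_def jmult_add_left jform_add_left linear_add[OF jtr_linear] algebra_simps)

lemma jcross_scaleR_left: "jcross (c *\<^sub>R X) Z = c *\<^sub>R jcross X Z"
  by (simp add: jcross_def jmult_scaleR_left jform_scaleR_left linear_scale[OF jtr_linear]
      algebra_simps)

lemma poly_jcharpoly: "poly (jcharpoly X) t = jdet (t *\<^sub>R jE - X)"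
proof -
  define Y where "Y = - X"
  define c where "c A B C = jform A (jcross B C)" for A B C
  have c1: "c (s *\<^sub>R A + A') B C = s * c A B C + c A' B C" for s A A' B C
    by (simp add: c_def jform_add_left jform_scaleR_left)
  have c2: "c A (s *\<^sub>R B + B') C = s * c A B C + c A B' C" for s A B B' C
    by (simp add: c_def jform_commute[of A] jcross_add_left jcross_scaleR_left jform_add_left
        jform_scaleR_left)
  have c3: "c A B (s *\<^sub>R C + C') = s * c A B C + c A B C'" for s A B C C'
    using c2[of A s C C' B] by (simp add: c_def jcross_commute)
  define p where "p = [: c Y Y Y / 3, (c jE Y Y + c Y jE Y + c Y Y jE) / 3,
      (c jE jE Y + c jE Y jE + c Y jE jE) / 3, c jE jE jE / 3 :]"
  have p: "poly p s = jdet (s *\<^sub>R jE - X)" for s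
  proof -
    have "jdet (s *\<^sub>R jE - X) = c (s *\<^sub>R jE + Y) (s *\<^sub>R jE + Y) (s *\<^sub>R jE + Y) / 3"
      by (simp add: jdet_def c_def Y_def)
    also have "\<dots> = poly p s"
      by (simp only: c1 c2 c3) (simp add: p_def algebra_simps add_divide_distrib)
    finally show ?thesis by simp
  qed
  have "jcharpoly X = p"
    unfolding jcharpoly_def
  proof (rule the_equality)
    show "q = p" if "\<forall>t. poly q t = jdet (t *\<^sub>R jE - X)" for q
      using that p by (metis poly_eq_poly_eq_iff ext)
  qed (use p in simp)
  then show ?thesis using p by simp
qed

end

theory Submission
  imports Defs
begin

text \<open>Automorphisms preserve the trace, because the associators span the elements of trace zero;
  hence they preserve the form, the cross product, the determinant and everything built from them.
  Octonionic triality (through the Moufang identity), rotations of the last two coordinates and boosts of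
  the first two bring every element first to tridiagonal shape and then to a matrix with real
  entries, that is, to a real \<open>3 \<times> 3\<close> matrix that is self-adjoint for a Lorentzian form. A real
  eigenvector of this matrix is timelike, spacelike or null, and in each case the remaining
  \<open>2 \<times> 2\<close> block (or the nilpotent part) is put into canonical form by hand.

  These moves preserve the sign of \<open>(X|E\<^sub>1)\<close> on rank one elements of non-negative trace. So they act
  transitively on the two sets of primitive idempotents, which are told apart intrinsically by the
  signature of the form on the annihilator; the nilpotent rank one elements of positive sign are the
  ones that pair positively with the idempotents of \<open>HO\<close>. Therefore all sets in the
  classification are invariant under the full automorphism group, and its claims need to be checked on the
  canonical forms only.\<close>

subsection \<open>Octonions\<close>

lemma exhaust_8:
  fixes k :: 8
  shows "k = 0 \<or> k = 1 \<or> k = 2 \<or> k = 3 \<or> k = 4 \<or> k = 5 \<or> k = 6 \<or> k = 7"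
proof (cases k)
  case (of_int z)
  then have "z = 0 \<or> z = 1 \<or> z = 2 \<or> z = 3 \<or> z = 4 \<or> z = 5 \<or> z = 6 \<or> z = 7"
    by auto
  then show ?thesis using of_int by auto
qed

lemma forall_8: "(\<forall>k::8. P k) \<longleftrightarrow> P 0 \<and> P 1 \<and> P 2 \<and> P 3 \<and> P 4 \<and> P 5 \<and> P 6 \<and> P 7"
  by (metis exhaust_8)

lemma UNIV_8: "(UNIV :: 8 set) = {0, 1, 2, 3, 4, 5, 6, 7}"
  using exhaust_8 by auto

lemma sum_8: "sum f (UNIV :: 8 set) = f 0 + f 1 + f 2 + f 3 + f 4 + f 5 + f 6 + f 7"
  unfolding UNIV_8 by (simp add: ac_simps)

lemma oct_triples_iff:
  "(i, j, k) \<in> oct_triples \<longleftrightarrow> (i, j, k) \<in> oct_lines \<or> (k, i, j) \<in> oct_lines \<or> (j, k, i) \<in> oct_lines"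
  by (simp add: oct_triples_def)

lemma oct_const_0: "oct_const 0 j k = (if k = j then 1 else 0)" "oct_const i 0 k = (if k = i then 1 else 0)"
  by (simp_all add: oct_const_def)

lemma oct_const_diag: "i \<noteq> 0 \<Longrightarrow> oct_const i i k = (if k = 0 then -1 else 0)"
  by (simp add: oct_const_def)

lemma oct_const_offdiag:
  shows "oct_const 1 2 k = (if k = 3 then 1 else 0)"
  and "oct_const 1 3 k = (if k = 2 then -1 else 0)"
  and "oct_const 1 4 k = (if k = 5 then 1 else 0)"
  and "oct_const 1 5 k = (if k = 4 then -1 else 0)"
  and "oct_const 1 6 k = (if k = 7 then 1 else 0)"
  and "oct_const 1 7 k = (if k = 6 then -1 else 0)"
  and "oct_const 2 1 k = (if k = 3 then -1 else 0)"
  and "oct_const 2 3 k = (if k = 1 then 1 else 0)"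
  and "oct_const 2 4 k = (if k = 6 then -1 else 0)"
  and "oct_const 2 5 k = (if k = 7 then 1 else 0)"
  and "oct_const 2 6 k = (if k = 4 then 1 else 0)"
  and "oct_const 2 7 k = (if k = 5 then -1 else 0)"
  and "oct_const 3 1 k = (if k = 2 then 1 else 0)"
  and "oct_const 3 2 k = (if k = 1 then -1 else 0)"
  and "oct_const 3 4 k = (if k = 7 then 1 else 0)"
  and "oct_const 3 5 k = (if k = 6 then 1 else 0)"
  and "oct_const 3 6 k = (if k = 5 then -1 else 0)"
  and "oct_const 3 7 k = (if k = 4 then -1 else 0)"
  and "oct_const 4 1 k = (if k = 5 then -1 else 0)"
  and "oct_const 4 2 k = (if k = 6 then 1 else 0)"
  and "oct_const 4 3 k = (if k = 7 then -1 else 0)"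
  and "oct_const 4 5 k = (if k = 1 then 1 else 0)"
  and "oct_const 4 6 k = (if k = 2 then -1 else 0)"
  and "oct_const 4 7 k = (if k = 3 then 1 else 0)"
  and "oct_const 5 1 k = (if k = 4 then 1 else 0)"
  and "oct_const 5 2 k = (if k = 7 then -1 else 0)"
  and "oct_const 5 3 k = (if k = 6 then -1 else 0)"
  and "oct_const 5 4 k = (if k = 1 then -1 else 0)"
  and "oct_const 5 6 k = (if k = 3 then 1 else 0)"
  and "oct_const 5 7 k = (if k = 2 then 1 else 0)"
  and "oct_const 6 1 k = (if k = 7 then -1 else 0)"
  and "oct_const 6 2 k = (if k = 4 then -1 else 0)"
  and "oct_const 6 3 k = (if k = 5 then 1 else 0)"
  and "oct_const 6 4 k = (if k = 2 then 1 else 0)"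
  and "oct_const 6 5 k = (if k = 3 then -1 else 0)"
  and "oct_const 6 7 k = (if k = 1 then 1 else 0)"
  and "oct_const 7 1 k = (if k = 6 then 1 else 0)"
  and "oct_const 7 2 k = (if k = 5 then 1 else 0)"
  and "oct_const 7 3 k = (if k = 4 then 1 else 0)"
  and "oct_const 7 4 k = (if k = 3 then -1 else 0)"
  and "oct_const 7 5 k = (if k = 2 then -1 else 0)"
  and "oct_const 7 6 k = (if k = 1 then -1 else 0)"
  by (simp_all add: oct_const_def oct_triples_iff oct_lines_def)

lemma oct_mult_nth:
  fixes x y :: "'a::comm_ring_1^8"
  shows "oct_mult x y $ 0 = x$0*y$0 - x$1*y$1 - x$2*y$2 - x$3*y$3 - x$4*y$4 - x$5*y$5 - x$6*y$6 - x$7*y$7"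
    and "oct_mult x y $ 1 = x$0*y$1 + x$1*y$0 + x$2*y$3 - x$3*y$2 + x$4*y$5 - x$5*y$4 + x$6*y$7 - x$7*y$6"
    and "oct_mult x y $ 2 = x$0*y$2 + x$2*y$0 + x$3*y$1 - x$1*y$3 + x$6*y$4 - x$4*y$6 + x$5*y$7 - x$7*y$5"
    and "oct_mult x y $ 3 = x$0*y$3 + x$3*y$0 + x$1*y$2 - x$2*y$1 + x$5*y$6 - x$6*y$5 + x$4*y$7 - x$7*y$4"
    and "oct_mult x y $ 4 = x$0*y$4 + x$4*y$0 + x$5*y$1 - x$1*y$5 + x$7*y$3 - x$3*y$7 + x$2*y$6 - x$6*y$2"
    and "oct_mult x y $ 5 = x$0*y$5 + x$5*y$0 + x$1*y$4 - x$4*y$1 + x$6*y$3 - x$3*y$6 + x$7*y$2 - x$2*y$7"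
    and "oct_mult x y $ 6 = x$0*y$6 + x$6*y$0 + x$3*y$5 - x$5*y$3 + x$7*y$1 - x$1*y$7 + x$4*y$2 - x$2*y$4"
    and "oct_mult x y $ 7 = x$0*y$7 + x$7*y$0 + x$1*y$6 - x$6*y$1 + x$3*y$4 - x$4*y$3 + x$2*y$5 - x$5*y$2"
  by (simp_all add: oct_mult_def sum_8 oct_const_0 oct_const_diag oct_const_offdiag)

lemma inner_8: "(x::real^8) \<bullet> y = x$0*y$0 + x$1*y$1 + x$2*y$2 + x$3*y$3 + x$4*y$4 + x$5*y$5 + x$6*y$6 + x$7*y$7"
  by (simp add: inner_vec_def sum_8)

lemma oct_mult_norm:
  fixes x y :: oct
  shows "oct_mult x y \<bullet> oct_mult x y = (x \<bullet> x) * (y \<bullet> y)"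
  unfolding inner_8 oct_mult_nth by (simp add: algebra_simps)

notation oct_mult (infixl "\<odot>" 70)

lemma oct_mult_add [simp]:
  fixes x y z :: "'a::comm_ring_1^8"
  shows "(x + y) \<odot> z = x \<odot> z + y \<odot> z" and "z \<odot> (x + y) = z \<odot> x + z \<odot> y"
  by (rule oct_mult_add_left oct_mult_add_right)+

lemma oct_mult_scale [simp]:
  fixes x y :: "'a::comm_ring_1^8"
  shows "(c *s x) \<odot> y = c *s (x \<odot> y)" and "x \<odot> (c *s y) = c *s (x \<odot> y)"
  by (simp_all add: oct_mult_def vec_eq_iff sum_distrib_left mult_ac)

lemma oct_mult_scaleR [simp]:
  fixes x y :: oct
  shows "(c *\<^sub>R x) \<odot> y = c *\<^sub>R (x \<odot> y)" and "x \<odot> (c *\<^sub>R y) = c *\<^sub>R (x \<odot> y)"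
  by (simp_all flip: scalar_mult_eq_scaleR)

lemma oct_mult_minus [simp]:
  fixes x y :: "'a::comm_ring_1^8"
  shows "(- x) \<odot> y = - (x \<odot> y)" and "x \<odot> (- y) = - (x \<odot> y)"
  by (simp_all add: oct_mult_def vec_eq_iff sum_negf)

lemma oct_mult_diff [simp]:
  fixes x y z :: "'a::comm_ring_1^8"
  shows "(x - y) \<odot> z = x \<odot> z - y \<odot> z" and "z \<odot> (x - y) = z \<odot> x - z \<odot> y"
  using oct_mult_add(1)[of x "- y" z] oct_mult_add(2)[of z x "- y"] by simp_all

lemma oct_mult_zero [simp]:
  fixes x :: "'a::comm_ring_1^8"
  shows "0 \<odot> x = 0" and "x \<odot> 0 = 0"
  by (simp_all add: oct_mult_def vec_eq_iff)

lemma oct_of_nth: "oct_of a $ i = (if i = 0 then a else 0)"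
  by (simp add: oct_of_def axis_def)

lemma oct_mult_oct_of [simp]:
  fixes x :: "'a::comm_ring_1^8"
  shows "oct_of a \<odot> x = a *s x" and "x \<odot> oct_of a = a *s x"
  by (simp_all add: vec_eq_iff forall_8 oct_mult_nth oct_of_nth mult.commute)

lemma oct_of_simps [simp]:
  "oct_of 0 = 0" "oct_of a + oct_of b = oct_of (a + b)" "oct_of a - oct_of b = oct_of (a - b)"
  "- oct_of a = oct_of (- a)" "c *s oct_of a = oct_of (c * a)"
  by (auto simp: vec_eq_iff oct_of_nth)

lemma scaleR_oct_of [simp]: "c *\<^sub>R (oct_of a :: oct) = oct_of (c * a)"
  by (simp add: vec_eq_iff oct_of_nth)

lemma oct_of_eq_iff [simp]: "oct_of a = oct_of b \<longleftrightarrow> a = b"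
  by (auto simp: vec_eq_iff oct_of_nth)

lemma oct_of_eq_0_iff [simp]: "oct_of a = 0 \<longleftrightarrow> a = 0"
  using oct_of_eq_iff[of a 0] by simp

lemma oct_cnj_nth: "oct_cnj x $ i = (if i = 0 then x $ 0 else - x $ i)"
  by (simp add: oct_cnj_def)

lemma oct_cnj_simps [simp]:
  "oct_cnj (oct_cnj x) = x" "oct_cnj (x + y) = oct_cnj x + oct_cnj y"
  "oct_cnj (x - y) = oct_cnj x - oct_cnj y" "oct_cnj (- x) = - oct_cnj x"
  "oct_cnj (c *s x) = c *s oct_cnj x" "oct_cnj (oct_of a) = oct_of a" "oct_cnj 0 = 0"
  by (auto simp: vec_eq_iff oct_cnj_nth oct_of_nth)

lemma oct_cnj_scaleR [simp]: "oct_cnj (c *\<^sub>R x :: oct) = c *\<^sub>R oct_cnj x"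
  by (simp add: vec_eq_iff oct_cnj_nth)

lemma oct_cnj_mult: "oct_cnj (x \<odot> y) = oct_cnj y \<odot> oct_cnj (x :: 'a::comm_ring_1^8)"
  by (simp add: vec_eq_iff forall_8 oct_mult_nth oct_cnj_nth algebra_simps)

lemma oct_cnj_inner [simp]: "oct_cnj x \<bullet> oct_cnj y = x \<bullet> (y :: oct)"
  by (simp add: inner_8 oct_cnj_nth)

lemma oct_cnj_inner_commute: "oct_cnj x \<bullet> y = x \<bullet> oct_cnj (y :: oct)"
  by (simp add: inner_8 oct_cnj_nth)

lemma inner_oct_of [simp]: "(oct_of a :: oct) \<bullet> x = a * x $ 0" "x \<bullet> (oct_of a :: oct) = a * x $ 0"
  by (simp_all add: inner_8 oct_of_nth)

lemma oct_mult_cnj_self: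
  "x \<odot> oct_cnj x = oct_of (x \<bullet> x)" "oct_cnj x \<odot> x = oct_of (x \<bullet> x)" for x :: oct
  by (simp_all add: vec_eq_iff forall_8 oct_mult_nth oct_cnj_nth oct_of_nth inner_8)

lemma oct_mult_norm_left:
  fixes x y z :: oct
  shows "(x \<odot> y) \<bullet> (x \<odot> z) = (x \<bullet> x) * (y \<bullet> z)"
  using oct_mult_norm[of x "y + z"]
  by (simp add: inner_add oct_mult_norm algebra_simps inner_commute)

lemma oct_mult_norm_right:
  fixes x y z :: oct
  shows "(x \<odot> z) \<bullet> (y \<odot> z) = (x \<bullet> y) * (z \<bullet> z)"
  using oct_mult_norm[of "x + y" z]
  by (simp add: inner_add oct_mult_norm algebra_simps inner_commute)

lemma oct_mult_norm_exchange:
  fixes x y u z :: oct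
  shows "(x \<odot> y) \<bullet> (u \<odot> z) + (u \<odot> y) \<bullet> (x \<odot> z) = 2 * (x \<bullet> u) * (y \<bullet> z)"
  using oct_mult_norm_left[of "x + u" y z]
  by (simp add: inner_add oct_mult_norm_left algebra_simps inner_commute)

lemma oct_cnj_conv: "oct_cnj x = oct_of (2 * x $ 0) - (x :: oct)"
  by (simp add: vec_eq_iff oct_cnj_nth oct_of_nth)

lemma inner_oct_mult_left: "(x \<odot> y) \<bullet> z = y \<bullet> (oct_cnj x \<odot> z)" for x y z :: oct
  using oct_mult_norm_exchange[of x y "oct_of 1" z]
  by (simp add: oct_cnj_conv scalar_mult_eq_scaleR inner_diff algebra_simps)

lemma inner_oct_mult_right: "(x \<odot> y) \<bullet> z = x \<bullet> (z \<odot> oct_cnj y)" for x y z :: oct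
proof -
  have "(x \<odot> y) \<bullet> z = (oct_cnj y \<odot> oct_cnj x) \<bullet> oct_cnj z"
    by (metis oct_cnj_inner oct_cnj_mult)
  also have "\<dots> = oct_cnj x \<bullet> (y \<odot> oct_cnj z)"
    by (simp add: inner_oct_mult_left)
  also have "\<dots> = oct_cnj x \<bullet> oct_cnj (z \<odot> oct_cnj y)"
    by (simp add: oct_cnj_mult)
  finally show ?thesis by simp
qed

lemma oct_mult_cnj_left: "x \<odot> (oct_cnj x \<odot> y) = (x \<bullet> x) *\<^sub>R y" for x y :: oct
proof -
  have "(x \<odot> (oct_cnj x \<odot> y)) \<bullet> z = ((x \<bullet> x) *\<^sub>R y) \<bullet> z" for z
    by (simp add: inner_oct_mult_left[of x] oct_mult_norm_left)
  then show ?thesis by (metis vector_eq_rdot)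
qed

lemma oct_Moufang:
  fixes x y z :: oct
  shows "(x \<odot> y) \<odot> (z \<odot> x) = (2 * (oct_cnj x \<bullet> (y \<odot> z))) *\<^sub>R x - (x \<bullet> x) *\<^sub>R oct_cnj (y \<odot> z)"
proof -
  have "((x \<odot> y) \<odot> (z \<odot> x)) \<bullet> t
    = ((2 * (oct_cnj x \<bullet> (y \<odot> z))) *\<^sub>R x - (x \<bullet> x) *\<^sub>R oct_cnj (y \<odot> z)) \<bullet> t" for t
  proof -
    let ?w = "oct_cnj (z \<odot> x)"
    have "((x \<odot> y) \<odot> (z \<odot> x)) \<bullet> t = (x \<odot> y) \<bullet> (t \<odot> ?w)"
      by (rule inner_oct_mult_right)
    also have "\<dots> = 2 * (x \<bullet> t) * (y \<bullet> ?w) - (t \<odot> y) \<bullet> (x \<odot> ?w)"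
      using oct_mult_norm_exchange[of x y t ?w] by simp
    also have "y \<bullet> ?w = oct_cnj x \<bullet> (y \<odot> z)"
      using inner_oct_mult_right[of y z "oct_cnj x"] by (simp add: oct_cnj_mult inner_commute)
    also have "x \<odot> ?w = (x \<bullet> x) *\<^sub>R oct_cnj z"
      by (simp add: oct_cnj_mult oct_mult_cnj_left)
    also have "(t \<odot> y) \<bullet> ((x \<bullet> x) *\<^sub>R oct_cnj z) = (x \<bullet> x) * (oct_cnj (y \<odot> z) \<bullet> t)"
      using inner_oct_mult_right[of t y "oct_cnj z"] by (simp add: oct_cnj_mult inner_commute)
    finally show ?thesis by (simp add: inner_diff algebra_simps inner_commute)
  qed
  then show ?thesis by (metis vector_eq_rdot)
qed

definition oct_tri :: "oct \<Rightarrow> oct \<Rightarrow> oct \<Rightarrow> real" where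
  "oct_tri x y z = oct_cnj (x \<odot> y) \<bullet> z"

lemma oct_tri_rotate: "oct_tri x y z = oct_tri y z x"
proof -
  have "oct_tri x y z = (x \<odot> y) \<bullet> oct_cnj z"
    by (simp add: oct_tri_def oct_cnj_inner_commute)
  also have "\<dots> = x \<bullet> oct_cnj (y \<odot> z)"
    by (simp add: inner_oct_mult_right oct_cnj_mult)
  finally show ?thesis by (simp add: oct_tri_def inner_commute)
qed

lemma oct_complex_nth: "oct_complex x $ k = of_real (x $ k)"
  by (simp add: oct_complex_def)

lemma oct_complex_simps [simp]:
  "oct_complex (x + y) = oct_complex x + oct_complex y"
  "oct_complex (x - y) = oct_complex x - oct_complex y"
  "oct_complex (- x) = - oct_complex x"
  "oct_complex (c *\<^sub>R x) = of_real c *s oct_complex x"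
  "oct_complex (oct_of a) = oct_of (of_real a)"
  "oct_complex 0 = 0"
  by (auto simp: vec_eq_iff oct_complex_nth oct_of_nth)

lemma oct_complex_mult: "oct_complex x \<odot> oct_complex y = oct_complex (x \<odot> y)"
  by (simp add: vec_eq_iff oct_complex_nth oct_mult_def)

lemma oct_mult_cnj_polar:
  "x \<odot> oct_cnj y = oct_of (2 * (x \<bullet> y)) - y \<odot> oct_cnj x"
  "oct_cnj x \<odot> y = oct_of (2 * (x \<bullet> y)) - oct_cnj y \<odot> x" for x y :: oct
proof -
  have "x \<odot> oct_cnj y + y \<odot> oct_cnj x = oct_of (2 * (x \<bullet> y))"
    using oct_mult_cnj_self(1)[of "x + y"]
    by (simp add: oct_mult_cnj_self inner_add inner_commute algebra_simps)
      (simp add: algebra_simps flip: oct_of_simps(2))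
  then show "x \<odot> oct_cnj y = oct_of (2 * (x \<bullet> y)) - y \<odot> oct_cnj x" by (simp add: algebra_simps)
  have "oct_cnj x \<odot> y + oct_cnj y \<odot> x = oct_of (2 * (x \<bullet> y))"
    using oct_mult_cnj_self(2)[of "x + y"]
    by (simp add: oct_mult_cnj_self inner_add inner_commute algebra_simps)
      (simp add: algebra_simps flip: oct_of_simps(2))
  then show "oct_cnj x \<odot> y = oct_of (2 * (x \<bullet> y)) - oct_cnj y \<odot> x" by (simp add: algebra_simps)
qed

lemma h1_nth [simp]:
  "h1 a b c x y z $ 1 $ 1 = oct_of (of_real a)"
  "h1 a b c x y z $ 2 $ 2 = oct_of (of_real b)"
  "h1 a b c x y z $ 3 $ 3 = oct_of (of_real c)"
  "h1 a b c x y z $ 1 $ 2 = \<i> *s oct_complex z"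
  "h1 a b c x y z $ 2 $ 1 = \<i> *s oct_complex (oct_cnj z)"
  "h1 a b c x y z $ 1 $ 3 = \<i> *s oct_complex (oct_cnj y)"
  "h1 a b c x y z $ 3 $ 1 = \<i> *s oct_complex y"
  "h1 a b c x y z $ 2 $ 3 = oct_complex x"
  "h1 a b c x y z $ 3 $ 2 = oct_complex (oct_cnj x)"
  by (simp_all add: h1_def)

lemma cmat_eq_iff: "X = Y \<longleftrightarrow> X$1$1 = Y$1$1 \<and> X$1$2 = Y$1$2 \<and> X$1$3 = Y$1$3 \<and> X$2$1 = Y$2$1
    \<and> X$2$2 = Y$2$2 \<and> X$2$3 = Y$2$3 \<and> X$3$1 = Y$3$1 \<and> X$3$2 = Y$3$2 \<and> X$3$3 = Y$3$3"
  for X Y :: cmat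
  by (auto simp: vec_eq_iff[of X Y] vec_eq_iff[of "X$_" "Y$_"] forall_3)

lemma h1_add [simp]:
  "h1 a b c x y z + h1 a' b' c' x' y' z' = h1 (a + a') (b + b') (c + c') (x + x') (y + y') (z + z')"
  by (simp add: cmat_eq_iff vector_add_ldistrib)

lemma h1_scaleR [simp]:
  "r *\<^sub>R h1 a b c x y z = h1 (r * a) (r * b) (r * c) (r *\<^sub>R x) (r *\<^sub>R y) (r *\<^sub>R z)"
  by (simp add: cmat_eq_iff) (simp add: vec_eq_iff oct_complex_nth oct_of_nth complex_eq_iff)

lemma h1_minus [simp]:
  "- h1 a b c x y z = h1 (- a) (- b) (- c) (- x) (- y) (- z)"
  using h1_scaleR[of "-1" a b c x y z] by (simp del: h1_scaleR)

lemma h1_diff [simp]: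
  "h1 a b c x y z - h1 a' b' c' x' y' z' = h1 (a - a') (b - b') (c - c') (x - x') (y - y') (z - z')"
  by (simp only: diff_conv_add_uminus h1_minus h1_add)

lemma h1_eq_iff [simp]:
  "h1 a b c x y z = h1 a' b' c' x' y' z' \<longleftrightarrow> a = a' \<and> b = b' \<and> c = c' \<and> x = x' \<and> y = y' \<and> z = z'"
  by (auto simp: cmat_eq_iff) (auto simp: vec_eq_iff oct_complex_nth)

lemma h1_eq_0_iff [simp]:
  "h1 a b c x y z = 0 \<longleftrightarrow> a = 0 \<and> b = 0 \<and> c = 0 \<and> x = 0 \<and> y = 0 \<and> z = 0"
proof -
  have "h1 0 0 0 0 0 0 = 0" by (simp add: cmat_eq_iff)
  then show ?thesis using h1_eq_iff[of a b c x y z 0 0 0 0 0 0] by simp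
qed

lemma h1_in_J1 [simp]: "h1 a b c x y z \<in> J1"
  by (auto simp: J1_def)

lemma J1_cases [elim?]:
  assumes "X \<in> J1" obtains a b c x y z where "X = h1 a b c x y z"
  using assms by (auto simp: J1_def)

lemma jE_h1: "jE = h1 1 1 1 0 0 0"
  by (simp add: cmat_eq_iff jE_def)

lemma jEi_h1: "jEi 1 = h1 1 0 0 0 0 0" "jEi 2 = h1 0 1 0 0 0 0" "jEi 3 = h1 0 0 1 0 0 0"
  by (simp_all add: cmat_eq_iff jEi_def)

lemma jdiag_h1: "jdiag a b c = h1 a b c 0 0 0"
  by (simp add: jdiag_def jEi_h1)

lemma jtr_h1 [simp]: "jtr (h1 a b c x y z) = a + b + c"
  by (simp add: jtr_def sum_3 oct_of_nth)

lemma cmat_mult_nth: "cmat_mult X Y $ i $ j = X$i$1 \<odot> Y$1$j + X$i$2 \<odot> Y$2$j + X$i$3 \<odot> Y$3$j"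
  by (simp add: cmat_mult_def sum_3)

lemma jmult_h1 [simp]:
  "jmult (h1 a b c x y z) (h1 a' b' c' x' y' z') =
    h1 (a * a' - y \<bullet> y' - z \<bullet> z') (b * b' + x \<bullet> x' - z \<bullet> z') (c * c' + x \<bullet> x' - y \<bullet> y')
      ((1/2) *\<^sub>R ((b + c) *\<^sub>R x' + (b' + c') *\<^sub>R x - oct_cnj (y \<odot> z') - oct_cnj (y' \<odot> z)))
      ((1/2) *\<^sub>R ((c + a) *\<^sub>R y' + (c' + a') *\<^sub>R y + oct_cnj (z \<odot> x') + oct_cnj (z' \<odot> x)))
      ((1/2) *\<^sub>R ((a + b) *\<^sub>R z' + (a' + b') *\<^sub>R z + oct_cnj (x \<odot> y') + oct_cnj (x' \<odot> y)))"
  unfolding jmult_def cmat_eq_iff vector_scaleR_component vector_add_component cmat_mult_nth h1_nth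
  by (simp add: oct_complex_mult oct_cnj_mult vec_eq_iff oct_complex_nth
      oct_mult_cnj_polar[of x x'] oct_mult_cnj_polar[of y y'] oct_mult_cnj_polar[of z z'] oct_of_nth complex_eq_iff field_simps)

lemma jform_h1 [simp]:
  "jform (h1 a b c x y z) (h1 a' b' c' x' y' z') =
    a * a' + b * b' + c * c' + 2 * (x \<bullet> x') - 2 * (y \<bullet> y') - 2 * (z \<bullet> z')"
  by (simp add: jform_def)

lemma jcross_self_h1 [simp]:
  "jcross (h1 a b c x y z) (h1 a b c x y z) =
    h1 (b * c - x \<bullet> x) (c * a + y \<bullet> y) (a * b + z \<bullet> z)
      (- oct_cnj (y \<odot> z) - a *\<^sub>R x) (oct_cnj (z \<odot> x) - b *\<^sub>R y) (oct_cnj (x \<odot> y) - c *\<^sub>R z)"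
  by (simp add: jcross_def jE_h1 field_simps scaleR_add_left)
   (simp add: vec_eq_iff algebra_simps)

lemma jdet_h1:
  "jdet (h1 a b c x y z) = a * b * c - a * (x \<bullet> x) + b * (y \<bullet> y) + c * (z \<bullet> z) - 2 * oct_tri x y z"
proof -
  have "x \<bullet> oct_cnj (y \<odot> z) = oct_tri x y z" "y \<bullet> oct_cnj (z \<odot> x) = oct_tri x y z"
    "z \<bullet> oct_cnj (x \<odot> y) = oct_tri x y z"
    using oct_tri_rotate[of x y z] oct_tri_rotate[of y z x] by (simp_all add: oct_tri_def inner_commute)
  then show ?thesis by (simp add: jdet_def inner_diff field_simps)
qed

lemma J1_add [simp]: "X \<in> J1 \<Longrightarrow> Y \<in> J1 \<Longrightarrow> X + Y \<in> J1"
  and J1_diff [simp]: "X \<in> J1 \<Longrightarrow> Y \<in> J1 \<Longrightarrow> X - Y \<in> J1"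
  and J1_scaleR [simp]: "X \<in> J1 \<Longrightarrow> r *\<^sub>R X \<in> J1"
  and J1_minus [simp]: "X \<in> J1 \<Longrightarrow> - X \<in> J1"
  and J1_jmult [simp]: "X \<in> J1 \<Longrightarrow> Y \<in> J1 \<Longrightarrow> jmult X Y \<in> J1"
  by (auto elim!: J1_cases)

lemma J1_jE [simp]: "jE \<in> J1" and J1_jdiag [simp]: "jdiag a b c \<in> J1" and J1_jEi [simp]: "jEi k \<in> J1"
  using exhaust_3[of k] by (auto simp: jE_h1 jdiag_h1 jEi_h1)

lemma J1_jcross [simp]: "X \<in> J1 \<Longrightarrow> Y \<in> J1 \<Longrightarrow> jcross X Y \<in> J1"
  by (simp add: jcross_def)

lemma jmult_jE [simp]: "X \<in> J1 \<Longrightarrow> jmult jE X = X" "X \<in> J1 \<Longrightarrow> jmult X jE = X"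
  by (auto elim!: J1_cases simp: jE_h1 simp flip: scaleR_add_left)

lemma jform_jmult_assoc:
  assumes "X \<in> J1" "Y \<in> J1" "Z \<in> J1"
  shows "jform (jmult X Y) Z = jform X (jmult Y Z)"
proof -
  obtain a b c x y z where X: "X = h1 a b c x y z" using assms(1) by (rule J1_cases)
  obtain a' b' c' x' y' z' where Y: "Y = h1 a' b' c' x' y' z'" using assms(2) by (rule J1_cases)
  obtain a'' b'' c'' x'' y'' z'' where Z: "Z = h1 a'' b'' c'' x'' y'' z''" using assms(3) by (rule J1_cases)
  have 1: "oct_cnj (u \<odot> v) \<bullet> w = oct_tri u v w" "w \<bullet> oct_cnj (u \<odot> v) = oct_tri u v w" for u v w
    by (simp_all add: oct_tri_def inner_commute)
  have 2: "oct_tri v w u = oct_tri u v w" "oct_tri w u v = oct_tri u v w" for u v w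
    by (metis oct_tri_rotate)+
  note 3 = 2[where u=x and v=y' and w=z''] 2[where u=x and v=y'' and w=z'] 2[where u=x' and v=y and w=z''] 2[where u=x' and v=y'' and w=z] 2[where u=x'' and v=y and w=z'] 2[where u=x'' and v=y' and w=z]
  show ?thesis
    by (simp add: X Y Z inner_add inner_diff 1 3 field_simps)
qed

definition jassoc :: "cmat \<Rightarrow> cmat \<Rightarrow> cmat \<Rightarrow> cmat" where
  "jassoc X Y Z = jmult (jmult X Y) Z - jmult X (jmult Y Z)"

lemma jassoc_J1: "X \<in> J1 \<Longrightarrow> Y \<in> J1 \<Longrightarrow> Z \<in> J1 \<Longrightarrow> jassoc X Y Z \<in> J1"
  by (simp add: jassoc_def)

lemma J1_jEX: "X \<in> J1 \<Longrightarrow> jEX X t \<in> J1"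
  by (simp add: jEX_def Let_def)

lemma jtr_jassoc: "X \<in> J1 \<Longrightarrow> Y \<in> J1 \<Longrightarrow> Z \<in> J1 \<Longrightarrow> jtr (jassoc X Y Z) = 0"
  using jform_jmult_assoc[of X Y Z] by (simp add: jassoc_def jform_def linear_diff[OF jtr_linear])

lemma h1_jassoc:
  "h1 0 0 0 x 0 0 = 4 *\<^sub>R jassoc (jEi 2) (jEi 2) (h1 0 0 0 x 0 0)"
  "h1 0 0 0 0 y 0 = 4 *\<^sub>R jassoc (jEi 1) (jEi 1) (h1 0 0 0 0 y 0)"
  "h1 0 0 0 0 0 z = 4 *\<^sub>R jassoc (jEi 1) (jEi 1) (h1 0 0 0 0 0 z)"
  "h1 1 (-1) 0 0 0 0 = (-2) *\<^sub>R jassoc (h1 0 0 0 0 0 (oct_of 1)) (h1 0 0 0 0 0 (oct_of 1)) (jEi 1)"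
  "h1 1 0 (-1) 0 0 0 = (-2) *\<^sub>R jassoc (h1 0 0 0 0 (oct_of 1) 0) (h1 0 0 0 0 (oct_of 1) 0) (jEi 1)"
  by (simp_all add: jassoc_def jEi_h1 oct_of_nth flip: scaleR_diff_left)

context
  fixes g assumes g: "g \<in> F4"
begin

lemma F4_bij: "bij_betw g J1 J1"
  using g by (simp add: F4_def)

lemma F4_J1: "X \<in> J1 \<Longrightarrow> g X \<in> J1"
  using F4_bij by (rule bij_betw_apply)

lemma F4_surj: "X \<in> J1 \<Longrightarrow> \<exists>Y\<in>J1. g Y = X"
  using bij_betw_imp_surj_on[OF F4_bij] by (metis imageE)

lemma F4_inj: "X \<in> J1 \<Longrightarrow> Y \<in> J1 \<Longrightarrow> g X = g Y \<longleftrightarrow> X = Y"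
  using bij_betw_imp_inj_on[OF F4_bij] by (rule inj_on_eq_iff)

lemma F4_add: "X \<in> J1 \<Longrightarrow> Y \<in> J1 \<Longrightarrow> g (X + Y) = g X + g Y"
  and F4_scaleR: "X \<in> J1 \<Longrightarrow> g (r *\<^sub>R X) = r *\<^sub>R g X"
  and F4_jmult: "X \<in> J1 \<Longrightarrow> Y \<in> J1 \<Longrightarrow> g (jmult X Y) = jmult (g X) (g Y)"
  using g by (auto simp: F4_def)

lemma F4_diff: "X \<in> J1 \<Longrightarrow> Y \<in> J1 \<Longrightarrow> g (X - Y) = g X - g Y"
  using F4_add[of X "(-1) *\<^sub>R Y"] F4_scaleR[of Y "-1"] by simp

lemma F4_zero: "g 0 = 0"
  using F4_diff[of jE jE] by simp

lemma F4_eq_0_iff: "X \<in> J1 \<Longrightarrow> g X = 0 \<longleftrightarrow> X = 0"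
  using F4_inj[of X 0] h1_in_J1[of 0 0 0 0 0 0] F4_zero by (simp add: h1_eq_0_iff[THEN iffD2])

lemma F4_jE: "g jE = jE"
proof -
  obtain Z where Z: "Z \<in> J1" "g Z = jE" using F4_surj[of jE] by auto
  then have "jmult (g jE) jE = jE" using F4_jmult[of jE Z] by simp
  then show ?thesis by (simp add: F4_J1)
qed

lemma F4_jassoc: "X \<in> J1 \<Longrightarrow> Y \<in> J1 \<Longrightarrow> Z \<in> J1 \<Longrightarrow> g (jassoc X Y Z) = jassoc (g X) (g Y) (g Z)"
  by (simp add: jassoc_def F4_diff F4_jmult)

text \<open>The associators span the space of trace zero, which is therefore invariant under automorphisms.\<close>

lemma F4_jtr: assumes "X \<in> J1" shows "jtr (g X) = jtr X"
proof -
  have A: "jtr (g (r *\<^sub>R jassoc A B C)) = 0" if "A \<in> J1" "B \<in> J1" "C \<in> J1" for r A B C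
    using that by (simp add: F4_scaleR jassoc_J1 F4_jassoc jtr_jassoc F4_J1 linear_scale[OF jtr_linear])
  have 0: "jtr (g (h1 0 0 0 x 0 0)) = 0" "jtr (g (h1 0 0 0 0 y 0)) = 0" "jtr (g (h1 0 0 0 0 0 z)) = 0"
     "jtr (g (h1 1 (-1) 0 0 0 0)) = 0" "jtr (g (h1 1 0 (-1) 0 0 0)) = 0" for x y z
    by (subst h1_jassoc, rule A; simp)+
  obtain a b c x y z where X: "X = h1 a b c x y z" using assms by (rule J1_cases)
  define m where "m = (a + b + c) / 3"
  have "X = m *\<^sub>R jE + (m - b) *\<^sub>R h1 1 (-1) 0 0 0 0 + (m - c) *\<^sub>R h1 1 0 (-1) 0 0 0
     + h1 0 0 0 x 0 0 + h1 0 0 0 0 y 0 + h1 0 0 0 0 0 z"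
    by (simp add: X jE_h1 m_def field_simps)
  then have "g X = m *\<^sub>R jE + (m - b) *\<^sub>R g (h1 1 (-1) 0 0 0 0) + (m - c) *\<^sub>R g (h1 1 0 (-1) 0 0 0)
     + g (h1 0 0 0 x 0 0) + g (h1 0 0 0 0 y 0) + g (h1 0 0 0 0 0 z)"
    by (simp add: F4_add F4_scaleR F4_jE del: h1_add h1_scaleR)
  then show ?thesis
    by (simp add: linear_add[OF jtr_linear] linear_scale[OF jtr_linear] 0 jE_h1 X m_def del: h1_scaleR)
qed

lemma F4_jform: "X \<in> J1 \<Longrightarrow> Y \<in> J1 \<Longrightarrow> jform (g X) (g Y) = jform X Y"
  by (simp add: jform_def F4_jtr flip: F4_jmult)

lemma F4_jcross: "X \<in> J1 \<Longrightarrow> Y \<in> J1 \<Longrightarrow> g (jcross X Y) = jcross (g X) (g Y)"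
  by (simp add: jcross_def F4_diff F4_add F4_scaleR F4_jmult F4_jtr F4_jform F4_jE)

lemma F4_jdet: "X \<in> J1 \<Longrightarrow> jdet (g X) = jdet X"
  by (simp add: jdet_def F4_jform flip: F4_jcross)

lemma F4_jcharpoly: "X \<in> J1 \<Longrightarrow> jcharpoly (g X) = jcharpoly X"
  using F4_jdet[of "_ *\<^sub>R jE - X"] by (simp add: jcharpoly_def F4_diff F4_scaleR F4_jE)

lemma F4_jcharroots: "X \<in> J1 \<Longrightarrow> jcharroots (g X) = jcharroots X"
  by (simp add: jcharroots_def F4_jcharpoly)

lemma F4_jEX: "X \<in> J1 \<Longrightarrow> jEX (g X) t = g (jEX X t)"
  by (simp add: jEX_def Let_def F4_scaleR F4_jcross F4_diff F4_jE F4_jtr flip: F4_jtr)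

lemma F4_jWX: "X \<in> J1 \<Longrightarrow> jWX (g X) t = g (jWX X t)"
  by (simp add: jWX_def F4_scaleR F4_add F4_diff F4_jE F4_jtr F4_jEX J1_jEX)

lemma F4_jp: "X \<in> J1 \<Longrightarrow> jp (g X) = g (jp X)"
  by (simp add: jp_def F4_scaleR F4_diff F4_jE F4_jtr)

lemma F4_jV: "X \<in> J1 \<Longrightarrow> jV (g X) = g ` jV X"
proof -
  assume X: "X \<in> J1"
  have *: "g (a *\<^sub>R jcross X X + b *\<^sub>R X + c *\<^sub>R jE) = a *\<^sub>R jcross (g X) (g X) + b *\<^sub>R g X + c *\<^sub>R jE" for a b c
    using X by (simp add: F4_scaleR F4_add F4_jE F4_jcross)
  show ?thesis unfolding jV_def *[symmetric] by blast
qed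

end

lemma F4_restrictI:
  assumes J: "\<And>X. X \<in> J1 \<Longrightarrow> f X \<in> J1" "\<And>X. X \<in> J1 \<Longrightarrow> f' X \<in> J1"
    and inv: "\<And>X. X \<in> J1 \<Longrightarrow> f' (f X) = X" "\<And>X. X \<in> J1 \<Longrightarrow> f (f' X) = X"
    and lin: "\<And>X Y. X \<in> J1 \<Longrightarrow> Y \<in> J1 \<Longrightarrow> f (X + Y) = f X + f Y"
      "\<And>c X. X \<in> J1 \<Longrightarrow> f (c *\<^sub>R X) = c *\<^sub>R f X"
    and mult: "\<And>X Y. X \<in> J1 \<Longrightarrow> Y \<in> J1 \<Longrightarrow> f (jmult X Y) = jmult (f X) (f Y)"
  shows "restrict f J1 \<in> F4"
proof -
  have "bij_betw f J1 J1"
    by (rule bij_betw_byWitness[where f' = f']) (use J inv in auto)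
  then have "bij_betw (restrict f J1) J1 J1" by (simp add: bij_betw_restrict_eq)
  then show ?thesis by (simp add: F4_def lin mult)
qed

lemma F4_id: "restrict id J1 \<in> F4"
  by (rule F4_restrictI[where f' = id]) auto

lemma F4_comp:
  assumes "g \<in> F4" "h \<in> F4" shows "restrict (g \<circ> h) J1 \<in> F4"
proof (rule F4_restrictI[where f' = "inv_into J1 h \<circ> inv_into J1 g"])
  note b = F4_bij[OF assms(1)] F4_bij[OF assms(2)]
  show "(inv_into J1 h \<circ> inv_into J1 g) X \<in> J1" if "X \<in> J1" for X
    using that b by (metis bij_betw_apply bij_betw_inv_into comp_apply)
  show "(inv_into J1 h \<circ> inv_into J1 g) ((g \<circ> h) X) = X" if "X \<in> J1" for X
    using that b by (simp add: bij_betw_inv_into_left F4_J1[OF assms(2)])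
  show "(g \<circ> h) ((inv_into J1 h \<circ> inv_into J1 g) X) = X" if "X \<in> J1" for X
    using that b by (simp add: bij_betw_inv_into_right bij_betw_apply[OF bij_betw_inv_into])
qed (simp_all add: F4_J1 F4_add F4_scaleR F4_jmult assms)

lemma F4_inv:
  assumes g: "g \<in> F4" shows "restrict (inv_into J1 g) J1 \<in> F4"
proof (rule F4_restrictI[where f' = g])
  note b = F4_bij[OF g]
  show J: "inv_into J1 g X \<in> J1" if "X \<in> J1" for X
    using that b by (metis bij_betw_apply bij_betw_inv_into)
  show i: "g (inv_into J1 g X) = X" if "X \<in> J1" for X
    using that b by (simp add: bij_betw_inv_into_right)
  show "inv_into J1 g (g X) = X" if "X \<in> J1" for X
    using that b by (simp add: bij_betw_inv_into_left)
  show "inv_into J1 g (X + Y) = inv_into J1 g X + inv_into J1 g Y" if "X \<in> J1" "Y \<in> J1" for X Y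
    using that by (subst F4_inj[OF g, symmetric]) (simp_all add: J i F4_add[OF g])
  show "inv_into J1 g (c *\<^sub>R X) = c *\<^sub>R inv_into J1 g X" if "X \<in> J1" for c X
    using that by (subst F4_inj[OF g, symmetric]) (simp_all add: J i F4_scaleR[OF g])
  show "inv_into J1 g (jmult X Y) = jmult (inv_into J1 g X) (inv_into J1 g Y)" if "X \<in> J1" "Y \<in> J1" for X Y
    using that by (subst F4_inj[OF g, symmetric]) (simp_all add: J i F4_jmult[OF g])
qed (simp add: F4_J1[OF g])

lemma F4_orbitE:
  assumes "Y \<in> F4_orbit X" obtains g where "g \<in> F4" "g X = Y"
  using assms by (auto simp: F4_orbit_def)

subsection \<open>Conjugation by scalar matrices\<close>

definition lmat :: "complex^3^3 \<Rightarrow> cmat \<Rightarrow> cmat" where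
  "lmat A X = (\<chi> i j. A$i$1 *s X$1$j + A$i$2 *s X$2$j + A$i$3 *s X$3$j)"

definition rmat :: "cmat \<Rightarrow> complex^3^3 \<Rightarrow> cmat" where
  "rmat X A = (\<chi> i j. A$1$j *s X$i$1 + A$2$j *s X$i$2 + A$3$j *s X$i$3)"

lemma lmat_rmat: "lmat A (rmat X B) = rmat (lmat A X) B"
  by (simp add: lmat_def rmat_def vec_eq_iff algebra_simps)

lemma lmat_lmat: "lmat A (lmat B X) = lmat (A ** B) X"
  by (simp add: lmat_def vec_eq_iff matrix_matrix_mult_def sum_3 algebra_simps)

lemma rmat_rmat: "rmat (rmat X A) B = rmat X (A ** B)"
  by (simp add: rmat_def vec_eq_iff matrix_matrix_mult_def sum_3 algebra_simps)

lemma lmat_1: "lmat (mat 1) X = X" and rmat_1: "rmat X (mat 1) = X"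
  by (simp_all add: cmat_eq_iff lmat_def rmat_def mat_def)

lemma cmat_mult_lmat: "cmat_mult (lmat A X) Y = lmat A (cmat_mult X Y)"
  and cmat_mult_rmat: "cmat_mult X (rmat Y A) = rmat (cmat_mult X Y) A"
  and cmat_mult_rmat_lmat: "cmat_mult (rmat X A) Y = cmat_mult X (lmat A Y)"
  by (simp_all add: lmat_def rmat_def vec_eq_iff cmat_mult_nth algebra_simps)

definition mconj :: "complex^3^3 \<Rightarrow> complex^3^3 \<Rightarrow> cmat \<Rightarrow> cmat" where
  "mconj A B X = lmat A (rmat X B)"

lemma cmat_mult_mconj: "B ** A = mat 1 \<Longrightarrow> cmat_mult (mconj A B X) (mconj A B Y) = mconj A B (cmat_mult X Y)"
  by (simp add: mconj_def cmat_mult_lmat cmat_mult_rmat cmat_mult_rmat_lmat lmat_lmat lmat_1)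

lemma mconj_mconj: "A ** A' = mat 1 \<Longrightarrow> B' ** B = mat 1 \<Longrightarrow> mconj A B (mconj A' B' X) = X"
  by (simp add: mconj_def lmat_rmat rmat_rmat lmat_lmat lmat_1 rmat_1)

lemma mconj_add: "mconj A B (X + Y) = mconj A B X + mconj A B Y"
  by (simp add: mconj_def lmat_def rmat_def vec_eq_iff algebra_simps)

lemma mconj_scaleR: "mconj A B (c *\<^sub>R X) = c *\<^sub>R mconj A B X"
  by (simp add: mconj_def lmat_def rmat_def vec_eq_iff algebra_simps)

lemma F4_mconjI:
  assumes "A ** B = mat 1" "B ** A = mat 1"
    and "\<And>X. X \<in> J1 \<Longrightarrow> mconj A B X \<in> J1" "\<And>X. X \<in> J1 \<Longrightarrow> mconj B A X \<in> J1"
  shows "restrict (mconj A B) J1 \<in> F4"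
  by (rule F4_restrictI[where f' = "mconj B A"])
    (use assms in \<open>simp_all add: mconj_mconj mconj_add mconj_scaleR jmult_def cmat_mult_mconj\<close>)

definition rotm :: "real \<Rightarrow> real \<Rightarrow> complex^3^3" where
  "rotm c s = vector [vector [1, 0, 0], vector [0, of_real c, of_real s], vector [0, - of_real s, of_real c]]"

definition boostm :: "real \<Rightarrow> real \<Rightarrow> complex^3^3" where
  "boostm c s = vector [vector [of_real c, \<i> * of_real s, 0], vector [- \<i> * of_real s, of_real c, 0], vector [0, 0, 1]]"

lemma rotm_inverse: "c\<^sup>2 + s\<^sup>2 = 1 \<Longrightarrow> rotm c s ** rotm c (- s) = mat 1"
  by (simp add: rotm_def vec_eq_iff forall_3 matrix_matrix_mult_def sum_3 mat_def power2_eq_square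
      flip: of_real_mult of_real_add)

lemma boostm_inverse: "c\<^sup>2 - s\<^sup>2 = 1 \<Longrightarrow> boostm c s ** boostm c (- s) = mat 1"
  by (simp add: boostm_def vec_eq_iff forall_3 matrix_matrix_mult_def sum_3 mat_def power2_eq_square
      complex_eq_iff)

lemma mconj_rotm:
  "mconj (rotm c s) (rotm c (- s)) (h1 \<xi>1 \<xi>2 \<xi>3 x y z) =
    h1 \<xi>1 (c\<^sup>2 * \<xi>2 + s\<^sup>2 * \<xi>3 + 2 * c * s * x $ 0) (s\<^sup>2 * \<xi>2 + c\<^sup>2 * \<xi>3 - 2 * c * s * x $ 0)
      (oct_of (c * s * (\<xi>3 - \<xi>2)) + c\<^sup>2 *\<^sub>R x - s\<^sup>2 *\<^sub>R oct_cnj x)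
      (c *\<^sub>R y - s *\<^sub>R oct_cnj z) (c *\<^sub>R z + s *\<^sub>R oct_cnj y)"
  by (simp add: cmat_eq_iff mconj_def lmat_def rmat_def rotm_def)
    (simp add: vec_eq_iff oct_complex_nth oct_cnj_nth oct_of_nth complex_eq_iff power2_eq_square algebra_simps)

lemma mconj_boostm:
  "mconj (boostm c s) (boostm c (- s)) (h1 \<xi>1 \<xi>2 \<xi>3 x y z) =
    h1 (c\<^sup>2 * \<xi>1 - s\<^sup>2 * \<xi>2 - 2 * c * s * z $ 0) (c\<^sup>2 * \<xi>2 - s\<^sup>2 * \<xi>1 + 2 * c * s * z $ 0) \<xi>3
      (c *\<^sub>R x + s *\<^sub>R oct_cnj y) (c *\<^sub>R y + s *\<^sub>R oct_cnj x)
      (oct_of (c * s * (\<xi>2 - \<xi>1)) + c\<^sup>2 *\<^sub>R z + s\<^sup>2 *\<^sub>R oct_cnj z)"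
  by (simp add: cmat_eq_iff mconj_def lmat_def rmat_def boostm_def)
    (simp add: vec_eq_iff oct_complex_nth oct_cnj_nth oct_of_nth complex_eq_iff power2_eq_square algebra_simps)

lemma F4_rotm: "c\<^sup>2 + s\<^sup>2 = 1 \<Longrightarrow> restrict (mconj (rotm c s) (rotm c (- s))) J1 \<in> F4"
  using rotm_inverse[of c s] rotm_inverse[of c "- s"] mconj_rotm[of c s] mconj_rotm[of c "- s"]
  by (intro F4_mconjI) (auto elim!: J1_cases)

lemma F4_boostm: "c\<^sup>2 - s\<^sup>2 = 1 \<Longrightarrow> restrict (mconj (boostm c s) (boostm c (- s))) J1 \<in> F4"
  using boostm_inverse[of c s] boostm_inverse[of c "- s"] mconj_boostm[of c s] mconj_boostm[of c "- s"]
  by (intro F4_mconjI) (auto elim!: J1_cases)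

subsection \<open>Triality\<close>

definition triality :: "(oct \<Rightarrow> oct) \<Rightarrow> (oct \<Rightarrow> oct) \<Rightarrow> (oct \<Rightarrow> oct) \<Rightarrow> bool" where
  "triality T1 T2 T3 \<longleftrightarrow> orthogonal_transformation T1 \<and> orthogonal_transformation T2
    \<and> orthogonal_transformation T3 \<and> (\<forall>x y z. oct_tri (T1 x) (T2 y) (T3 z) = oct_tri x y z)"

lemma triality_rotate: "triality T1 T2 T3 \<Longrightarrow> triality T2 T3 T1"
  unfolding triality_def by (intro conjI allI; (elim conjE)?; (assumption | (subst (1 2) oct_tri_rotate[symmetric], blast)))

lemma triality_cnj_mult:
  assumes "triality T1 T2 T3" shows "T3 (oct_cnj (x \<odot> y)) = oct_cnj (T1 x \<odot> T2 y)"
proof -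
  have "oct_cnj (T1 x \<odot> T2 y) \<bullet> T3 z = T3 (oct_cnj (x \<odot> y)) \<bullet> T3 z" for z
    using assms by (auto simp: triality_def oct_tri_def orthogonal_transformation_def)
  moreover have "surj T3" using assms by (simp add: triality_def orthogonal_transformation_surj)
  ultimately show ?thesis by (metis surjD vector_eq_rdot)
qed

definition oct_refl :: "oct \<Rightarrow> oct \<Rightarrow> oct" where
  "oct_refl a z = (2 * (a \<bullet> z)) *\<^sub>R oct_cnj a - oct_cnj z"

text \<open>In terms of products, the third map is \<open>z \<mapsto> cnj a \<odot> z \<odot> cnj a\<close>.\<close>

lemma triality_mult:
  assumes a: "a \<bullet> a = 1"
  shows "triality (\<lambda>x. a \<odot> x) (\<lambda>y. y \<odot> a) (oct_refl a)"
proof -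
  have "oct_tri (a \<odot> x) (y \<odot> a) (oct_refl a z) = oct_tri x y z" for x y z
  proof -
    define b w p q where "b = oct_cnj a" and "w = x \<odot> y" and "p = b \<bullet> w" and "q = a \<bullet> z"
    have b: "b \<bullet> b = 1" "b \<bullet> oct_cnj z = q" "w \<bullet> b = p"
      using a by (simp_all add: b_def q_def p_def inner_commute)
    have "oct_tri (a \<odot> x) (y \<odot> a) (oct_refl a z)
        = ((2 * p) *\<^sub>R b - w) \<bullet> ((2 * q) *\<^sub>R b - oct_cnj z)"
      by (simp add: oct_tri_def oct_Moufang a oct_refl_def b_def w_def p_def q_def)
    also have "\<dots> = oct_tri x y z"
      using b by (simp add: inner_diff oct_tri_def oct_cnj_inner_commute[of w z] flip: w_def)
    finally show ?thesis .
  qed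
  moreover have "orthogonal_transformation (\<lambda>x. a \<odot> x)" "orthogonal_transformation (\<lambda>y. y \<odot> a)"
    using a by (simp_all add: orthogonal_transformation_def oct_mult_norm_left oct_mult_norm_right linear_iff)
  moreover have "orthogonal_transformation (oct_refl a)"
    unfolding orthogonal_transformation_def
  proof (intro conjI allI)
    show "linear (oct_refl a)"
      by (rule linearI) (simp_all add: oct_refl_def inner_add scaleR_add_left algebra_simps)
    show "oct_refl a v \<bullet> oct_refl a w = v \<bullet> w" for v w
    proof -
      have "oct_cnj v \<bullet> oct_cnj a = a \<bullet> v" by (simp add: inner_commute)
      then show ?thesis unfolding oct_refl_def
        by (simp add: inner_diff_left inner_diff_right a)
    qed
  qed
  ultimately show ?thesis by (simp add: triality_def)
qed

definition spin8 :: "(oct \<Rightarrow> oct) \<Rightarrow> (oct \<Rightarrow> oct) \<Rightarrow> (oct \<Rightarrow> oct) \<Rightarrow> cmat \<Rightarrow> cmat" where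
  "spin8 T1 T2 T3 X = h1 (Re (X$1$1$0)) (Re (X$2$2$0)) (Re (X$3$3$0))
     (T1 (\<chi> k. Re (X$2$3$k))) (T2 (\<chi> k. Im (X$3$1$k))) (T3 (\<chi> k. Im (X$1$2$k)))"

lemma spin8_h1 [simp]: "spin8 T1 T2 T3 (h1 a b c x y z) = h1 a b c (T1 x) (T2 y) (T3 z)"
  by (simp add: spin8_def oct_of_nth oct_complex_nth vec_lambda_eta)

lemma F4_spin8:
  assumes T: "triality T1 T2 T3"
  shows "restrict (spin8 T1 T2 T3) J1 \<in> F4"
proof -
  have o: "orthogonal_transformation T1" "orthogonal_transformation T2" "orthogonal_transformation T3"
    using T by (auto simp: triality_def)
  note l = o[THEN orthogonal_transformation_linear]
  note lin = l[THEN linear_add] l[THEN linear_diff] l[THEN linear_scale]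
  have i: "T1 x \<bullet> T1 y = x \<bullet> y" "T2 x \<bullet> T2 y = x \<bullet> y" "T3 x \<bullet> T3 y = x \<bullet> y" for x y
    using o by (auto simp: orthogonal_transformation_def)
  note s = o[THEN orthogonal_transformation_surj, THEN surj_f_inv_f]
    o[THEN orthogonal_transformation_inj, THEN inv_f_f]
  note m = triality_cnj_mult[OF T] triality_cnj_mult[OF triality_rotate[OF T]]
    triality_cnj_mult[OF triality_rotate[OF triality_rotate[OF T]]]
  show ?thesis
  proof (rule F4_restrictI[where f' = "spin8 (inv T1) (inv T2) (inv T3)"])
    show "spin8 T1 T2 T3 (jmult X Y) = jmult (spin8 T1 T2 T3 X) (spin8 T1 T2 T3 Y)" if "X \<in> J1" "Y \<in> J1" for X Y
      using that by (auto elim!: J1_cases simp: lin i m)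
  qed (auto elim!: J1_cases simp: lin s)
qed

subsection \<open>The cone of non-negative trace\<close>

definition jcone :: "cmat set" where
  "jcone = {X \<in> J1. jcross X X = 0 \<and> jtr X \<ge> 0 \<and> jform X (jEi 1) > 0}"

definition F4c :: "(cmat \<Rightarrow> cmat) set" where
  "F4c = {g \<in> F4. \<forall>X\<in>J1. g X \<in> jcone \<longleftrightarrow> X \<in> jcone}"

definition reach :: "cmat \<Rightarrow> cmat \<Rightarrow> bool" where
  "reach X Y \<longleftrightarrow> (\<exists>g\<in>F4c. g X = Y)"

lemma jcone_h1: "h1 a b c x y z \<in> jcone \<longleftrightarrow> jcross (h1 a b c x y z) (h1 a b c x y z) = 0 \<and> a + b + c \<ge> 0 \<and> a > 0"
  by (simp add: jcone_def jEi_h1)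

lemma F4_jcone_iff:
  assumes "g \<in> F4" "X \<in> J1"
  shows "g X \<in> jcone \<longleftrightarrow> jcross X X = 0 \<and> jtr X \<ge> 0 \<and> jform (g X) (jEi 1) > 0"
  using assms by (simp add: jcone_def F4_J1 F4_jtr F4_eq_0_iff flip: F4_jcross)

lemma F4c_fix11:
  assumes "restrict f J1 \<in> F4" "\<And>X. X \<in> J1 \<Longrightarrow> jform (f X) (jEi 1) = jform X (jEi 1)"
  shows "restrict f J1 \<in> F4c"
  using assms(1) F4_jcone_iff[OF assms(1)] by (simp add: F4c_def assms(2)) (simp add: jcone_def)

lemma F4c_rotm: "c\<^sup>2 + s\<^sup>2 = 1 \<Longrightarrow> restrict (mconj (rotm c s) (rotm c (- s))) J1 \<in> F4c"
  by (intro F4c_fix11 F4_rotm) (auto elim!: J1_cases simp: mconj_rotm jEi_h1)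

lemma F4c_spin8: "triality T1 T2 T3 \<Longrightarrow> restrict (spin8 T1 T2 T3) J1 \<in> F4c"
  by (intro F4c_fix11 F4_spin8) (auto elim!: J1_cases simp: jEi_h1)

text \<open>On the cone, \<open>|z|\<^sup>2 = - a b\<close>, so a boost maps the entry \<open>a\<close> to at least
  \<open>(c \<surd>a - |s| \<surd>(-b))\<^sup>2\<close>.\<close>

lemma jcone_boostm:
  assumes cs: "c\<^sup>2 - s\<^sup>2 = 1" and X: "X \<in> jcone"
  shows "jform (mconj (boostm c s) (boostm c (- s)) X) (jEi 1) > 0"
proof -
  have "X \<in> J1" using X by (simp add: jcone_def)
  then obtain a b d x y z where Xh: "X = h1 a b d x y z" by (rule J1_cases)
  have a: "a > 0" "a + b + d \<ge> 0" and zz: "z \<bullet> z = - (a * b)" and yy: "y \<bullet> y = - (d * a)"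
    using X unfolding Xh jcone_h1 jcross_self_h1 h1_eq_0_iff by linarith+
  have "d \<le> 0" "b \<le> 0" using zz yy a(1) inner_ge_zero[of z] inner_ge_zero[of y]
    by (simp_all add: mult_le_0_iff)
  define p q where "p = sqrt a" and "q = sqrt (- b)"
  have p: "p > 0" "p\<^sup>2 = a" and q: "q \<ge> 0" "q\<^sup>2 = - b" "q \<le> p"
    using a \<open>d \<le> 0\<close> \<open>b \<le> 0\<close> by (auto simp: p_def q_def)
  have "(z $ 0)\<^sup>2 \<le> z \<bullet> z" by (simp add: inner_8 power2_eq_square)
  then have "(z $ 0)\<^sup>2 \<le> (p * q)\<^sup>2" using zz by (simp add: power_mult_distrib p q)
  then have z0: "\<bar>z $ 0\<bar> \<le> p * q" using p(1) q(1) by (simp add: abs_le_square_iff[symmetric])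
  have "\<bar>s\<bar>\<^sup>2 < \<bar>c\<bar>\<^sup>2" using cs by simp
  then have "\<bar>s\<bar> < \<bar>c\<bar>" by (rule power2_less_imp_less) simp
  then have "\<bar>s\<bar> * p < \<bar>c\<bar> * p" using p by simp
  moreover have "\<bar>s\<bar> * q \<le> \<bar>s\<bar> * p" using q by (simp add: mult_left_mono)
  ultimately have "\<bar>s\<bar> * q < \<bar>c\<bar> * p" by linarith
  then have "0 < (\<bar>c\<bar> * p - \<bar>s\<bar> * q)\<^sup>2" by simp
  also have "\<dots> = c\<^sup>2 * a - s\<^sup>2 * b - 2 * \<bar>c * s\<bar> * (p * q)"
    using p(2) q(2) by (simp add: power2_diff power_mult_distrib abs_mult)
  also have "\<dots> \<le> c\<^sup>2 * a - s\<^sup>2 * b - 2 * (c * s * z $ 0)"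
  proof -
    have "c * s * z $ 0 \<le> \<bar>c * s\<bar> * \<bar>z $ 0\<bar>" by (metis abs_ge_self abs_mult)
    also have "\<dots> \<le> \<bar>c * s\<bar> * (p * q)" using z0 by (simp add: mult_left_mono)
    finally show ?thesis by simp
  qed
  finally show ?thesis by (simp add: Xh mconj_boostm jEi_h1 mult.assoc)
qed

lemma F4c_boostm:
  assumes cs: "c\<^sup>2 - s\<^sup>2 = 1"
  shows "restrict (mconj (boostm c s) (boostm c (- s))) J1 \<in> F4c"
proof -
  let ?f = "mconj (boostm c s) (boostm c (- s))" and ?f' = "mconj (boostm c (- s)) (boostm c s)"
  note g = F4_boostm[of c s] F4_boostm[of c "- s"]
  have inv: "?f' (?f X) = X" for X
    using boostm_inverse[of c s] boostm_inverse[of c "- s"] cs by (simp add: mconj_mconj)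
  have *: "mconj (boostm c s) (boostm c (- s)) X \<in> jcone" if "c\<^sup>2 - s\<^sup>2 = 1" "X \<in> jcone" for s X
  proof -
    have X: "X \<in> J1" using that(2) by (simp add: jcone_def)
    show ?thesis
      using F4_jcone_iff[OF F4_boostm[OF that(1)] X] jcone_boostm[OF that] that(2) X
      by (simp add: jcone_def)
  qed
  have "?f X \<in> jcone \<longleftrightarrow> X \<in> jcone" if "X \<in> J1" for X
    using *[of s X] *[of "- s" "?f X"] cs inv[of X] by auto
  then show ?thesis using g(1)[OF cs] by (simp add: F4c_def)
qed

lemma reach_refl: "X \<in> J1 \<Longrightarrow> reach X X"
  unfolding reach_def F4c_def using F4_id by (intro bexI[of _ "restrict id J1"]) auto

lemma reach_trans:
  assumes "reach X Y" "reach Y Z" "X \<in> J1" shows "reach X Z"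
proof -
  obtain g h where "g \<in> F4c" "h \<in> F4c" "g X = Y" "h Y = Z" using assms by (auto simp: reach_def)
  then show ?thesis unfolding reach_def F4c_def
    using F4_comp[of h g] F4_J1 assms(3) by (intro bexI[of _ "restrict (h \<circ> g) J1"]) auto
qed

lemma reach_rotm: "c\<^sup>2 + s\<^sup>2 = 1 \<Longrightarrow> X \<in> J1 \<Longrightarrow> reach X (mconj (rotm c s) (rotm c (- s)) X)"
  and reach_boostm: "c\<^sup>2 - s\<^sup>2 = 1 \<Longrightarrow> X \<in> J1 \<Longrightarrow> reach X (mconj (boostm c s) (boostm c (- s)) X)"
  and reach_spin8: "triality T1 T2 T3 \<Longrightarrow> X \<in> J1 \<Longrightarrow> reach X (spin8 T1 T2 T3 X)"
  unfolding reach_def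
  using F4c_rotm[of c s] F4c_boostm[of c s] F4c_spin8[of T1 T2 T3] by (metis restrict_apply')+

subsection \<open>Reduction to real entries\<close>

lemma triality_id: "triality (\<lambda>x. x) (\<lambda>x. x) (\<lambda>x. x)"
  by (simp add: triality_def orthogonal_transformation_def linear_iff)

lemma triality_comp:
  "triality S1 S2 S3 \<Longrightarrow> triality T1 T2 T3 \<Longrightarrow> triality (S1 \<circ> T1) (S2 \<circ> T2) (S3 \<circ> T3)"
  by (simp add: triality_def orthogonal_transformation_compose)

lemma triality_zero: "triality T1 T2 T3 \<Longrightarrow> T3 0 = 0"
  by (simp add: triality_def orthogonal_transformation_linear linear_0)

lemma triality_refl_mult:
  assumes "a \<bullet> a = 1"
  shows "triality (oct_refl a) (\<lambda>x. a \<odot> x) (\<lambda>x. x \<odot> a)"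
  by (rule triality_rotate[OF triality_rotate[OF triality_mult[OF assms]]])

lemma oct_refl_oct_of: "a $ 0 = 0 \<Longrightarrow> oct_refl a (oct_of r) = oct_of (- r)"
  by (simp add: oct_refl_def)

lemma imaginary_eq: "x $ 0 = 0 \<Longrightarrow> oct_cnj x = - x" for x :: oct
  by (simp add: oct_cnj_conv)

lemma norm_oct_cnj [simp]: "norm (oct_cnj x) = norm (x :: oct)"
  by (simp add: norm_eq_sqrt_inner)

lemma inner_self_div_norm: "x \<bullet> x / norm x = norm x"
proof -
  have "x \<bullet> x = norm x * norm x" by (simp only: power2_norm_eq_inner flip: power2_eq_square)
  then show ?thesis by simp
qed

lemma ex_triality_real1:
  obtains T1 T2 T3 r where "triality T1 T2 T3" "T1 x = oct_of r"
proof (cases "x = 0")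
  case True
  show thesis by (rule that[OF triality_id, of 0]) (simp add: True)
next
  case False
  define a where "a = (1 / norm x) *\<^sub>R oct_cnj x"
  have "norm a = 1" using False by (simp add: a_def)
  then have "a \<bullet> a = 1" by (simp add: norm_eq_1)
  moreover have "a \<odot> x = oct_of (norm x)"
    by (simp add: a_def oct_mult_cnj_self inner_self_div_norm)
  ultimately show thesis by (rule that[OF triality_mult])
qed

text \<open>A unit \<open>a\<close> orthogonal to \<open>1\<close> and to \<open>cnj y\<close> makes \<open>a \<odot> y\<close> imaginary; the unit imaginary
  multiple \<open>b\<close> of \<open>a \<odot> y\<close> then makes \<open>b \<odot> (a \<odot> y)\<close> real.\<close>

lemma ex_triality_real2:
  obtains T1 T2 T3 s where "triality T1 T2 T3" "\<And>r. T1 (oct_of r) = oct_of r \<or> T1 (oct_of r) = oct_of (- r)" "T2 y = oct_of s"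
proof -
  have "dim {oct_of 1, oct_cnj y} \<le> card {oct_of 1, oct_cnj y}" by (rule dim_le_card') simp
  also have "\<dots> \<le> 2" by (simp add: card_insert_if)
  also have "\<dots> < DIM(oct)" by simp
  finally obtain a0 where a0: "a0 \<noteq> 0" "\<And>v. v \<in> span {oct_of 1, oct_cnj y} \<Longrightarrow> orthogonal a0 v"
    by (rule orthogonal_to_subspace_exists) auto
  define a where "a = (1 / norm a0) *\<^sub>R a0"
  have "norm a = 1" using a0(1) by (simp add: a_def)
  then have a1: "a \<bullet> a = 1" by (simp add: norm_eq_1)
  have "a0 \<bullet> oct_of 1 = 0" "a0 \<bullet> oct_cnj y = 0"
    using a0(2)[of "oct_of 1"] a0(2)[of "oct_cnj y"] by (simp_all add: orthogonal_def span_base)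
  then have a2: "a $ 0 = 0" and "a \<bullet> oct_cnj y = 0" by (auto simp: a_def)
  define w where "w = a \<odot> y"
  have "w \<bullet> oct_of 1 = a \<bullet> oct_cnj y" unfolding w_def inner_oct_mult_right by simp
  then have w0: "w $ 0 = 0" using \<open>a \<bullet> oct_cnj y = 0\<close> by simp
  show thesis
  proof (cases "w = 0")
    case True
    then show thesis using that[OF triality_refl_mult[OF a1], where s = 0] a2
      by (simp add: oct_refl_oct_of w_def)
  next
    case False
    define b where "b = (1 / norm w) *\<^sub>R w"
    have "norm b = 1" using False by (simp add: b_def)
    then have b1: "b \<bullet> b = 1" by (simp add: norm_eq_1)
    have "- (w \<odot> w) = oct_of (w \<bullet> w)"
      using oct_mult_cnj_self(1)[of w] by (simp only: imaginary_eq[OF w0] oct_mult_minus)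
    then have "w \<odot> w = - oct_of (w \<bullet> w)" by (metis minus_minus)
    then have "b \<odot> w = oct_of (- norm w)"
      by (simp add: b_def inner_self_div_norm)
    then show thesis
      using that[OF triality_comp[OF triality_refl_mult[OF b1] triality_refl_mult[OF a1]], where s = "- norm w"] a2 w0
      by (simp add: oct_refl_oct_of w_def[symmetric]) (simp add: oct_refl_oct_of b_def)
  qed
qed

lemma ex_triality_real:
  obtains T1 T2 T3 r s where "triality T1 T2 T3" "T1 x = oct_of r" "T2 y = oct_of s"
proof -
  obtain S1 S2 S3 r where S: "triality S1 S2 S3" "S1 x = oct_of r" by (rule ex_triality_real1)
  obtain T1 T2 T3 s where T: "triality T1 T2 T3" "\<And>r. T1 (oct_of r) = oct_of r \<or> T1 (oct_of r) = oct_of (- r)"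
    "T2 (S2 y) = oct_of s" using ex_triality_real2[of "S2 y"] by blast
  show thesis
    using T(2)[of r] that[OF triality_comp[OF T(1) S(1)]] S(2) T(3) by (metis comp_apply)
qed

abbreviation rh :: "real \<Rightarrow> real \<Rightarrow> real \<Rightarrow> real \<Rightarrow> real \<Rightarrow> real \<Rightarrow> cmat" where
  "rh a b c x y z \<equiv> h1 a b c (oct_of x) (oct_of y) (oct_of z)"

lemma reach_rot:
  assumes "C\<^sup>2 + S\<^sup>2 = 1"
  shows "reach (rh a b c x y z) (rh a (C\<^sup>2 * b + S\<^sup>2 * c + 2 * C * S * x) (S\<^sup>2 * b + C\<^sup>2 * c - 2 * C * S * x)
    (C * S * (c - b) + (C\<^sup>2 - S\<^sup>2) * x) (C * y - S * z) (C * z + S * y))"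
  using reach_rotm[OF assms, of "rh a b c x y z"] by (simp add: mconj_rotm oct_of_nth algebra_simps)

lemma reach_boost:
  assumes "C\<^sup>2 - S\<^sup>2 = 1"
  shows "reach (rh a b c x y z) (rh (C\<^sup>2 * a - S\<^sup>2 * b - 2 * C * S * z) (C\<^sup>2 * b - S\<^sup>2 * a + 2 * C * S * z) c
    (C * x + S * y) (C * y + S * x) (C * S * (b - a) + (C\<^sup>2 + S\<^sup>2) * z))"
  using reach_boostm[OF assms, of "rh a b c x y z"] by (simp add: mconj_boostm oct_of_nth algebra_simps)

lemma ex_unit_annihilating:
  fixes p q :: real
  obtains C S where "C\<^sup>2 + S\<^sup>2 = 1" "C * p + S * q = 0"
proof (cases "p = 0 \<and> q = 0")
  case True
  then show thesis using that[of 1 0] by simp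
next
  case False
  define \<rho> where "\<rho> = sqrt (p\<^sup>2 + q\<^sup>2)"
  have "p\<^sup>2 + q\<^sup>2 > 0" using False by (simp add: sum_power2_gt_zero_iff)
  then have "\<rho>\<^sup>2 = p\<^sup>2 + q\<^sup>2" "\<rho> \<noteq> 0" by (auto simp: \<rho>_def)
  then have "(q / \<rho>)\<^sup>2 + (- p / \<rho>)\<^sup>2 = 1"
    using False by (simp add: power_divide add.commute[of "q\<^sup>2"] flip: add_divide_distrib)
  then show thesis by (rule that) (simp add: mult.commute)
qed

lemma reach_tridiagonal:
  assumes "X \<in> J1"
  obtains a b c x y where "reach X (rh a b c x y 0)"
proof -
  obtain a b c x y z where X: "X = h1 a b c x y z" using assms by (rule J1_cases)
  obtain T1 T2 T3 r s where T: "triality T1 T2 T3" "T1 y = oct_of r" "T2 z = oct_of s"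
    by (rule ex_triality_real)
  have 1: "reach X (h1 a b c (T3 x) (oct_of r) (oct_of s))"
    using reach_spin8[OF triality_rotate[OF triality_rotate[OF T(1)]] assms] T(2,3) by (simp add: X)
  obtain C S where CS: "C\<^sup>2 + S\<^sup>2 = 1" "C * s + S * r = 0" by (rule ex_unit_annihilating)
  obtain b' c' x' y' where 2: "reach (h1 a b c (T3 x) (oct_of r) (oct_of s)) (h1 a b' c' x' y' 0)"
    using reach_rotm[OF CS(1), of "h1 a b c (T3 x) (oct_of r) (oct_of s)"] CS(2) by (simp add: mconj_rotm)
  obtain U1 U2 U3 p q where U: "triality U1 U2 U3" "U1 x' = oct_of p" "U2 y' = oct_of q"
    by (rule ex_triality_real)
  have 3: "reach (h1 a b' c' x' y' 0) (rh a b' c' p q 0)"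
    using reach_spin8[OF U(1), of "h1 a b' c' x' y' 0"] U triality_zero[OF U(1)] by simp
  show thesis
    using that reach_trans[OF 1 reach_trans[OF 2 3]] assms by simp
qed

subsection \<open>Reduction of real elements to canonical forms\<close>

definition reducible :: "cmat \<Rightarrow> bool" where
  "reducible X \<longleftrightarrow> (\<exists>n\<in>{1..12}. \<exists>Y\<in>canonical_forms n. reach X Y)"

lemma J1_canonical [simp]: "jF3 x \<in> J1" "Pplus \<in> J1" "Pminus \<in> J1" "Qplus x \<in> J1"
  by (simp_all add: jF3_def Pplus_def Pminus_def Qplus_def)

lemma canonical_formsI:
  "l1 > l2 \<Longrightarrow> l2 > l3 \<Longrightarrow> jdiag l1 l2 l3 \<in> canonical_forms 1"
  "l1 > l2 \<Longrightarrow> l2 > l3 \<Longrightarrow> jdiag l2 l3 l1 \<in> canonical_forms 2"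
  "l1 > l2 \<Longrightarrow> l2 > l3 \<Longrightarrow> jdiag l3 l1 l2 \<in> canonical_forms 3"
  "q > 0 \<Longrightarrow> jdiag p p l1 + jF3 (oct_of q) \<in> canonical_forms 4"
  "l1 \<noteq> l2 \<Longrightarrow> jdiag l1 l2 l2 \<in> canonical_forms 5"
  "l1 \<noteq> l2 \<Longrightarrow> jdiag l2 l2 l1 \<in> canonical_forms 6"
  "l1 \<noteq> l2 \<Longrightarrow> jdiag l2 l2 l1 + Pplus \<in> canonical_forms 7"
  "l1 \<noteq> l2 \<Longrightarrow> jdiag l2 l2 l1 + Pminus \<in> canonical_forms 8"
  "r *\<^sub>R jE \<in> canonical_forms 9"
  "r *\<^sub>R jE + Pplus \<in> canonical_forms 10"
  "r *\<^sub>R jE + Pminus \<in> canonical_forms 11"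
  "r *\<^sub>R jE + Qplus (oct_of 1) \<in> canonical_forms 12"
  unfolding canonical_forms_def
  by (simp_all del: ex_simps; blast)+

lemma reducible_reach: "reach X Y \<Longrightarrow> reducible Y \<Longrightarrow> X \<in> J1 \<Longrightarrow> reducible X"
  unfolding reducible_def using reach_trans by blast

lemma reducible_rot:
  assumes "C\<^sup>2 + S\<^sup>2 = 1"
    "reducible (rh a (C\<^sup>2 * b + S\<^sup>2 * c + 2 * C * S * x) (S\<^sup>2 * b + C\<^sup>2 * c - 2 * C * S * x)
    (C * S * (c - b) + (C\<^sup>2 - S\<^sup>2) * x) (C * y - S * z) (C * z + S * y))"
  shows "reducible (rh a b c x y z)"
  by (rule reducible_reach[OF reach_rot[OF assms(1)] assms(2)]) simp

lemma reducible_boost: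
  assumes "C\<^sup>2 - S\<^sup>2 = 1"
    "reducible (rh (C\<^sup>2 * a - S\<^sup>2 * b - 2 * C * S * z) (C\<^sup>2 * b - S\<^sup>2 * a + 2 * C * S * z) c
    (C * x + S * y) (C * y + S * x) (C * S * (b - a) + (C\<^sup>2 + S\<^sup>2) * z))"
  shows "reducible (rh a b c x y z)"
  by (rule reducible_reach[OF reach_boost[OF assms(1)] assms(2)]) simp

lemma reducible_swap: "reducible (rh a c b (- x) (- z) y) \<Longrightarrow> reducible (rh a b c x y z)"
  by (rule reducible_rot[of 0 1]) simp_all

lemma reducible_flip: "reducible (rh a b c x (- y) (- z)) \<Longrightarrow> reducible (rh a b c x y z)"
  by (rule reducible_rot[of "-1" 0]) simp_all

lemma reducibleI: "Y \<in> canonical_forms n \<Longrightarrow> n \<in> {1..12} \<Longrightarrow> Y \<in> J1 \<Longrightarrow> reducible Y"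
  unfolding reducible_def using reach_refl by blast

lemma ex_rotation_angle:
  fixes p q :: real
  obtains C S where "C\<^sup>2 + S\<^sup>2 = 1" "(C\<^sup>2 - S\<^sup>2) * p = 2 * C * S * q"
proof -
  obtain t where t: "p = sqrt (p\<^sup>2 + q\<^sup>2) * sin t" "q = sqrt (p\<^sup>2 + q\<^sup>2) * cos t"
  proof (cases "p = 0 \<and> q = 0")
    case True
    then show thesis using that[of 0] by simp
  next
    case False
    then have *: "p\<^sup>2 + q\<^sup>2 > 0" by (simp add: sum_power2_gt_zero_iff)
    then have "(q / sqrt (p\<^sup>2 + q\<^sup>2))\<^sup>2 + (p / sqrt (p\<^sup>2 + q\<^sup>2))\<^sup>2 = (p\<^sup>2 + q\<^sup>2) / (p\<^sup>2 + q\<^sup>2)"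
      by (simp add: power_divide add.commute flip: add_divide_distrib)
    also have "\<dots> = 1" using * by (intro divide_self) (rule less_imp_neq[symmetric])
    finally obtain t where "q / sqrt (p\<^sup>2 + q\<^sup>2) = cos t" "p / sqrt (p\<^sup>2 + q\<^sup>2) = sin t"
      by (rule sincos_total_2pi)
    moreover have "sqrt (p\<^sup>2 + q\<^sup>2) \<noteq> 0" using real_sqrt_gt_zero[OF *] by linarith
    ultimately show thesis
      using that[of t] nonzero_divide_eq_eq[of "sqrt (p\<^sup>2 + q\<^sup>2)"] by (metis mult.commute)
  qed
  define C S where "C = cos (t / 2)" and "S = sin (t / 2)"
  have "sin t = 2 * S * C" "cos t = C\<^sup>2 - S\<^sup>2"
    using sin_double[of "t / 2"] cos_double[of "t / 2"] by (simp_all add: C_def S_def)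
  then have "(C\<^sup>2 - S\<^sup>2) * (sqrt (p\<^sup>2 + q\<^sup>2) * sin t) = 2 * C * S * (sqrt (p\<^sup>2 + q\<^sup>2) * cos t)"
    by simp
  then have "(C\<^sup>2 - S\<^sup>2) * p = 2 * C * S * q" using t by simp
  moreover have "C\<^sup>2 + S\<^sup>2 = 1" by (simp add: C_def S_def)
  ultimately show thesis by (rule that[rotated])
qed

lemma ex_boost_rapidity:
  fixes p q :: real
  assumes "p\<^sup>2 < q\<^sup>2"
  obtains C S where "C\<^sup>2 - S\<^sup>2 = 1" "(C\<^sup>2 + S\<^sup>2) * p = 2 * C * S * q"
proof -
  define w where "w = sqrt (q\<^sup>2 - p\<^sup>2)"
  have w: "w > 0" "w\<^sup>2 = q\<^sup>2 - p\<^sup>2" using assms by (simp_all add: w_def)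
  have "q \<noteq> 0" using assms by auto
  define K M where "K = \<bar>q\<bar> / w" and "M = p * sgn q / w"
  have K: "K > 0" using w \<open>q \<noteq> 0\<close> by (simp add: K_def)
  have "K\<^sup>2 - M\<^sup>2 = (q\<^sup>2 - p\<^sup>2) / w\<^sup>2"
    using \<open>q \<noteq> 0\<close> by (simp add: K_def M_def power_divide power_mult_distrib diff_divide_distrib sgn_if)
  also have "\<dots> = 1" using w assms by simp
  finally have KM: "M\<^sup>2 = (K - 1) * (K + 1)" by (simp add: power2_eq_square algebra_simps)
  define C S where "C = sqrt ((K + 1) / 2)" and "S = M / (2 * C)"
  have C: "C > 0" "C\<^sup>2 = (K + 1) / 2" using K by (simp_all add: C_def)
  have "S\<^sup>2 = M\<^sup>2 / (4 * C\<^sup>2)" by (simp add: S_def power_divide power_mult_distrib)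
  also have "\<dots> = (K - 1) / 2" unfolding C(2) KM using K by (subst divide_eq_eq) auto
  finally have S: "S\<^sup>2 = (K - 1) / 2" .
  have "2 * C * S = M" using C(1) by (simp add: S_def)
  moreover have "K * p = M * q" by (simp add: K_def M_def sgn_if)
  moreover have "C\<^sup>2 + S\<^sup>2 = K" unfolding C(2) S by (simp flip: add_divide_distrib)
  ultimately have "(C\<^sup>2 + S\<^sup>2) * p = 2 * C * S * q" by metis
  moreover have "C\<^sup>2 - S\<^sup>2 = 1" unfolding C(2) S by (simp flip: diff_divide_distrib)
  ultimately show thesis by (rule that[rotated])
qed

lemma reducible_diag: "reducible (rh a b c 0 0 0)"
proof -
  have J: "rh a b c 0 0 0 = jdiag a b c" for a b c by (simp add: jdiag_h1)
  have *: "reducible (rh a b c 0 0 0)" if bc: "b \<ge> c" for b c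
  proof -
    consider "a > b" "b > c" | "b > a" "a > c" | "b > c" "c > a" | "b = c" "a \<noteq> b" | "a = b" "b \<noteq> c"
      | "a = c" "b \<noteq> c" | "a = b" "b = c"
      using bc by (cases a b rule: linorder_cases; cases a c rule: linorder_cases; cases b c rule: linorder_cases) auto
    then show ?thesis
    proof cases
      case 1
      then show ?thesis unfolding J by (intro reducibleI[where n = 1] canonical_formsI(1)) simp_all
    next
      case 2
      then have "reducible (rh a c b 0 0 0)"
        unfolding J by (intro reducibleI[where n = 2]) (simp_all add: canonical_formsI)
      then show ?thesis by - (rule reducible_swap, simp)
    next
      case 3
      then show ?thesis unfolding J by (intro reducibleI[where n = 3]) (simp_all add: canonical_formsI)
    next
      case 4
      then show ?thesis unfolding J by (intro reducibleI[where n = 5]) (simp_all add: canonical_formsI)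
    next
      case 5
      then show ?thesis unfolding J by (intro reducibleI[where n = 6]) (simp_all add: canonical_formsI)
    next
      case 6
      then have "reducible (rh a c b 0 0 0)"
        unfolding J by (intro reducibleI[where n = 6]) (simp_all add: canonical_formsI)
      then show ?thesis by - (rule reducible_swap, simp)
    next
      case 7
      have *: "rh a a a 0 0 0 = a *\<^sub>R jE" by (simp add: jE_h1)
      have "reducible (rh a a a 0 0 0)"
        unfolding * by (intro reducibleI[where n = 9]) (simp_all add: canonical_formsI)
      then show ?thesis using 7 by simp
    qed
  qed
  show ?thesis
  proof (cases "b \<ge> c")
    case False
    then have "reducible (rh a c b 0 0 0)" by - (rule *, simp)
    then show ?thesis by - (rule reducible_swap, simp)
  qed (rule *)
qed

lemma reducible_block23: "reducible (rh a b c x 0 0)"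
proof -
  obtain C S where CS: "C\<^sup>2 + S\<^sup>2 = 1" "(C\<^sup>2 - S\<^sup>2) * x = 2 * C * S * ((b - c) / 2)"
    by (rule ex_rotation_angle)
  have "C * S * (c - b) + (C\<^sup>2 - S\<^sup>2) * x = 0" unfolding CS(2) by (simp add: field_simps)
  then show ?thesis by - (rule reducible_rot[OF CS(1)], use reducible_diag in simp)
qed

lemma reducible_F3:
  assumes "q \<noteq> 0" shows "reducible (rh p p l 0 0 q)"
proof -
  have *: "reducible (rh p p l 0 0 q)" if "q > 0" for q
  proof -
    have *: "rh p p l 0 0 q = jdiag p p l + jF3 (oct_of q)" by (simp add: jdiag_h1 jF3_def)
    show ?thesis using that unfolding *
      by (intro reducibleI[where n = 4]) (simp_all add: canonical_formsI)
  qed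
  show ?thesis
  proof (cases "q > 0")
    case False
    then have "reducible (rh p p l 0 0 (- q))" using assms by - (rule *, simp)
    then show ?thesis by - (rule reducible_flip, simp)
  qed (rule *)
qed

lemma reducible_Pplus: "reducible (rh (p + 1) (p - 1) l 0 0 1)"
proof -
  have 1: "rh (p + 1) (p - 1) l 0 0 1 = jdiag p p l + Pplus" by (simp add: jdiag_h1 Pplus_def)
  have 2: "jdiag l l l = l *\<^sub>R jE" by (simp add: jdiag_h1 jE_h1)
  show "reducible (rh (p + 1) (p - 1) l 0 0 1)"
  proof (cases "p = l")
    case True
    then show ?thesis unfolding 1 by (simp add: 2 reducibleI[OF canonical_formsI(10)])
  next
    case False
    then show ?thesis unfolding 1 by (intro reducibleI[where n = 7]) (simp_all add: canonical_formsI)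
  qed
qed

lemma reducible_Pminus: "reducible (rh (p - 1) (p + 1) l 0 0 1)"
proof -
  have 1: "rh (p - 1) (p + 1) l 0 0 1 = jdiag p p l + Pminus" by (simp add: jdiag_h1 Pminus_def)
  have 2: "jdiag l l l = l *\<^sub>R jE" by (simp add: jdiag_h1 jE_h1)
  show "reducible (rh (p - 1) (p + 1) l 0 0 1)"
  proof (cases "p = l")
    case True
    then show ?thesis unfolding 1 by (simp add: 2 reducibleI[OF canonical_formsI(11)])
  next
    case False
    then show ?thesis unfolding 1 by (intro reducibleI[where n = 8]) (simp_all add: canonical_formsI)
  qed
qed

lemma hyperbola_param:
  fixes e :: real
  assumes "e \<noteq> 0"
  shows "((e + 1 / e) / 2)\<^sup>2 - ((e - 1 / e) / 2)\<^sup>2 = 1"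
  using assms by (simp add: field_simps power2_eq_square)

lemma reducible_block12: "reducible (rh a b l 0 0 z)"
proof -
  define p d where "p = (a + b) / 2" and "d = (a - b) / 2"
  have ab: "a = p + d" "b = p - d" by (simp_all add: p_def d_def field_simps)
  have boost: "reducible (rh (p + d) (p - d) l 0 0 z)"
    if "C\<^sup>2 - S\<^sup>2 = 1" "reducible (rh (p + ((C\<^sup>2 + S\<^sup>2) * d - 2 * C * S * z)) (p - ((C\<^sup>2 + S\<^sup>2) * d - 2 * C * S * z)) l
      0 0 ((C\<^sup>2 + S\<^sup>2) * z - 2 * C * S * d))" for C S d z
  proof -
    have "C\<^sup>2 * (p + d) - S\<^sup>2 * (p - d) - 2 * C * S * z = p * (C\<^sup>2 - S\<^sup>2) + ((C\<^sup>2 + S\<^sup>2) * d - 2 * C * S * z)"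
      "C\<^sup>2 * (p - d) - S\<^sup>2 * (p + d) + 2 * C * S * z = p * (C\<^sup>2 - S\<^sup>2) - ((C\<^sup>2 + S\<^sup>2) * d - 2 * C * S * z)"
      by (simp_all add: algebra_simps)
    then show ?thesis using that by - (rule reducible_boost[OF that(1)], simp add: algebra_simps)
  qed
  consider "z\<^sup>2 < d\<^sup>2" | "d\<^sup>2 < z\<^sup>2" | "z\<^sup>2 = d\<^sup>2" by linarith
  then have "reducible (rh (p + d) (p - d) l 0 0 z)"
  proof cases
    case 1
    then obtain C S where CS: "C\<^sup>2 - S\<^sup>2 = 1" "(C\<^sup>2 + S\<^sup>2) * z = 2 * C * S * d" by (rule ex_boost_rapidity)
    show ?thesis by (rule boost[OF CS(1)]) (simp only: CS(2) diff_self reducible_diag)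
  next
    case 2
    then obtain C S where CS: "C\<^sup>2 - S\<^sup>2 = 1" "(C\<^sup>2 + S\<^sup>2) * d = 2 * C * S * z" by (rule ex_boost_rapidity)
    have "((C\<^sup>2 + S\<^sup>2) * z - 2 * C * S * d) * z = (C\<^sup>2 + S\<^sup>2) * z\<^sup>2 - (2 * C * S * z) * d"
      by (simp add: power2_eq_square algebra_simps)
    also have "\<dots> = (C\<^sup>2 + S\<^sup>2) * (z\<^sup>2 - d\<^sup>2)"
      unfolding CS(2)[symmetric] by (simp add: power2_eq_square algebra_simps)
    finally have *: "((C\<^sup>2 + S\<^sup>2) * z - 2 * C * S * d) * z = (C\<^sup>2 + S\<^sup>2) * (z\<^sup>2 - d\<^sup>2)" .
    have "C\<^sup>2 + S\<^sup>2 > 0" using CS(1) by (smt (verit) zero_le_power2)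
    then have "(C\<^sup>2 + S\<^sup>2) * z - 2 * C * S * d \<noteq> 0" using * 2 by (metis diff_gt_0_iff_gt less_irrefl mult_eq_0_iff)
    then show ?thesis by - (rule boost[OF CS(1)], simp only: CS(2) diff_self diff_0_right add_0_right reducible_F3 not_False_eq_True)
  next
    case 3
    have e2: "((e + 1 / e) / 2)\<^sup>2 + ((e - 1 / e) / 2)\<^sup>2 = (e\<^sup>2 + 1 / e\<^sup>2) / 2"
      "2 * ((e + 1 / e) / 2) * ((e - 1 / e) / 2) = (e\<^sup>2 - 1 / e\<^sup>2) / 2" if "e \<noteq> 0" for e :: real
      using that by (simp_all add: power2_eq_square field_simps)
    have pos: "reducible (rh (p + d) (p - d) l 0 0 d)" if "d > 0" for d
    proof -
      have e: "sqrt d \<noteq> 0" "(sqrt d)\<^sup>2 = d" using that by auto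
      show ?thesis
        by (rule boost[OF hyperbola_param[OF e(1)]], unfold e2[OF e(1)])
          (use reducible_Pplus[of p l] that in \<open>simp add: field_simps\<close>)
    qed
    have neg: "reducible (rh (p + d) (p - d) l 0 0 (- d))" if "d < 0" for d
    proof -
      define e where "e = 1 / sqrt (- d)"
      have e: "e \<noteq> 0" "e\<^sup>2 = - (1 / d)" using that by (auto simp: e_def power_divide)
      show ?thesis
        by (rule boost[OF hyperbola_param[OF e(1)]], unfold e2[OF e(1)])
          (use reducible_Pminus[of p l] that in \<open>simp add: e(2) field_simps\<close>)
    qed
    consider "d = 0" | "d > 0" | "d < 0" by linarith
    then show ?thesis
    proof cases
      case 1
      then show ?thesis using 3 reducible_diag by simp
    next
      case 2
      have "z = d \<or> z = - d" using 3 by (simp add: power2_eq_iff)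
      then show ?thesis using pos[OF 2] reducible_flip[of "p + d" "p - d" l 0 0 z] by auto
    next
      case d: 3
      have "z = d \<or> z = - d" using 3 by (simp add: power2_eq_iff)
      then show ?thesis using neg[OF d] reducible_flip[of "p + d" "p - d" l 0 0 z] by auto
    qed
  qed
  then show ?thesis by (simp add: ab)
qed

text \<open>\<open>(u, v, w)\<close> is an eigenvector of the real matrix obtained from \<open>rh a b c x y z\<close> by conjugation
  with \<open>diag (\<i>, 1, 1)\<close>; it transforms by the real Lorentz group.\<close>

definition eigvec :: "real \<Rightarrow> real \<Rightarrow> real \<Rightarrow> real \<Rightarrow> real \<Rightarrow> real \<Rightarrow> real \<Rightarrow> real \<Rightarrow> real \<Rightarrow> real \<Rightarrow> bool" where
  "eigvec a b c x y z l u v w \<longleftrightarrow>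
    a * u + z * v + y * w = l * u \<and> b * v + x * w - z * u = l * v \<and> x * v + c * w - y * u = l * w"

lemma eigvec_rot:
  assumes "C\<^sup>2 + S\<^sup>2 = 1" "eigvec a b c x y z l u v w"
  shows "eigvec a (C\<^sup>2 * b + S\<^sup>2 * c + 2 * C * S * x) (S\<^sup>2 * b + C\<^sup>2 * c - 2 * C * S * x)
    (C * S * (c - b) + (C\<^sup>2 - S\<^sup>2) * x) (C * y - S * z) (C * z + S * y) l
    u (C * v + S * w) (C * w - S * v)"
  using assms unfolding eigvec_def by (intro conjI; elim conjE; algebra)

lemma eigvec_boost:
  assumes "C\<^sup>2 - S\<^sup>2 = 1" "eigvec a b c x y z l u v w"
  shows "eigvec (C\<^sup>2 * a - S\<^sup>2 * b - 2 * C * S * z) (C\<^sup>2 * b - S\<^sup>2 * a + 2 * C * S * z) c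
    (C * x + S * y) (C * y + S * x) (C * S * (b - a) + (C\<^sup>2 + S\<^sup>2) * z) l (C * u + S * v) (S * u + C * v) w"
  using assms unfolding eigvec_def by (intro conjI; elim conjE; algebra)

lemma reducible_timelike:
  assumes "eigvec a b c x y z l u v 0" "v\<^sup>2 < u\<^sup>2"
  shows "reducible (rh a b c x y z)"
proof -
  define \<rho> where "\<rho> = sqrt (u\<^sup>2 - v\<^sup>2)"
  have \<rho>: "\<rho> > 0" "\<rho>\<^sup>2 = u\<^sup>2 - v\<^sup>2" using assms(2) by (simp_all add: \<rho>_def)
  define C S where "C = u / \<rho>" and "S = - v / \<rho>"
  have "C\<^sup>2 - S\<^sup>2 = (u\<^sup>2 - v\<^sup>2) / \<rho>\<^sup>2" by (simp add: C_def S_def power_divide diff_divide_distrib)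
  then have CS: "C\<^sup>2 - S\<^sup>2 = 1" unfolding \<rho>(2) using assms(2) by simp
  have 0: "S * u + C * v = 0" by (simp add: C_def S_def field_simps)
  have "C * u + S * v = (u\<^sup>2 - v\<^sup>2) / \<rho>" by (simp add: C_def S_def power2_eq_square diff_divide_distrib)
  then have 1: "C * u + S * v \<noteq> 0" using \<rho>(1) assms(2) by simp
  show ?thesis
    by (rule reducible_boost[OF CS])
      (use eigvec_boost[OF CS assms(1)] 0 1 in \<open>auto simp: eigvec_def reducible_block23[simplified]\<close>)
qed

lemma reducible_spacelike:
  assumes "eigvec a b c x y z l u v 0" "u\<^sup>2 < v\<^sup>2"
  shows "reducible (rh a b c x y z)"
proof -
  define \<rho> where "\<rho> = sqrt (v\<^sup>2 - u\<^sup>2)"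
  have \<rho>: "\<rho> > 0" "\<rho>\<^sup>2 = v\<^sup>2 - u\<^sup>2" using assms(2) by (simp_all add: \<rho>_def)
  define C S where "C = v / \<rho>" and "S = - u / \<rho>"
  have "C\<^sup>2 - S\<^sup>2 = (v\<^sup>2 - u\<^sup>2) / \<rho>\<^sup>2" by (simp add: C_def S_def power_divide diff_divide_distrib)
  then have CS: "C\<^sup>2 - S\<^sup>2 = 1" unfolding \<rho>(2) using assms(2) by simp
  have 0: "C * u + S * v = 0" by (simp add: C_def S_def field_simps)
  have "S * u + C * v = (v\<^sup>2 - u\<^sup>2) / \<rho>" by (simp add: C_def S_def power2_eq_square diff_divide_distrib)
  then have 1: "S * u + C * v \<noteq> 0" using \<rho>(1) assms(2) by simp
  have "reducible (rh a b c 0 y 0)" for a b c y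
    by (rule reducible_swap) (simp add: reducible_block12[simplified])
  then show ?thesis
    by - (rule reducible_boost[OF CS],
      use eigvec_boost[OF CS assms(1)] 0 1 in \<open>auto simp: eigvec_def\<close>)
qed

lemma reducible_nonnull:
  assumes "eigvec a b c x y z l u v w" "u\<^sup>2 \<noteq> v\<^sup>2 + w\<^sup>2"
  shows "reducible (rh a b c x y z)"
proof -
  obtain C S where CS: "C\<^sup>2 + S\<^sup>2 = 1" "C * w + S * (- v) = 0" by (rule ex_unit_annihilating)
  have e: "(C * v + S * w)\<^sup>2 = v\<^sup>2 + w\<^sup>2" using CS by algebra
  have 0: "C * w - S * v = 0" using CS(2) by simp
  note E = eigvec_rot[OF CS(1) assms(1), unfolded 0]
  have "u\<^sup>2 < (C * v + S * w)\<^sup>2 \<or> (C * v + S * w)\<^sup>2 < u\<^sup>2" using assms(2) e by linarith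
  then show ?thesis
    using reducible_rot[OF CS(1)] reducible_timelike[OF E] reducible_spacelike[OF E] by blast
qed

text \<open>The nilpotent element with \<open>N\<^sup>2 \<noteq> 0\<close>: for the timelike unit vector \<open>u\<close> below,
  \<open>\<langle>N u, u\<rangle> = 0\<close>, and moving \<open>u\<close> to the first basis vector makes the first diagonal entry vanish.\<close>

lemma reach_nilpotent_corner:
  assumes "x \<noteq> 0"
  obtains b c x' y' z' where "reach (rh (- z) z 0 x x z) (rh 0 b c x' y' z')"
proof -
  define k where "k = z / (2 * x)"
  define u v w where "u = (2 + k\<^sup>2) / 2" and "v = k\<^sup>2 / 2" and "w = k"
  have z: "z = 2 * x * k" using assms by (simp add: k_def)
  define \<rho> where "\<rho> = sqrt (v\<^sup>2 + w\<^sup>2)"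
  have \<rho>: "\<rho>\<^sup>2 = v\<^sup>2 + w\<^sup>2" by (simp add: \<rho>_def)
  obtain C S where CS: "C\<^sup>2 + S\<^sup>2 = 1" "C * \<rho> = v" "S * \<rho> = w"
  proof (cases "\<rho> = 0")
    case True
    then show thesis using that[of 1 0] \<rho> by (simp add: sum_power2_eq_zero_iff)
  next
    case False
    have "(v / \<rho>)\<^sup>2 + (w / \<rho>)\<^sup>2 = (v\<^sup>2 + w\<^sup>2) / \<rho>\<^sup>2" by (simp add: power_divide add_divide_distrib)
    also have "\<dots> = 1" unfolding \<rho>[symmetric] using False by simp
    finally show thesis using that[of "v / \<rho>" "w / \<rho>"] False by simp
  qed
  have "u\<^sup>2 - \<rho>\<^sup>2 = 1" unfolding \<rho> u_def v_def w_def by (simp add: power2_eq_square field_simps)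
  then have B: "u\<^sup>2 - (- \<rho>)\<^sup>2 = 1" by simp
  have "u\<^sup>2 * (- z) - (- \<rho>)\<^sup>2 * (C\<^sup>2 * z + S\<^sup>2 * 0 + 2 * C * S * x) - 2 * u * (- \<rho>) * (C * z + S * x)
    = - (u\<^sup>2 * z) - ((C * \<rho>)\<^sup>2 * z + 2 * (C * \<rho>) * (S * \<rho>) * x) + 2 * u * (C * \<rho> * z + S * \<rho> * x)"
    by (simp add: power2_eq_square algebra_simps)
  also have "\<dots> = - (z * (u - v)\<^sup>2) + 2 * w * x * (u - v)"
    unfolding CS(2,3) by (simp add: power2_eq_square algebra_simps)
  also have "u - v = 1" by (simp add: u_def v_def field_simps)
  finally have 0: "u\<^sup>2 * (- z) - (- \<rho>)\<^sup>2 * (C\<^sup>2 * z + S\<^sup>2 * 0 + 2 * C * S * x) - 2 * u * (- \<rho>) * (C * z + S * x) = 0"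
    by (simp add: z w_def)
  show thesis
    using that reach_trans[OF reach_rot[OF CS(1)] reach_boost[OF B], of "- z" z 0 x x z]
    unfolding 0 by (simp del: mult_minus_left mult_minus_right)
qed

lemma oct_tri_real [simp]: "oct_tri (oct_of x) (oct_of y) (oct_of z) = x * y * z"
  by (simp add: oct_tri_def oct_of_nth)

lemma reach_Qplus_scale:
  assumes "p \<noteq> 0"
  shows "reach (rh 0 0 0 p p 0) (Qplus (oct_of 1))"
proof -
  define e where "e = 1 / p"
  have e: "e \<noteq> 0" "e * p = 1" using assms by (simp_all add: e_def)
  have s: "(e + 1 / e) / 2 + (e - 1 / e) / 2 = e" "(e - 1 / e) / 2 + (e + 1 / e) / 2 = e" by (simp_all add: field_simps)
  have "(e + 1 / e) / 2 * p + (e - 1 / e) / 2 * p = 1" "(e - 1 / e) / 2 * p + (e + 1 / e) / 2 * p = 1"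
    unfolding distrib_right[symmetric] s by (rule e(2))+
  then show ?thesis
    using reach_boost[OF hyperbola_param[OF e(1)], of 0 0 0 p p 0] by (simp add: Qplus_def add.commute)
qed

lemma reach_Qplus:
  assumes "x \<noteq> 0" shows "reach (rh (- z) z 0 x x z) (Qplus (oct_of 1))"
proof -
  let ?N = "rh (- z) z 0 x x z"
  note P = reach_Qplus_scale
  have M: "reach (rh 0 0 0 p q 0) (Qplus (oct_of 1))" if "p \<noteq> 0" "q\<^sup>2 = p\<^sup>2" for p q
  proof -
    have "q = p \<or> q = - p" using that(2) by (simp add: power2_eq_iff)
    moreover have "reach (rh 0 0 0 p (- p) 0) (rh 0 0 0 p p 0)"
      using reach_rot[of "-1" 0 0 0 0 p "- p" 0] by simp
    ultimately show ?thesis using P[OF that(1)] reach_trans by (metis h1_in_J1)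
  qed
  obtain b c x' y' z' where 1: "reach ?N (rh 0 b c x' y' z')" by (rule reach_nilpotent_corner[OF assms])
  obtain C S where CS: "C\<^sup>2 + S\<^sup>2 = 1" "(C\<^sup>2 - S\<^sup>2) * b = 2 * C * S * (- x')" by (rule ex_rotation_angle)
  obtain b' c' p q r where 2: "reach (rh 0 b c x' y' z') (rh 0 b' c' p q r)" "b' = C\<^sup>2 * b + S\<^sup>2 * c + 2 * C * S * x'"
    using reach_rot[OF CS(1), of 0 b c x' y' z'] by blast
  have 3: "reach ?N (rh 0 b' c' p q r)" by (rule reach_trans[OF 1 2(1) h1_in_J1])
  then obtain g where g: "g \<in> F4" "g ?N = rh 0 b' c' p q r" by (auto simp: reach_def F4c_def)
  obtain g1 where g1: "g1 \<in> F4" "g1 ?N = rh 0 b c x' y' z'" using 1 by (auto simp: reach_def F4c_def)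
  have "c = - b" using F4_jtr[OF g1(1), of ?N] by (simp add: g1)
  then have "b' = 0" using 2(2) CS(2) by (simp add: algebra_simps)
  moreover have "c' = - b'" using F4_jtr[OF g(1), of ?N] by (simp add: g)
  ultimately have bc: "b' = 0" "c' = 0" by simp_all
  have f: "p\<^sup>2 = q\<^sup>2 + r\<^sup>2"
    using F4_jform[OF g(1), of ?N ?N] by (simp add: g bc oct_of_nth power2_eq_square)
  have d: "p * q * r = 0"
    using F4_jdet[OF g(1), of ?N] by (simp add: g bc oct_of_nth jdet_h1)
  have "rh 0 b' c' p q r \<noteq> 0" using F4_eq_0_iff[OF g(1), of ?N] assms by (simp add: g)
  then have p: "p \<noteq> 0" using f bc by (auto simp: sum_power2_eq_zero_iff)
  have "reach (rh 0 b' c' p q r) (Qplus (oct_of 1))"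
  proof (cases "r = 0")
    case True
    then show ?thesis using M[OF p, of q] f bc by simp
  next
    case False
    then have "q = 0" using d p by simp
    then have "reach (rh 0 0 0 (- p) (- r) 0) (Qplus (oct_of 1))" using M[of "- p" "- r"] f p by simp
    moreover have "reach (rh 0 0 0 p 0 r) (rh 0 0 0 (- p) (- r) 0)"
      using reach_rot[of 0 1 0 0 0 p 0 r] by simp
    ultimately show ?thesis using \<open>q = 0\<close> bc reach_trans by (metis h1_in_J1)
  qed
  then show ?thesis by (rule reach_trans[OF 3 _ h1_in_J1])
qed

lemma reach_shift:
  assumes "reach X Y" "X \<in> J1" shows "reach (l *\<^sub>R jE + X) (l *\<^sub>R jE + Y)"
  using assms by (auto simp: reach_def F4c_def F4_add F4_scaleR F4_jE)

lemma reducible_null: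
  assumes e: "eigvec a b c x y z l u v w" and n: "u\<^sup>2 = v\<^sup>2 + w\<^sup>2" "u \<noteq> 0"
  shows "reducible (rh a b c x y z)"
proof -
  have *: "reducible (rh a b c x y z)" if "eigvec a b c x y z l u u 0" for a b c x y z
  proof -
    have "(a + z - l) * u = 0" "(b - z - l) * u = 0" "(x - y) * u = 0"
      using that by (simp_all add: eigvec_def algebra_simps)
    then have abc: "a = l - z" "b = l + z" "y = x" using n(2) by auto
    show ?thesis
    proof (cases "c = l")
      case False
      define k where "k = x / (c - l)"
      have "k * (c - l) = x" using False by (simp add: k_def)
      then have "eigvec a b c x y z c k k 1" unfolding eigvec_def abc by (simp add: algebra_simps)
      then show ?thesis by (rule reducible_nonnull) simp
    next
      case c: True
      show ?thesis
      proof (cases "x = 0")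
        case True
        then show ?thesis using reducible_block12[of a b c z] by (simp add: abc)
      next
        case False
        have "reach (l *\<^sub>R jE + rh (- z) z 0 x x z) (l *\<^sub>R jE + Qplus (oct_of 1))"
          by (rule reach_shift[OF reach_Qplus[OF False]]) simp
        moreover have "l *\<^sub>R jE + rh (- z) z 0 x x z = rh a b c x y z" by (simp add: jE_h1 abc c)
        moreover have "reducible (l *\<^sub>R jE + Qplus (oct_of 1))"
          by (rule reducibleI[OF canonical_formsI(12)]) simp_all
        ultimately show ?thesis by (metis reducible_reach h1_in_J1)
      qed
    qed
  qed
  define C S where "C = v / u" and "S = w / u"
  have "C\<^sup>2 + S\<^sup>2 = (v\<^sup>2 + w\<^sup>2) / u\<^sup>2" by (simp add: C_def S_def power_divide add_divide_distrib)
  then have CS: "C\<^sup>2 + S\<^sup>2 = 1" unfolding n(1)[symmetric] using n(2) by simp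
  have "C * v + S * w = (v\<^sup>2 + w\<^sup>2) / u" by (simp add: C_def S_def power2_eq_square add_divide_distrib)
  then have "C * v + S * w = u" unfolding n(1)[symmetric] using n(2) by (simp add: power2_eq_square)
  moreover have "C * w - S * v = 0" by (simp add: C_def S_def)
  ultimately show ?thesis by - (rule reducible_rot[OF CS], rule *, use eigvec_rot[OF CS e] in simp)
qed

lemma reducible_eigvec:
  assumes "eigvec a b c x y z l u v w" "u \<noteq> 0 \<or> v \<noteq> 0 \<or> w \<noteq> 0"
  shows "reducible (rh a b c x y z)"
proof (cases "u\<^sup>2 = v\<^sup>2 + w\<^sup>2")
  case True
  then have "u \<noteq> 0" using assms(2) by (auto simp: sum_power2_eq_zero_iff)
  then show ?thesis using reducible_null assms(1) True by blast
qed (use reducible_nonnull assms(1) in blast)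

lemma cubic_real_root:
  fixes a b c :: real
  obtains t where "t ^ 3 + a * t\<^sup>2 + b * t + c = 0"
proof -
  define p where "p = [:c, b, a, 1:]"
  have p: "poly p t = t ^ 3 + a * t\<^sup>2 + b * t + c" for t
    by (simp add: p_def power2_eq_square power3_eq_cube algebra_simps)
  define M where "M = 1 + \<bar>a\<bar> + \<bar>b\<bar> + \<bar>c\<bar>"
  have M: "M \<ge> 1" by (simp add: M_def)
  then have M2: "M \<le> M\<^sup>2" "1 \<le> M\<^sup>2" by (simp_all add: self_le_power one_le_power)
  have bd: "\<bar>a * t\<^sup>2 + b * t + c\<bar> \<le> M ^ 3" if "\<bar>t\<bar> = M" for t
  proof -
    have t2: "t\<^sup>2 = M\<^sup>2" using that by (metis power2_abs)
    have "\<bar>a * t\<^sup>2 + b * t + c\<bar> \<le> \<bar>a * t\<^sup>2\<bar> + \<bar>b * t\<bar> + \<bar>c\<bar>" by linarith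
    also have "\<dots> = \<bar>a\<bar> * M\<^sup>2 + \<bar>b\<bar> * M + \<bar>c\<bar> * 1" by (simp add: abs_mult that t2)
    also have "\<dots> \<le> \<bar>a\<bar> * M\<^sup>2 + \<bar>b\<bar> * M\<^sup>2 + \<bar>c\<bar> * M\<^sup>2"
      using M2 by (intro add_mono mult_left_mono) auto
    also have "\<dots> \<le> M * M\<^sup>2" unfolding distrib_right[symmetric] by (intro mult_right_mono) (auto simp: M_def)
    finally show ?thesis by (simp add: power2_eq_square power3_eq_cube)
  qed
  have "poly p (- M) \<le> 0" "0 \<le> poly p M"
    using bd[of M] bd[of "- M"] M by (simp_all add: p abs_le_iff)
  moreover have "- M \<le> M" using M by simp
  ultimately obtain t where "poly p t = 0"
    using IVT'[of "poly p" "- M" 0 M] continuous_at_imp_continuous_on[of "{- M..M}" "poly p"] by auto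
  then show thesis using that p by simp
qed

lemma reducible_J1:
  assumes "X \<in> J1" shows "reducible X"
proof -
  obtain a b c x y where X: "reach X (rh a b c x y 0)" by (rule reach_tridiagonal[OF assms])
  define A B D where "A = - (a + b + c)" and "B = a * b + b * c + c * a - x\<^sup>2 + y\<^sup>2"
    and "D = - (a * b * c) + a * x\<^sup>2 - b * y\<^sup>2"
  obtain t where "t ^ 3 + A * t\<^sup>2 + B * t + D = 0" by (rule cubic_real_root)
  then have t: "(t - a) * (t - b) * (t - c) = x\<^sup>2 * (t - a) - y\<^sup>2 * (t - b)"
    by (simp add: A_def B_def D_def power2_eq_square power3_eq_cube algebra_simps)
  have "\<exists>u v w. eigvec a b c x y 0 t u v w \<and> (u \<noteq> 0 \<or> v \<noteq> 0 \<or> w \<noteq> 0)"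
  proof (cases "t = a \<or> t = b")
    case False
    then have ab: "t - a \<noteq> 0" "t - b \<noteq> 0" by auto
    define u v where "u = y / (t - a)" and "v = x / (t - b)"
    have uv: "u * (t - a) = y" "v * (t - b) = x" using ab by (simp_all add: u_def v_def)
    have "(t - a) * (t - b) * (t - c) = (t - a) * (t - b) * (x * v - y * u)"
    proof -
      have "(t - a) * (t - b) * (x * v - y * u) = (t - a) * x * (v * (t - b)) - (t - b) * y * (u * (t - a))"
        by (simp add: algebra_simps)
      then show ?thesis unfolding t uv by (simp add: power2_eq_square)
    qed
    then have "t - c = x * v - y * u" using ab by simp
    then have "eigvec a b c x y 0 t u v 1" using uv by (simp add: eigvec_def algebra_simps)
    then show ?thesis by (intro exI[of _ u] exI[of _ v] exI[of _ 1]) simp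
  next
    case True
    then consider "a = b" "t = a" | "t = a" "y = 0" | "t = b" "x = 0" using t by auto
    then show ?thesis
    proof cases
      case 1
      show ?thesis
      proof (cases "x = 0 \<and> y = 0")
        case True
        then have "eigvec a b c x y 0 t 1 0 0" using 1 by (simp add: eigvec_def)
        then show ?thesis by (intro exI[of _ 1] exI[of _ 0]) simp
      next
        case False
        then show ?thesis using 1 by (intro exI[of _ x] exI[of _ y] exI[of _ 0]) (auto simp: eigvec_def)
      qed
    next
      case 2
      then show ?thesis by (intro exI[of _ 1] exI[of _ 0]) (simp add: eigvec_def)
    next
      case 3
      then show ?thesis by (intro exI[of _ 0] exI[of _ 1]) (simp add: eigvec_def)
    qed
  qed
  then have "reducible (rh a b c x y 0)" using reducible_eigvec by blast
  then show ?thesis using reducible_reach[OF X] assms by blast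
qed

subsection \<open>Characteristic roots\<close>

lemma poly_map_poly_of_real:
  "poly (map_poly of_real p) (of_real t :: complex) = of_real (poly p t)"
  by (induction p) (simp_all add: map_poly_pCons)

lemma jcharroots_eqI:
  assumes "\<And>t. complex_of_real (jdet (t *\<^sub>R jE - X)) = (of_real t - u) * (of_real t - v) * (of_real t - w)"
  shows "jcharroots X = {#u, v, w#}"
proof -
  let ?p = "map_poly complex_of_real (jcharpoly X)" and ?q = "[:- u, 1:] * [:- v, 1:] * [:- w, 1:]"
  have "poly (?p - ?q) (of_real t) = 0" for t
    by (simp add: poly_map_poly_of_real poly_jcharpoly assms algebra_simps)
  then have "range complex_of_real \<subseteq> {x. poly (?p - ?q) x = 0}" by auto
  moreover have "infinite (range complex_of_real)"
    by (simp add: finite_image_iff inj_def infinite_UNIV_char_0)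
  ultimately have "?p - ?q = 0" using poly_roots_finite finite_subset by blast
  then have "?p = ?q" by (simp only: right_minus_eq)
  then have "jcharroots X = proots ?q" by (simp only: jcharroots_def)
  also have "\<dots> = {#u, v, w#}" by (simp add: proots_mult del: mult_pCons_left mult_pCons_right)
  finally show ?thesis .
qed

lemma canonical_cases:
  assumes "Y \<in> canonical_forms n"
  obtains l1 l2 l3 where "n = 1" "l1 > l2" "l2 > l3" "Y = h1 l1 l2 l3 0 0 0"
  | l1 l2 l3 where "n = 2" "l1 > l2" "l2 > l3" "Y = h1 l2 l3 l1 0 0 0"
  | l1 l2 l3 where "n = 3" "l1 > l2" "l2 > l3" "Y = h1 l3 l1 l2 0 0 0"
  | p q l1 where "n = 4" "q > 0" "Y = h1 p p l1 0 0 (oct_of q)"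
  | l1 l2 where "n = 5" "l1 \<noteq> l2" "Y = h1 l1 l2 l2 0 0 0"
  | l1 l2 where "n = 6" "l1 \<noteq> l2" "Y = h1 l2 l2 l1 0 0 0"
  | l1 l2 where "n = 7" "l1 \<noteq> l2" "Y = h1 (l2 + 1) (l2 - 1) l1 0 0 (oct_of 1)"
  | l1 l2 where "n = 8" "l1 \<noteq> l2" "Y = h1 (l2 - 1) (l2 + 1) l1 0 0 (oct_of 1)"
  | r where "n = 9" "Y = h1 r r r 0 0 0"
  | r where "n = 10" "Y = h1 (r + 1) (r - 1) r 0 0 (oct_of 1)"
  | r where "n = 11" "Y = h1 (r - 1) (r + 1) r 0 0 (oct_of 1)"
  | r where "n = 12" "Y = h1 r r r (oct_of 1) (oct_of 1) 0"
proof -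
  have "n \<in> {1,2,3,4,5,6,7,8,9,10,11,12}"
    using assms by (rule contrapos_pp) (simp add: canonical_forms_def)
  then consider "n = 1" | "n = 2" | "n = 3" | "n = 4" | "n = 5" | "n = 6" | "n = 7" | "n = 8" | "n = 9"
    | "n = 10" | "n = 11" | "n = 12" by auto
  then show thesis
  proof cases
    case 1
    with assms obtain l1 l2 l3 where "l1 > l2" "l2 > l3" "Y = jdiag l1 l2 l3"
      by (auto simp: canonical_forms_def)
    then show ?thesis using that(1) 1 by (simp add: jdiag_h1 jF3_def Pplus_def Pminus_def Qplus_def jE_h1)
  next
    case 2
    with assms obtain l1 l2 l3 where "l1 > l2" "l2 > l3" "Y = jdiag l2 l3 l1"
      by (auto simp: canonical_forms_def)
    then show ?thesis using that(2) 2 by (simp add: jdiag_h1 jF3_def Pplus_def Pminus_def Qplus_def jE_h1)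
  next
    case 3
    with assms obtain l1 l2 l3 where "l1 > l2" "l2 > l3" "Y = jdiag l3 l1 l2"
      by (auto simp: canonical_forms_def)
    then show ?thesis using that(3) 3 by (simp add: jdiag_h1 jF3_def Pplus_def Pminus_def Qplus_def jE_h1)
  next
    case 4
    with assms obtain p q l1 where "q > 0" "Y = jdiag p p l1 + jF3 (oct_of q)"
      by (auto simp: canonical_forms_def)
    then show ?thesis using that(4) 4 by (simp add: jdiag_h1 jF3_def Pplus_def Pminus_def Qplus_def jE_h1)
  next
    case 5
    with assms obtain l1 l2 where "l1 \<noteq> l2" "Y = jdiag l1 l2 l2"
      by (auto simp: canonical_forms_def)
    then show ?thesis using that(5) 5 by (simp add: jdiag_h1 jF3_def Pplus_def Pminus_def Qplus_def jE_h1)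
  next
    case 6
    with assms obtain l1 l2 where "l1 \<noteq> l2" "Y = jdiag l2 l2 l1"
      by (auto simp: canonical_forms_def)
    then show ?thesis using that(6) 6 by (simp add: jdiag_h1 jF3_def Pplus_def Pminus_def Qplus_def jE_h1)
  next
    case 7
    with assms obtain l1 l2 where "l1 \<noteq> l2" "Y = jdiag l2 l2 l1 + Pplus"
      by (auto simp: canonical_forms_def)
    then show ?thesis using that(7) 7 by (simp add: jdiag_h1 jF3_def Pplus_def Pminus_def Qplus_def jE_h1)
  next
    case 8
    with assms obtain l1 l2 where "l1 \<noteq> l2" "Y = jdiag l2 l2 l1 + Pminus"
      by (auto simp: canonical_forms_def)
    then show ?thesis using that(8) 8 by (simp add: jdiag_h1 jF3_def Pplus_def Pminus_def Qplus_def jE_h1)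
  next
    case 9
    with assms obtain r where "Y = r *\<^sub>R jE"
      by (auto simp: canonical_forms_def)
    then show ?thesis using that(9) 9 by (simp add: jdiag_h1 jF3_def Pplus_def Pminus_def Qplus_def jE_h1)
  next
    case 10
    with assms obtain r where "Y = r *\<^sub>R jE + Pplus"
      by (auto simp: canonical_forms_def)
    then show ?thesis using that(10) 10 by (simp add: jdiag_h1 jF3_def Pplus_def Pminus_def Qplus_def jE_h1)
  next
    case 11
    with assms obtain r where "Y = r *\<^sub>R jE + Pminus"
      by (auto simp: canonical_forms_def)
    then show ?thesis using that(11) 11 by (simp add: jdiag_h1 jF3_def Pplus_def Pminus_def Qplus_def jE_h1)
  next
    case 12
    with assms obtain r where "Y = r *\<^sub>R jE + Qplus (oct_of 1)"
      by (auto simp: canonical_forms_def)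
    then show ?thesis using that(12) 12 by (simp add: jdiag_h1 jF3_def Pplus_def Pminus_def Qplus_def jE_h1)
  qed
qed

lemma jcharroots_diag: "jcharroots (h1 a b c 0 0 0) = {#of_real a, of_real b, of_real c#}"
  by (rule jcharroots_eqI) (simp add: jE_h1 jdet_h1 oct_tri_def)

lemma jcharroots_canonical:
  "jcharroots (h1 p p l1 0 0 (oct_of q)) = {#of_real l1, of_real p + \<i> * of_real q, of_real p - \<i> * of_real q#}"
  "jcharroots (h1 (l2 + 1) (l2 - 1) l1 0 0 (oct_of 1)) = {#of_real l1, of_real l2, of_real l2#}"
  "jcharroots (h1 (l2 - 1) (l2 + 1) l1 0 0 (oct_of 1)) = {#of_real l1, of_real l2, of_real l2#}"
  "jcharroots (h1 r r r (oct_of 1) (oct_of 1) 0) = {#of_real r, of_real r, of_real r#}"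
  by (rule jcharroots_eqI; simp add: jE_h1 jdet_h1 oct_tri_def oct_of_nth complex_eq_iff; simp add: algebra_simps power2_eq_square)+

subsection \<open>Invariance of the orbits of rank one\<close>

lemma rank1_nonpos:
  assumes "jcross (h1 a b c x y z) (h1 a b c x y z) = 0"
  shows "a * b \<le> 0" "a * c \<le> 0" "b * c = x \<bullet> x" "a = 0 \<Longrightarrow> y = 0 \<and> z = 0"
proof -
  have *: "b * c = x \<bullet> x" "c * a + y \<bullet> y = 0" "a * b + z \<bullet> z = 0" using assms by simp_all
  show "a * b \<le> 0" using *(3) inner_ge_zero[of z] by linarith
  show "a * c \<le> 0" using *(2) inner_ge_zero[of y] unfolding mult.commute[of a c] by linarith
  show "b * c = x \<bullet> x" by (rule *(1))
  show "y = 0 \<and> z = 0" if "a = 0" using *(2,3) that by simp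
qed

lemma rank1_trace1:
  assumes "jcross (h1 a b c x y z) (h1 a b c x y z) = 0" "a + b + c = 1"
  shows "a \<ge> 1 \<or> a \<le> 0"
proof (cases "a > 0")
  case True
  then have "b \<le> 0" "c \<le> 0" using rank1_nonpos(1,2)[OF assms(1)] by (auto simp: mult_le_0_iff)
  then show ?thesis using assms(2) by linarith
qed simp

lemma rank1_trace0:
  assumes "jcross (h1 a b c x y z) (h1 a b c x y z) = 0" "a + b + c = 0" "a = 0"
  shows "h1 a b c x y z = 0"
proof -
  have "c = - b" using assms by simp
  then have "- (b * b) = x \<bullet> x" using rank1_nonpos(3)[OF assms(1)] by simp
  then have "b * b = 0 \<and> x \<bullet> x = 0" using inner_ge_zero[of x] zero_le_square[of b] by linarith
  then show ?thesis using rank1_nonpos(4)[OF assms(1)] assms \<open>c = - b\<close> by simp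
qed

lemma HO_iff: "X \<in> HO \<longleftrightarrow> X \<in> jcone \<and> jtr X = 1"
proof -
  have "(jform X (jEi 1) \<ge> 1) \<longleftrightarrow> jform X (jEi 1) > 0" if "X \<in> J1" "jcross X X = 0" "jtr X = 1"
    using that(1)
  proof (rule J1_cases)
    fix a b c x y z assume X: "X = h1 a b c x y z"
    show ?thesis using rank1_trace1[of a b c x y z] that by (auto simp: X jEi_h1)
  qed
  then show ?thesis by (auto simp: HO_def jcone_def)
qed

lemma HO'_iff: "X \<in> HO' \<longleftrightarrow> X \<in> J1 \<and> jcross X X = 0 \<and> jtr X = 1 \<and> X \<notin> HO"
  by (auto simp: HO'_def HO_iff jcone_def)

lemma N1plus_iff: "X \<in> N1plus \<longleftrightarrow> X \<in> jcone \<and> jtr X = 0"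
  by (auto simp: N1plus_def jcone_def)

lemma N1minus_iff: "X \<in> N1minus \<longleftrightarrow> X \<in> J1 \<and> jcross X X = 0 \<and> jtr X = 0 \<and> X \<noteq> 0 \<and> X \<notin> N1plus"
proof -
  have "jform X (jEi 1) = 0 \<longleftrightarrow> X = 0" if "X \<in> J1" "jcross X X = 0" "jtr X = 0"
    using that(1)
  proof (rule J1_cases)
    fix a b c x y z assume X: "X = h1 a b c x y z"
    show ?thesis using rank1_trace0[of a b c x y z] that by (auto simp: X jEi_h1)
  qed
  then show ?thesis by (fastforce simp: N1minus_def N1plus_def)
qed

lemma canonical_rank1:
  assumes "Y \<in> canonical_forms n" "jcross Y Y = 0" "jtr Y = 1"
  shows "Y = jEi 1 \<or> Y = jEi 3"
proof -
  have *: "(r + 1) * (r - 1) + 1 = 0 \<longleftrightarrow> r = 0" "(r - 1) * (r + 1) + 1 = 0 \<longleftrightarrow> r = 0" for r :: real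
    by (simp_all add: algebra_simps)
  show ?thesis using assms(1)
    by (cases rule: canonical_cases) (use assms(2,3) in \<open>auto simp: jEi_h1 oct_of_nth *\<close>)
qed

lemma rank1_trace1_reach:
  assumes "X \<in> J1" "jcross X X = 0" "jtr X = 1"
  obtains g where "g \<in> F4c" "X \<in> HO \<longrightarrow> g X = jEi 1" "X \<in> HO' \<longrightarrow> g X = jEi 3"
proof -
  obtain n g where g: "g \<in> F4c" "g X \<in> canonical_forms n"
    using reducible_J1[OF assms(1)] by (auto simp: reducible_def reach_def)
  then have F: "g \<in> F4" and c: "g X \<in> jcone \<longleftrightarrow> X \<in> jcone" using assms(1) by (auto simp: F4c_def)
  have "jcross (g X) (g X) = 0" "jtr (g X) = 1"
    using assms F by (simp_all add: F4_jtr F4_zero flip: F4_jcross)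
  then have "g X = jEi 1 \<or> g X = jEi 3" using canonical_rank1[OF g(2)] by blast
  moreover have "jEi 1 \<in> jcone" "jEi 3 \<notin> jcone" by (simp_all add: jEi_h1 jcone_h1)
  ultimately show thesis using that[OF g(1)] c assms by (auto simp: HO_iff HO'_iff)
qed

definition negative_annihilator :: "cmat \<Rightarrow> bool" where
  "negative_annihilator P \<longleftrightarrow> (\<exists>Y\<in>J1. jmult P Y = 0 \<and> jform Y Y < 0)"

lemma negative_annihilator_F4:
  assumes f: "f \<in> F4" and P: "P \<in> J1"
  shows "negative_annihilator (f P) \<longleftrightarrow> negative_annihilator P"
proof -
  have *: "jmult (f P) (f Y) = 0 \<and> jform (f Y) (f Y) < 0 \<longleftrightarrow> jmult P Y = 0 \<and> jform Y Y < 0" if "Y \<in> J1" for Y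
    using that f P by (simp add: F4_jform F4_eq_0_iff flip: F4_jmult)
  show ?thesis unfolding negative_annihilator_def using * F4_J1[OF f] F4_surj[OF f] by metis
qed

lemma negative_annihilator_jEi: "\<not> negative_annihilator (jEi 1)" "negative_annihilator (jEi 3)"
proof -
  show "\<not> negative_annihilator (jEi 1)"
    by (auto simp: negative_annihilator_def jEi_h1 not_less elim!: J1_cases)
  show "negative_annihilator (jEi 3)"
    unfolding negative_annihilator_def
    by (rule bexI[of _ "h1 0 0 0 0 0 (oct_of 1)"]) (simp_all add: jEi_h1 oct_of_nth)
qed

lemma negative_annihilator_iff:
  assumes "X \<in> J1" "jcross X X = 0" "jtr X = 1"
  shows "negative_annihilator X \<longleftrightarrow> X \<notin> HO"
proof -
  obtain g where g: "g \<in> F4c" "X \<in> HO \<longrightarrow> g X = jEi 1" "X \<in> HO' \<longrightarrow> g X = jEi 3"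
    using assms by (rule rank1_trace1_reach)
  have F: "g \<in> F4" using g(1) by (simp add: F4c_def)
  show ?thesis using negative_annihilator_F4[OF F assms(1)] g negative_annihilator_jEi assms
    by (metis HO'_iff)
qed

context
  fixes f assumes f: "f \<in> F4"
begin

lemma F4_rank1:
  assumes "X \<in> J1"
  shows "jcross (f X) (f X) = 0 \<longleftrightarrow> jcross X X = 0"
  using assms f by (simp add: F4_eq_0_iff flip: F4_jcross)

lemma F4_HO: assumes "X \<in> J1" shows "f X \<in> HO \<longleftrightarrow> X \<in> HO"
proof -
  note * = F4_rank1[OF assms] F4_jtr[OF f assms] F4_J1[OF f assms] negative_annihilator_F4[OF f assms]
  show ?thesis
  proof (cases "jcross X X = 0 \<and> jtr X = 1")
    case True
    then show ?thesis using negative_annihilator_iff[of X] negative_annihilator_iff[of "f X"] assms * by simp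
  next
    case False
    then show ?thesis using * by (auto simp: HO_def)
  qed
qed

lemma F4_HO': "X \<in> J1 \<Longrightarrow> f X \<in> HO' \<longleftrightarrow> X \<in> HO'"
  by (simp add: HO'_iff F4_HO F4_rank1 F4_jtr[OF f] F4_J1[OF f])

end

lemma jform_pos:
  assumes "X \<in> jcone" "h \<in> HO" shows "jform X h > 0"
proof -
  have J: "X \<in> J1" "h \<in> J1" using assms by (auto simp: jcone_def HO_def)
  obtain g where g: "g \<in> F4c" "g h = jEi 1"
    using rank1_trace1_reach[of h] assms(2) by (auto simp: HO_def)
  have F: "g \<in> F4" and "g X \<in> jcone" using g(1) J assms(1) by (auto simp: F4c_def)
  then have "jform (g X) (g h) > 0" by (simp add: g jcone_def)
  then show ?thesis using F4_jform[OF F] J by simp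
qed

lemma F4_inverse:
  assumes f: "f \<in> F4"
  obtains f' where "f' \<in> F4" "\<And>X. X \<in> J1 \<Longrightarrow> f' (f X) = X" "\<And>X. X \<in> J1 \<Longrightarrow> f (f' X) = X"
proof (rule that[OF F4_inv[OF f]])
  show "restrict (inv_into J1 f) J1 (f X) = X" if "X \<in> J1" for X
    using that F4_bij[OF f] F4_J1[OF f that] by (simp add: bij_betw_inv_into_left)
  show "f (restrict (inv_into J1 f) J1 X) = X" if "X \<in> J1" for X
    using that F4_bij[OF f] by (simp add: bij_betw_inv_into_right)
qed

lemma F4_N1plus:
  assumes f: "f \<in> F4" and X: "X \<in> J1" shows "f X \<in> N1plus \<longleftrightarrow> X \<in> N1plus"
proof -
  have *: "f X \<in> N1plus" if f: "f \<in> F4" and X: "X \<in> N1plus" for f X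
  proof -
    have J: "X \<in> J1" "X \<in> jcone" "jcross X X = 0" "jtr X = 0"
      using X by (simp_all add: N1plus_iff) (simp_all add: jcone_def)
    obtain h where h: "h \<in> J1" "f h = jEi 1" using F4_surj[OF f, of "jEi 1"] by auto
    have "jEi 1 \<in> HO" by (simp add: jEi_h1 HO_def)
    then have "h \<in> HO" using F4_HO[OF f h(1)] h(2) by simp
    then have "jform (f X) (jEi 1) > 0" using jform_pos[OF J(2)] F4_jform[OF f J(1) h(1)] h(2) by simp
    then show ?thesis using J by (simp add: N1plus_def F4_J1[OF f] F4_jtr[OF f] F4_rank1[OF f])
  qed
  obtain f' where "f' \<in> F4" "f' (f X) = X" using F4_inverse[OF f] X by metis
  then show ?thesis using *[OF f] *[of f' "f X"] by auto
qed

lemma F4_N1minus: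
  assumes f: "f \<in> F4" and X: "X \<in> J1" shows "f X \<in> N1minus \<longleftrightarrow> X \<in> N1minus"
  using assms by (simp add: N1minus_iff F4_N1plus F4_rank1 F4_jtr F4_J1 F4_eq_0_iff)

lemma F4_N2:
  assumes f: "f \<in> F4" and X: "X \<in> J1" shows "f X \<in> N2 \<longleftrightarrow> X \<in> N2"
  using assms by (simp add: N2_def F4_rank1 F4_jtr F4_J1 F4_jdet) (simp add: F4_jtr flip: F4_jcross)

subsection \<open>The canonical forms\<close>

lemma numeral_type_3 [simp]: "(4 :: 3) = 1" "(5 :: 3) = 2"
  by simp_all

lemma jEX_diag:
  "a \<noteq> b \<Longrightarrow> a \<noteq> c \<Longrightarrow> jEX (h1 a b c 0 0 0) a = jEi 1"
  "b \<noteq> c \<Longrightarrow> b \<noteq> a \<Longrightarrow> jEX (h1 a b c 0 0 0) b = jEi 2"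
  "c \<noteq> a \<Longrightarrow> c \<noteq> b \<Longrightarrow> jEX (h1 a b c 0 0 0) c = jEi 3"
  by (simp_all add: jEX_def jE_h1 jEi_h1 del: inverse_mult_distrib)

lemma jEX_Ppm:
  assumes "l1 \<noteq> l2"
  shows "jEX (h1 (l2 + 1) (l2 - 1) l1 0 0 (oct_of 1)) l1 = jEi 3"
    and "jEX (h1 (l2 - 1) (l2 + 1) l1 0 0 (oct_of 1)) l1 = jEi 3"
proof -
  have *: "(l1 - (l2 + 1)) * (l1 - (l2 - 1)) + 1 = (l1 - l2)\<^sup>2" "(l1 - (l2 - 1)) * (l1 - (l2 + 1)) + 1 = (l1 - l2)\<^sup>2"
    by (simp_all add: power2_eq_square algebra_simps)
  show "jEX (h1 (l2 + 1) (l2 - 1) l1 0 0 (oct_of 1)) l1 = jEi 3"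
    "jEX (h1 (l2 - 1) (l2 + 1) l1 0 0 (oct_of 1)) l1 = jEi 3"
    using assms by (simp_all add: jEX_def jE_h1 jEi_h1 oct_of_nth *)
qed

lemma jWX_canonical:
  assumes "l1 \<noteq> l2"
  shows "jWX (h1 l1 l2 l2 0 0 0) l1 = 0"
    and "jWX (h1 l2 l2 l1 0 0 0) l1 = 0"
    and "jWX (h1 (l2 + 1) (l2 - 1) l1 0 0 (oct_of 1)) l1 = Pplus"
    and "jWX (h1 (l2 - 1) (l2 + 1) l1 0 0 (oct_of 1)) l1 = Pminus"
  using assms by (simp_all add: jWX_def jEX_diag jEX_Ppm) (simp_all add: jEi_h1 jE_h1 Pplus_def Pminus_def)

lemma jp_canonical:
  "jp (h1 r r r 0 0 0) = 0"
  "jp (h1 (r + 1) (r - 1) r 0 0 (oct_of 1)) = Pplus"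
  "jp (h1 (r - 1) (r + 1) r 0 0 (oct_of 1)) = Pminus"
  "jp (h1 r r r (oct_of 1) (oct_of 1) 0) = Qplus (oct_of 1)"
  by (simp_all add: jp_def jE_h1 Pplus_def Pminus_def Qplus_def)

lemma jEi_orbits [simp]:
  "jEi 1 \<in> HO" "jEi 1 \<notin> HO'" "jEi 2 \<notin> HO" "jEi 2 \<in> HO'" "jEi 3 \<notin> HO" "jEi 3 \<in> HO'"
  "jEi 2 \<noteq> jEi 3"
  by (simp_all add: HO_def HO'_def jEi_h1)

lemma zero_h1: "0 = h1 0 0 0 0 0 0"
  by (rule sym) simp

lemma nilpotent_orbits [simp]:
  "0 \<notin> N1plus" "0 \<notin> N1minus" "0 \<notin> N2"
  "Pplus \<noteq> 0" "Pplus \<in> N1plus" "Pplus \<notin> N1minus" "Pplus \<notin> N2"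
  "Pminus \<noteq> 0" "Pminus \<notin> N1plus" "Pminus \<in> N1minus" "Pminus \<notin> N2"
  "Qplus (oct_of 1) \<noteq> 0" "Qplus (oct_of 1) \<notin> N1plus" "Qplus (oct_of 1) \<notin> N1minus" "Qplus (oct_of 1) \<in> N2"
  by (simp_all add: N1plus_def N1minus_def N2_def Pplus_def Pminus_def Qplus_def jEi_h1 oct_of_nth jdet_h1 oct_tri_def)
    (simp_all add: zero_h1 jEi_h1 del: h1_eq_0_iff)

lemma jEX_in_jV: "X \<in> J1 \<Longrightarrow> jEX X t \<in> jV X"
proof -
  assume "X \<in> J1"
  then obtain a b c x y z where X: "X = h1 a b c x y z" by (rule J1_cases)
  define s where "s = t\<^sup>2 - t * (a + b + c)"
  have "jcross (t *\<^sub>R jE - X) (t *\<^sub>R jE - X) = jcross X X + t *\<^sub>R X + s *\<^sub>R jE"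
    by (simp add: X jE_h1 s_def power2_eq_square algebra_simps)
  then have "jEX X t = k *\<^sub>R jcross X X + (k * t) *\<^sub>R X + (k * s) *\<^sub>R jE"
    if "k = inverse (jtr (jcross (t *\<^sub>R jE - X) (t *\<^sub>R jE - X)))" for k
    using that by (simp add: jEX_def Let_def scaleR_add_right del: h1_add h1_scaleR)
  then show ?thesis unfolding jV_def by blast
qed

lemma jV_J1: "X \<in> J1 \<Longrightarrow> jV X \<subseteq> J1"
  by (auto simp: jV_def)

lemma diag_jV:
  assumes "a \<noteq> b" "a \<noteq> c" "b \<noteq> c"
  shows "HO \<inter> jV (h1 a b c 0 0 0) = {jEi 1}" "HO' \<inter> jV (h1 a b c 0 0 0) = {jEi 2, jEi 3}"
proof -
  let ?Y = "h1 a b c 0 0 0"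
  have V: "jEi 1 \<in> jV ?Y" "jEi 2 \<in> jV ?Y" "jEi 3 \<in> jV ?Y"
    using jEX_in_jV[of ?Y a] jEX_in_jV[of ?Y b] jEX_in_jV[of ?Y c] assms by (simp_all add: jEX_diag)
  have *: "P = jEi 1 \<or> P = jEi 2 \<or> P = jEi 3" if P_in: "P \<in> jV ?Y" and P_rank: "jcross P P = 0" "jtr P = 1" for P
  proof -
    obtain r s t where P: "P = r *\<^sub>R jcross ?Y ?Y + s *\<^sub>R ?Y + t *\<^sub>R jE"
      using P_in unfolding jV_def by blast
    have "\<exists>u v w. P = h1 u v w 0 0 0" unfolding P by (simp add: jE_h1)
    then obtain u v w where "P = h1 u v w 0 0 0" by blast
    then show ?thesis using P_rank by (auto simp: jEi_h1)
  qed
  have H: "P \<in> HO \<Longrightarrow> jcross P P = 0 \<and> jtr P = 1" "P \<in> HO' \<Longrightarrow> jcross P P = 0 \<and> jtr P = 1" for P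
    by (auto simp: HO_def HO'_def)
  show "HO \<inter> jV ?Y = {jEi 1}" using V * H(1) by auto (metis jEi_orbits(3,5))
  show "HO' \<inter> jV ?Y = {jEi 2, jEi 3}" using V * H(2) by auto (metis jEi_orbits(2))
qed

lemma F4_image_eqD:
  assumes "f \<in> F4" "A \<subseteq> J1" "B \<subseteq> J1" "f ` A = f ` B" shows "A = B"
  using inj_on_image_eq_iff[OF bij_betw_imp_inj_on[OF F4_bij[OF assms(1)]] assms(2,3)] assms(4) by blast

lemma num3_cases: "j = i \<or> j = i + 1 \<or> j = i + 2" for i j :: 3
  using exhaust_3[of i] exhaust_3[of j] by auto

lemma regular_type:
  fixes l :: "3 \<Rightarrow> real"
  assumes X: "X \<in> J1" and f: "f \<in> F4" and l: "l 1 > l 2" "l 2 > l 3"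
    and Y: "f X = h1 (l i) (l (i + 1)) (l (i + 2)) 0 0 0"
  shows "HO \<inter> jV X = {jEX X (l i)}" "HO' \<inter> jV X = {jEX X (l (i + 1)), jEX X (l (i + 2))}"
    "jEX X (l (i + 1)) \<noteq> jEX X (l (i + 2))" "jEX X (l j) \<in> HO \<longleftrightarrow> j = i"
proof -
  have d: "l i \<noteq> l (i + 1)" "l i \<noteq> l (i + 2)" "l (i + 1) \<noteq> l (i + 2)"
    using exhaust_3[of i] l by auto
  have E: "f (jEX X (l i)) = jEi 1" "f (jEX X (l (i + 1))) = jEi 2" "f (jEX X (l (i + 2))) = jEi 3"
    using d by (simp_all add: Y jEX_diag flip: F4_jEX[OF f X])
  have J: "jEX X t \<in> J1" for t using X by (rule J1_jEX)
  have V: "f ` (HO \<inter> jV X) = HO \<inter> jV (f X)" "f ` (HO' \<inter> jV X) = HO' \<inter> jV (f X)"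
    unfolding F4_jV[OF f X] using F4_HO[OF f] F4_HO'[OF f] jV_J1[OF X] by blast+
  show "HO \<inter> jV X = {jEX X (l i)}"
    by (rule F4_image_eqD[OF f]) (use jV_J1[OF X] J in \<open>auto simp: V(1) Y diag_jV[OF d] E\<close>)
  show "HO' \<inter> jV X = {jEX X (l (i + 1)), jEX X (l (i + 2))}"
    by (rule F4_image_eqD[OF f]) (use jV_J1[OF X] J in \<open>auto simp: V(2) Y diag_jV[OF d] E\<close>)
  show "jEX X (l (i + 1)) \<noteq> jEX X (l (i + 2))" using E(2,3) jEi_orbits(7) by metis
  show "jEX X (l j) \<in> HO \<longleftrightarrow> j = i"
    using num3_cases[of j i] F4_HO[OF f J, of "l j"] E d by auto
qed

lemma canonical_reach:
  assumes "X \<in> J1"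
  obtains n f where "f \<in> F4" "f X \<in> canonical_forms n" "n \<in> {1..12}"
  using reducible_J1[OF assms] by (auto simp: reducible_def reach_def F4c_def)

lemma real_mset_eqD:
  "{#complex_of_real a, of_real b, of_real c#} = {#of_real a', of_real b', of_real c'#} \<Longrightarrow>
    {#a, b, c#} = {#a', b', c'#}"
proof -
  assume "{#complex_of_real a, of_real b, of_real c#} = {#of_real a', of_real b', of_real c'#}"
  then have "image_mset complex_of_real {#a, b, c#} = image_mset complex_of_real {#a', b', c'#}" by simp
  moreover have "inj (image_mset complex_of_real)" by (rule multiset.inj_map) (simp add: inj_def)
  ultimately show ?thesis by (metis injD)
qed

lemma decreasing_mset_eqD:
  fixes a b c :: real
  assumes "{#a, b, c#} = {#a', b', c'#}" "a > b" "b > c" "a' > b'" "b' > c'"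
  shows "a = a' \<and> b = b' \<and> c = c'"
proof -
  have "{a, b, c} = {a', b', c'}" using arg_cong[OF assms(1), of set_mset] by simp
  then have "a \<in> {a', b', c'}" "b \<in> {a', b', c'}" "c \<in> {a', b', c'}" "a' \<in> {a, b, c}" "c' \<in> {a, b, c}" by blast+
  then show ?thesis using assms(2-5) by auto
qed

definition root_kind :: "complex multiset \<Rightarrow> nat" where
  "root_kind M = (if \<exists>z\<in>#M. Im z \<noteq> 0 then 2 else if card (set_mset M) = 3 then 1
     else if card (set_mset M) = 2 then 3 else 4)"

definition form_kind :: "nat \<Rightarrow> nat" where
  "form_kind n = (if n \<le> 3 then 1 else if n = 4 then 2 else if n \<le> 8 then 3 else 4)"

lemma form_kind_iff: "form_kind n = 1 \<longleftrightarrow> n \<le> 3" "form_kind n = 2 \<longleftrightarrow> n = 4"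
  by (simp_all add: form_kind_def)

lemma form_kind_eqD:
  assumes "form_kind m = form_kind n"
  shows "m \<le> 3 \<and> n \<le> 3 \<or> m = 4 \<and> n = 4 \<or> 4 < m \<and> m \<le> 8 \<and> 4 < n \<and> n \<le> 8 \<or> 8 < m \<and> 8 < n"
proof -
  consider "n \<le> 3" | "n = 4" | "4 < n" "n \<le> 8" | "8 < n" by linarith
  then show ?thesis
    by cases (use assms in \<open>auto simp: form_kind_def split: if_splits\<close>)
qed

lemma root_kind_canonical:
  assumes "Y \<in> canonical_forms n"
  shows "root_kind (jcharroots Y) = form_kind n"
  using assms
  by (cases rule: canonical_cases)
    (auto simp: jcharroots_diag jcharroots_canonical jcharroots_canonical(2,3)[of r r for r] root_kind_def form_kind_def card_insert_if)

lemma canonical_regular: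
  assumes "Y \<in> canonical_forms n" "n \<in> {1, 2, 3}"
  obtains l :: "3 \<Rightarrow> real" where "l 1 > l 2" "l 2 > l 3" "jcharroots Y = {#of_real (l 1), of_real (l 2), of_real (l 3)#}"
    "Y = h1 (l (of_nat n)) (l (of_nat n + 1)) (l (of_nat n + 2)) 0 0 0"
proof -
  define L :: "real \<Rightarrow> real \<Rightarrow> real \<Rightarrow> 3 \<Rightarrow> real" where "L l1 l2 l3 i = (if i = 1 then l1 else if i = 2 then l2 else l3)" for l1 l2 l3 i
  show thesis using assms(1)
    by (cases rule: canonical_cases)
      (use assms(2) that[of "L _ _ _"] in \<open>simp_all add: L_def jcharroots_diag add_mset_commute\<close>)
qed

lemma canonical_double:
  assumes "Y \<in> canonical_forms n" "n \<in> {5, 6, 7, 8}"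
  obtains l1 l2 where "l1 \<noteq> l2" "jcharroots Y = {#of_real l1, of_real l2, of_real l2#}"
    "jEX Y l1 \<in> HO \<longleftrightarrow> n = 5" "jEX Y l1 \<in> HO' \<longleftrightarrow> n \<noteq> 5"
    "jWX Y l1 = (if n = 7 then Pplus else if n = 8 then Pminus else 0)"
    "n = 5 \<Longrightarrow> Y = jdiag l1 l2 l2" "n = 6 \<Longrightarrow> Y = jdiag l2 l2 l1"
    "n = 7 \<Longrightarrow> Y = jdiag l2 l2 l1 + Pplus" "n = 8 \<Longrightarrow> Y = jdiag l2 l2 l1 + Pminus"
proof -
  consider "n = 5" | "n = 6" | "n = 7" | "n = 8" using assms(2) by auto
  then show thesis
  proof cases
    case 1
    with assms(1) obtain l1 l2 where *: "l1 \<noteq> l2" "Y = jdiag l1 l2 l2"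
      by (auto simp: canonical_forms_def)
    then have "Y = h1 l1 l2 l2 0 0 0" by (simp add: jdiag_h1 Pplus_def Pminus_def)
    then show ?thesis using that[OF *(1)] 1 *
      by (simp add: jcharroots_diag jcharroots_canonical jEX_diag jEX_Ppm jWX_canonical add_mset_commute)
  next
    case 2
    with assms(1) obtain l1 l2 where *: "l1 \<noteq> l2" "Y = jdiag l2 l2 l1"
      by (auto simp: canonical_forms_def)
    then have "Y = h1 l2 l2 l1 0 0 0" by (simp add: jdiag_h1 Pplus_def Pminus_def)
    then show ?thesis using that[OF *(1)] 2 *
      by (simp add: jcharroots_diag jcharroots_canonical jEX_diag jEX_Ppm jWX_canonical add_mset_commute)
  next
    case 3
    with assms(1) obtain l1 l2 where *: "l1 \<noteq> l2" "Y = jdiag l2 l2 l1 + Pplus"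
      by (auto simp: canonical_forms_def)
    then have "Y = h1 (l2 + 1) (l2 - 1) l1 0 0 (oct_of 1)" by (simp add: jdiag_h1 Pplus_def Pminus_def)
    then show ?thesis using that[OF *(1)] 3 *
      by (simp add: jcharroots_diag jcharroots_canonical jEX_diag jEX_Ppm jWX_canonical add_mset_commute)
  next
    case 4
    with assms(1) obtain l1 l2 where *: "l1 \<noteq> l2" "Y = jdiag l2 l2 l1 + Pminus"
      by (auto simp: canonical_forms_def)
    then have "Y = h1 (l2 - 1) (l2 + 1) l1 0 0 (oct_of 1)" by (simp add: jdiag_h1 Pplus_def Pminus_def)
    then show ?thesis using that[OF *(1)] 4 *
      by (simp add: jcharroots_diag jcharroots_canonical jEX_diag jEX_Ppm jWX_canonical add_mset_commute)
  qed
qed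

lemma canonical_triple:
  assumes "Y \<in> canonical_forms n" "n \<in> {9, 10, 11, 12}"
  obtains r where "jcharroots Y = {#of_real r, of_real r, of_real r#}" "jtr Y = 3 * r"
    "jp Y = (if n = 9 then 0 else if n = 10 then Pplus else if n = 11 then Pminus else Qplus (oct_of 1))"
    "Y = r *\<^sub>R jE + jp Y"
proof -
  consider "n = 9" | "n = 10" | "n = 11" | "n = 12" using assms(2) by auto
  then show thesis
  proof cases
    case 1
    with assms(1) obtain r where *: "Y = r *\<^sub>R jE"
      by (auto simp: canonical_forms_def)
    then have "Y = h1 r r r 0 0 0" by (simp add: jE_h1 Pplus_def Pminus_def Qplus_def)
    then show ?thesis using that[of r] 1 *
      by (simp add: jcharroots_diag jp_canonical)
  next
    case 2
    with assms(1) obtain r where *: "Y = r *\<^sub>R jE + Pplus"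
      by (auto simp: canonical_forms_def)
    then have "Y = h1 (r + 1) (r - 1) r 0 0 (oct_of 1)" by (simp add: jE_h1 Pplus_def Pminus_def Qplus_def)
    then show ?thesis using that[of r] 2 *
      by (simp add: jcharroots_canonical(2)[of r r] jp_canonical)
  next
    case 3
    with assms(1) obtain r where *: "Y = r *\<^sub>R jE + Pminus"
      by (auto simp: canonical_forms_def)
    then have "Y = h1 (r - 1) (r + 1) r 0 0 (oct_of 1)" by (simp add: jE_h1 Pplus_def Pminus_def Qplus_def)
    then show ?thesis using that[of r] 3 *
      by (simp add: jcharroots_canonical(3)[of r r] jp_canonical)
  next
    case 4
    with assms(1) obtain r where *: "Y = r *\<^sub>R jE + Qplus (oct_of 1)"
      by (auto simp: canonical_forms_def)
    then have "Y = h1 r r r (oct_of 1) (oct_of 1) 0" by (simp add: jE_h1 Pplus_def Pminus_def Qplus_def)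
    then show ?thesis using that[of r] 4 *
      by (simp add: jcharroots_canonical(4) jp_canonical)
  qed
qed

subsection \<open>Classification\<close>

lemma F4_orbitI: "f \<in> F4 \<Longrightarrow> f X = Y \<Longrightarrow> Y \<in> F4_orbit X"
  by (auto simp: F4_orbit_def)

lemma regular_reach:
  fixes l :: "3 \<Rightarrow> real"
  assumes X: "X \<in> J1" and l: "l 1 > l 2" "l 2 > l 3"
    and r: "jcharroots X = {#of_real (l 1), of_real (l 2), of_real (l 3)#}"
  obtains i f where "f \<in> F4" "f X = h1 (l i) (l (i + 1)) (l (i + 2)) 0 0 0"
proof -
  obtain n f where f: "f \<in> F4" "f X \<in> canonical_forms n" "n \<in> {1..12}" by (rule canonical_reach[OF X])
  have R: "jcharroots (f X) = {#of_real (l 1), of_real (l 2), of_real (l 3)#}"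
    using F4_jcharroots[OF f(1) X] r by simp
  have "l 1 \<noteq> l 2" "l 1 \<noteq> l 3" "l 2 \<noteq> l 3" using l by auto
  then have "root_kind (jcharroots (f X)) = 1" unfolding R by (simp add: root_kind_def)
  then have "n \<le> 3" by (simp only: root_kind_canonical[OF f(2)] form_kind_iff)
  then have n: "n \<in> {1, 2, 3}" using f(3) by auto
  obtain m :: "3 \<Rightarrow> real" where m: "m 1 > m 2" "m 2 > m 3" "jcharroots (f X) = {#of_real (m 1), of_real (m 2), of_real (m 3)#}"
    "f X = h1 (m (of_nat n)) (m (of_nat n + 1)) (m (of_nat n + 2)) 0 0 0"
    by (rule canonical_regular[OF f(2) n])
  have "{#l 1, l 2, l 3#} = {#m 1, m 2, m 3#}"
    by (rule real_mset_eqD[OF R[symmetric, unfolded m(3)]])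
  note lm = decreasing_mset_eqD[OF this l m(1,2)]
  have "l j = m j" for j using exhaust_3[of j] lm by metis
  then show thesis using that[OF f(1), of "of_nat n"] m(4) by simp
qed

lemma orbit_regular:
  fixes l :: "3 \<Rightarrow> real"
  assumes X: "X \<in> J1" and l: "l 1 > l 2 \<and> l 2 > l 3 \<and> jcharroots X = {#of_real (l 1), of_real (l 2), of_real (l 3)#}"
  shows "\<exists>!i::3. HO \<inter> jV X = {jEX X (l i)}
                  \<and> HO' \<inter> jV X = {jEX X (l (i + 1)), jEX X (l (i + 2))}
                  \<and> jEX X (l (i + 1)) \<noteq> jEX X (l (i + 2))"
    and "jEX X (l 1) \<in> HO \<Longrightarrow> jdiag (l 1) (l 2) (l 3) \<in> F4_orbit X"
    and "jEX X (l 2) \<in> HO \<Longrightarrow> jdiag (l 2) (l 3) (l 1) \<in> F4_orbit X"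
    and "jEX X (l 3) \<in> HO \<Longrightarrow> jdiag (l 3) (l 1) (l 2) \<in> F4_orbit X"
proof -
  obtain i f where f: "f \<in> F4" "f X = h1 (l i) (l (i + 1)) (l (i + 2)) 0 0 0"
    using regular_reach[OF X] l by blast
  have l': "l 1 > l 2" "l 2 > l 3" using l by simp_all
  note T = regular_type[OF X f(1) l' f(2)]
  show "\<exists>!i::3. HO \<inter> jV X = {jEX X (l i)}
                  \<and> HO' \<inter> jV X = {jEX X (l (i + 1)), jEX X (l (i + 2))}
                  \<and> jEX X (l (i + 1)) \<noteq> jEX X (l (i + 2))"
  proof (rule ex1I)
    show "HO \<inter> jV X = {jEX X (l i)} \<and> HO' \<inter> jV X = {jEX X (l (i + 1)), jEX X (l (i + 2))}
      \<and> jEX X (l (i + 1)) \<noteq> jEX X (l (i + 2))" by (intro conjI T(1-3))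
    show "j = i" if "HO \<inter> jV X = {jEX X (l j)} \<and> HO' \<inter> jV X = {jEX X (l (j + 1)), jEX X (l (j + 2))}
      \<and> jEX X (l (j + 1)) \<noteq> jEX X (l (j + 2))" for j
      using T(4)[of j] that by blast
  qed
  have D: "jdiag (l j) (l (j + 1)) (l (j + 2)) \<in> F4_orbit X" if "jEX X (l j) \<in> HO" for j
    using that T(4)[of j] F4_orbitI[OF f] by (simp add: jdiag_h1)
  show "jEX X (l 1) \<in> HO \<Longrightarrow> jdiag (l 1) (l 2) (l 3) \<in> F4_orbit X"
    "jEX X (l 2) \<in> HO \<Longrightarrow> jdiag (l 2) (l 3) (l 1) \<in> F4_orbit X"
    "jEX X (l 3) \<in> HO \<Longrightarrow> jdiag (l 3) (l 1) (l 2) \<in> F4_orbit X"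
    using D[of 1] D[of 2] D[of 3] by simp_all
qed

lemma orbit_complex:
  assumes X: "X \<in> J1" and q: "q > 0"
    and r: "jcharroots X = {#of_real l1, of_real p + \<i> * of_real q, of_real p - \<i> * of_real q#}"
  shows "jdiag p p l1 + jF3 (oct_of q) \<in> F4_orbit X"
proof -
  obtain n f where f: "f \<in> F4" "f X \<in> canonical_forms n" "n \<in> {1..12}" by (rule canonical_reach[OF X])
  have R: "jcharroots (f X) = {#of_real l1, of_real p + \<i> * of_real q, of_real p - \<i> * of_real q#}"
    using F4_jcharroots[OF f(1) X] r by simp
  have "root_kind (jcharroots (f X)) = 2" unfolding R using q by (auto simp: root_kind_def)
  then have n: "n = 4" by (simp only: root_kind_canonical[OF f(2)] form_kind_iff)
  obtain p' q' l1' where "q' > 0" "f X = jdiag p' p' l1' + jF3 (oct_of q')"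
    using f(2) unfolding n by (auto simp: canonical_forms_def)
  then have c: "q' > 0" "f X = h1 p' p' l1' 0 0 (oct_of q')" by (simp_all add: jdiag_h1 jF3_def)
  have "set_mset {#complex_of_real l1, of_real p + \<i> * of_real q, of_real p - \<i> * of_real q#}
    = set_mset {#complex_of_real l1', of_real p' + \<i> * of_real q', of_real p' - \<i> * of_real q'#}"
    using R by (simp only: c(2) jcharroots_canonical)
  then have S: "{complex_of_real l1, of_real p + \<i> * of_real q, of_real p - \<i> * of_real q}
    = {complex_of_real l1', of_real p' + \<i> * of_real q', of_real p' - \<i> * of_real q'}"
    by simp
  have "complex_of_real l1 \<in> {of_real l1', of_real p' + \<i> * of_real q', of_real p' - \<i> * of_real q'}"
    "of_real p + \<i> * of_real q \<in> {complex_of_real l1', of_real p' + \<i> * of_real q', of_real p' - \<i> * of_real q'}"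
    unfolding S[symmetric] by simp_all
  then have "l1' = l1" "p' = p" "q' = q" using q c(1) by (auto simp: complex_eq_iff)
  then show ?thesis using F4_orbitI[OF f(1) c(2)] by (simp add: jdiag_h1 jF3_def)
qed

lemma orbit_double:
  assumes X: "X \<in> J1" and r: "count (jcharroots X) (of_real l1) = 1 \<and> count (jcharroots X) (of_real l2) = 2"
  shows "jEX X l1 \<in> HO \<union> HO'
          \<and> jWX X l1 \<in> {0} \<union> N1plus \<union> N1minus
          \<and> (jEX X l1 \<in> HO \<longrightarrow> jWX X l1 = 0)
          \<and> (jWX X l1 \<noteq> 0 \<longrightarrow> jEX X l1 \<in> HO')
          \<and> (jEX X l1 \<in> HO \<longrightarrow> jdiag l1 l2 l2 \<in> F4_orbit X)
          \<and> (jEX X l1 \<in> HO' \<and> jWX X l1 = 0 \<longrightarrow> jdiag l2 l2 l1 \<in> F4_orbit X)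
          \<and> (jWX X l1 \<in> N1plus \<longrightarrow> jdiag l2 l2 l1 + Pplus \<in> F4_orbit X)
          \<and> (jWX X l1 \<in> N1minus \<longrightarrow> jdiag l2 l2 l1 + Pminus \<in> F4_orbit X)"
proof -
  obtain n f where f: "f \<in> F4" "f X \<in> canonical_forms n" "n \<in> {1..12}" by (rule canonical_reach[OF X])
  have R: "count (jcharroots (f X)) (of_real l1) = 1" "count (jcharroots (f X)) (of_real l2) = 2"
    using F4_jcharroots[OF f(1) X] r by simp_all
  have n: "n \<in> {5, 6, 7, 8}"
    using f(2) R by (cases rule: canonical_cases)
      (auto simp: jcharroots_diag jcharroots_canonical jcharroots_canonical(2,3)[of r r for r] complex_eq_iff split: if_splits)
  obtain m1 m2 where m: "m1 \<noteq> m2" "jcharroots (f X) = {#of_real m1, of_real m2, of_real m2#}"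
    "jEX (f X) m1 \<in> HO \<longleftrightarrow> n = 5" "jEX (f X) m1 \<in> HO' \<longleftrightarrow> n \<noteq> 5"
    "jWX (f X) m1 = (if n = 7 then Pplus else if n = 8 then Pminus else 0)"
    "n = 5 \<Longrightarrow> f X = jdiag m1 m2 m2" "n = 6 \<Longrightarrow> f X = jdiag m2 m2 m1"
    "n = 7 \<Longrightarrow> f X = jdiag m2 m2 m1 + Pplus" "n = 8 \<Longrightarrow> f X = jdiag m2 m2 m1 + Pminus"
    using canonical_double[OF f(2) n] by blast
  have ml: "m1 = l1" "m2 = l2" using R m(1,2) by (auto split: if_splits)
  have JE: "jEX X t \<in> J1" for t using X by (rule J1_jEX)
  then have JW: "jWX X t \<in> J1" for t using X by (simp add: jWX_def)
  have 1: "jEX X l1 \<in> HO \<longleftrightarrow> n = 5" "jEX X l1 \<in> HO' \<longleftrightarrow> n \<noteq> 5"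
    using m(3,4) F4_HO[OF f(1) JE, of l1] F4_HO'[OF f(1) JE, of l1] F4_jEX[OF f(1) X, of l1] by (simp_all add: ml)
  have W: "f (jWX X l1) = (if n = 7 then Pplus else if n = 8 then Pminus else 0)"
    using m(5) F4_jWX[OF f(1) X, of l1] by (simp add: ml)
  have 2: "jWX X l1 \<in> N1plus \<longleftrightarrow> n = 7" "jWX X l1 \<in> N1minus \<longleftrightarrow> n = 8" "jWX X l1 = 0 \<longleftrightarrow> n \<noteq> 7 \<and> n \<noteq> 8"
    using W F4_N1plus[OF f(1) JW, of l1] F4_N1minus[OF f(1) JW, of l1] F4_eq_0_iff[OF f(1) JW, of l1]
    by (simp_all split: if_splits)
  have 3: "n = 5 \<Longrightarrow> jdiag l1 l2 l2 \<in> F4_orbit X" "n = 6 \<Longrightarrow> jdiag l2 l2 l1 \<in> F4_orbit X"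
    "n = 7 \<Longrightarrow> jdiag l2 l2 l1 + Pplus \<in> F4_orbit X" "n = 8 \<Longrightarrow> jdiag l2 l2 l1 + Pminus \<in> F4_orbit X"
    using m(6-9) F4_orbitI[OF f(1) refl] unfolding ml by metis+
  show ?thesis using n 1 2 3 by auto
qed

lemma orbit_triple:
  assumes X: "X \<in> J1" and r: "count (jcharroots X) z = 3"
  shows "jp X \<in> {0} \<union> N1plus \<union> N1minus \<union> N2
          \<and> (jp X = 0 \<longrightarrow> ((1/3) * jtr X) *\<^sub>R jE \<in> F4_orbit X)
          \<and> (jp X \<in> N1plus \<longrightarrow> ((1/3) * jtr X) *\<^sub>R jE + Pplus \<in> F4_orbit X)
          \<and> (jp X \<in> N1minus \<longrightarrow> ((1/3) * jtr X) *\<^sub>R jE + Pminus \<in> F4_orbit X)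
          \<and> (jp X \<in> N2 \<longrightarrow> ((1/3) * jtr X) *\<^sub>R jE + Qplus (oct_of 1) \<in> F4_orbit X)"
proof -
  obtain n f where f: "f \<in> F4" "f X \<in> canonical_forms n" "n \<in> {1..12}" by (rule canonical_reach[OF X])
  have R: "count (jcharroots (f X)) z = 3" using F4_jcharroots[OF f(1) X] r by simp
  have n: "n \<in> {9, 10, 11, 12}"
    using f(2) R by (cases rule: canonical_cases)
      (auto simp: jcharroots_diag jcharroots_canonical complex_eq_iff split: if_splits)
  obtain s where s: "jtr (f X) = 3 * s"
    "jp (f X) = (if n = 9 then 0 else if n = 10 then Pplus else if n = 11 then Pminus else Qplus (oct_of 1))"
    "f X = s *\<^sub>R jE + jp (f X)"
    using canonical_triple[OF f(2) n] by blast
  have sX: "(1/3) * jtr X = s" using s(1) F4_jtr[OF f(1) X] by simp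
  have J: "jp X \<in> J1" using X by (simp add: jp_def)
  have P: "f (jp X) = (if n = 9 then 0 else if n = 10 then Pplus else if n = 11 then Pminus else Qplus (oct_of 1))"
    using s(2) F4_jp[OF f(1) X] by simp
  have 1: "jp X \<in> N1plus \<longleftrightarrow> n = 10" "jp X \<in> N1minus \<longleftrightarrow> n = 11" "jp X \<in> N2 \<longleftrightarrow> n = 12" "jp X = 0 \<longleftrightarrow> n = 9"
    using P n F4_N1plus[OF f(1) J] F4_N1minus[OF f(1) J] F4_N2[OF f(1) J] F4_eq_0_iff[OF f(1) J]
    by (auto split: if_splits)
  have "s *\<^sub>R jE + jp (f X) \<in> F4_orbit X" using F4_orbitI[OF f(1) s(3)] .
  then show ?thesis unfolding sX using n 1 s(2) by auto
qed

lemma canonical_forms_separated: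
  assumes Y: "Y \<in> canonical_forms m" and Z: "Z \<in> canonical_forms n" and orb: "Z \<in> F4_orbit Y"
    and mn: "m \<in> {1..12}" "n \<in> {1..12}"
  shows "m = n"
proof -
  obtain f where f: "f \<in> F4" "f Y = Z" using orb by (rule F4_orbitE)
  have JY: "Y \<in> J1" using Y by (cases rule: canonical_cases) auto
  have R: "jcharroots Z = jcharroots Y" using F4_jcharroots[OF f(1) JY] f(2) by simp
  have "form_kind m = form_kind n"
    by (simp only: R flip: root_kind_canonical[OF Y] root_kind_canonical[OF Z])
  then consider "m \<le> 3" "n \<le> 3" | "m = 4" "n = 4" | "4 < m" "m \<le> 8" "4 < n" "n \<le> 8" | "8 < m" "8 < n"
    using form_kind_eqD by blast
  then consider "m \<in> {1, 2, 3}" "n \<in> {1, 2, 3}" | "m = 4" "n = 4" | "m \<in> {5, 6, 7, 8}" "n \<in> {5, 6, 7, 8}"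
    | "m \<in> {9, 10, 11, 12}" "n \<in> {9, 10, 11, 12}"
  proof cases
    case 1
    then show thesis using mn by (intro that(1)) auto
  next
    case 2
    then show thesis by (rule that(2))
  next
    case 3
    then show thesis by (intro that(3)) auto
  next
    case 4
    then show thesis using mn by (intro that(4)) auto
  qed
  then show ?thesis
  proof cases
    case 1
    obtain l :: "3 \<Rightarrow> real" where l: "l 1 > l 2" "l 2 > l 3" "jcharroots Y = {#of_real (l 1), of_real (l 2), of_real (l 3)#}"
      "Y = h1 (l (of_nat m)) (l (of_nat m + 1)) (l (of_nat m + 2)) 0 0 0"
      by (rule canonical_regular[OF Y 1(1)])
    obtain k :: "3 \<Rightarrow> real" where k: "k 1 > k 2" "k 2 > k 3" "jcharroots Z = {#of_real (k 1), of_real (k 2), of_real (k 3)#}"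
      "Z = h1 (k (of_nat n)) (k (of_nat n + 1)) (k (of_nat n + 2)) 0 0 0"
      by (rule canonical_regular[OF Z 1(2)])
    have "{#l 1, l 2, l 3#} = {#k 1, k 2, k 3#}"
      by (rule real_mset_eqD) (simp only: R flip: k(3) l(3))
    note lk = decreasing_mset_eqD[OF this l(1,2) k(1,2)]
    have kl: "k j = l j" for j using exhaust_3[of j] lk by metis
    have "restrict id J1 Y = h1 (l (of_nat m)) (l (of_nat m + 1)) (l (of_nat m + 2)) 0 0 0"
      using l(4) JY by simp
    note A = regular_type(4)[OF JY F4_id l(1,2) this]
    have "f Y = h1 (l (of_nat n)) (l (of_nat n + 1)) (l (of_nat n + 2)) 0 0 0"
      using k(4) f(2) by (simp add: kl)
    note B = regular_type(4)[OF JY f(1) l(1,2) this]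
    have "(of_nat m :: 3) = of_nat n" using A B by metis
    then show ?thesis using 1 by auto
  next
    case 3
    obtain l1 l2 where l: "l1 \<noteq> l2" "jcharroots Y = {#of_real l1, of_real l2, of_real l2#}"
      "jEX Y l1 \<in> HO \<longleftrightarrow> m = 5"
      "jWX Y l1 = (if m = 7 then Pplus else if m = 8 then Pminus else 0)"
      by (rule canonical_double[OF Y 3(1)]) (rule that; assumption)
    obtain k1 k2 where k: "k1 \<noteq> k2" "jcharroots Z = {#of_real k1, of_real k2, of_real k2#}"
      "jEX Z k1 \<in> HO \<longleftrightarrow> n = 5"
      "jWX Z k1 = (if n = 7 then Pplus else if n = 8 then Pminus else 0)"
      by (rule canonical_double[OF Z 3(2)]) (rule that; assumption)
    have "count (jcharroots Z) (of_real l1) = 1" using R l(1,2) by simp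
    then have kl: "k1 = l1" using k(1,2) by (auto split: if_splits)
    have JE: "jEX Y t \<in> J1" for t using JY by (rule J1_jEX)
    then have JW: "jWX Y t \<in> J1" for t using JY by (simp add: jWX_def)
    have "jEX Z l1 \<in> HO \<longleftrightarrow> jEX Y l1 \<in> HO"
      using F4_HO[OF f(1) JE] F4_jEX[OF f(1) JY] f(2) by simp
    moreover have "jWX Z l1 \<in> N1plus \<longleftrightarrow> jWX Y l1 \<in> N1plus" "jWX Z l1 \<in> N1minus \<longleftrightarrow> jWX Y l1 \<in> N1minus"
      using F4_N1plus[OF f(1) JW] F4_N1minus[OF f(1) JW] F4_jWX[OF f(1) JY] f(2) by simp_all
    moreover have "jWX Y l1 \<in> N1plus \<longleftrightarrow> m = 7" "jWX Y l1 \<in> N1minus \<longleftrightarrow> m = 8"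
      "jWX Z l1 \<in> N1plus \<longleftrightarrow> n = 7" "jWX Z l1 \<in> N1minus \<longleftrightarrow> n = 8"
      using l(4) k(4) by (simp_all add: kl)
    ultimately have "n = 5 \<longleftrightarrow> m = 5" "n = 7 \<longleftrightarrow> m = 7" "n = 8 \<longleftrightarrow> m = 8"
      using l(3) k(3) unfolding kl by simp_all
    then show ?thesis using 3 by auto
  next
    case 4
    have J: "jp Y \<in> J1" using JY by (simp add: jp_def)
    have Y': "jp Y = (if m = 9 then 0 else if m = 10 then Pplus else if m = 11 then Pminus else Qplus (oct_of 1))"
      by (rule canonical_triple[OF Y 4(1)])
    have Z': "jp Z = (if n = 9 then 0 else if n = 10 then Pplus else if n = 11 then Pminus else Qplus (oct_of 1))"
      by (rule canonical_triple[OF Z 4(2)])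
    have "jp Y = 0 \<longleftrightarrow> m = 9" "jp Y \<in> N1plus \<longleftrightarrow> m = 10" "jp Y \<in> N1minus \<longleftrightarrow> m = 11"
      unfolding Y' by simp_all
    moreover have "jp Z = 0 \<longleftrightarrow> n = 9" "jp Z \<in> N1plus \<longleftrightarrow> n = 10" "jp Z \<in> N1minus \<longleftrightarrow> n = 11"
      unfolding Z' by simp_all
    moreover have "jp Z = f (jp Y)" using F4_jp[OF f(1) JY] f(2) by simp
    ultimately have "n = 9 \<longleftrightarrow> m = 9" "n = 10 \<longleftrightarrow> m = 10" "n = 11 \<longleftrightarrow> m = 11"
      using F4_N1plus[OF f(1) J] F4_N1minus[OF f(1) J] F4_eq_0_iff[OF f(1) J] by metis+
    then show ?thesis using 4 by auto
  qed simp
qed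

lemma orbits_disjoint: "sorted_wrt disjnt [HO, HO']" "sorted_wrt disjnt [{0}, N1plus, N1minus, N2]"
  by (auto simp: disjnt_iff HO'_iff N1minus_iff) (auto simp: N1plus_def N1minus_def N2_def)

theorem theorem1:
  shows
    "(\<forall>X\<in>J1. \<exists>n\<in>{1..12}. \<exists>Y\<in>canonical_forms n. Y \<in> F4_orbit X)
   \<and> (\<forall>X\<in>J1. \<forall>l :: 3 \<Rightarrow> real.
        l 1 > l 2 \<and> l 2 > l 3
        \<and> jcharroots X = {#of_real (l 1), of_real (l 2), of_real (l 3)#}
        \<longrightarrow> (\<exists>!i::3. HO \<inter> jV X = {jEX X (l i)}
                  \<and> HO' \<inter> jV X = {jEX X (l (i + 1)), jEX X (l (i + 2))}
                  \<and> jEX X (l (i + 1)) \<noteq> jEX X (l (i + 2)))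
          \<and> (jEX X (l 1) \<in> HO \<longrightarrow> jdiag (l 1) (l 2) (l 3) \<in> F4_orbit X)
          \<and> (jEX X (l 2) \<in> HO \<longrightarrow> jdiag (l 2) (l 3) (l 1) \<in> F4_orbit X)
          \<and> (jEX X (l 3) \<in> HO \<longrightarrow> jdiag (l 3) (l 1) (l 2) \<in> F4_orbit X))
   \<and> (\<forall>X\<in>J1. \<forall>(l1::real) (p::real) (q::real).
        q > 0 \<and> jcharroots X = {#of_real l1, of_real p + \<i> * of_real q, of_real p - \<i> * of_real q#}
        \<longrightarrow> jdiag p p l1 + jF3 (oct_of q) \<in> F4_orbit X)
   \<and> sorted_wrt disjnt [HO, HO']
   \<and> sorted_wrt disjnt [{0}, N1plus, N1minus, N2]
   \<and> (\<forall>X\<in>J1. \<forall>(l1::real) (l2::real).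
        count (jcharroots X) (of_real l1) = 1 \<and> count (jcharroots X) (of_real l2) = 2
        \<longrightarrow> jEX X l1 \<in> HO \<union> HO'
          \<and> jWX X l1 \<in> {0} \<union> N1plus \<union> N1minus
          \<and> (jEX X l1 \<in> HO \<longrightarrow> jWX X l1 = 0)
          \<and> (jWX X l1 \<noteq> 0 \<longrightarrow> jEX X l1 \<in> HO')
          \<and> (jEX X l1 \<in> HO \<longrightarrow> jdiag l1 l2 l2 \<in> F4_orbit X)
          \<and> (jEX X l1 \<in> HO' \<and> jWX X l1 = 0 \<longrightarrow> jdiag l2 l2 l1 \<in> F4_orbit X)
          \<and> (jWX X l1 \<in> N1plus \<longrightarrow> jdiag l2 l2 l1 + Pplus \<in> F4_orbit X)
          \<and> (jWX X l1 \<in> N1minus \<longrightarrow> jdiag l2 l2 l1 + Pminus \<in> F4_orbit X))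
   \<and> (\<forall>X\<in>J1. (\<exists>z. count (jcharroots X) z = 3)
        \<longrightarrow> jp X \<in> {0} \<union> N1plus \<union> N1minus \<union> N2
          \<and> (jp X = 0 \<longrightarrow> ((1/3) * jtr X) *\<^sub>R jE \<in> F4_orbit X)
          \<and> (jp X \<in> N1plus \<longrightarrow> ((1/3) * jtr X) *\<^sub>R jE + Pplus \<in> F4_orbit X)
          \<and> (jp X \<in> N1minus \<longrightarrow> ((1/3) * jtr X) *\<^sub>R jE + Pminus \<in> F4_orbit X)
          \<and> (jp X \<in> N2 \<longrightarrow> ((1/3) * jtr X) *\<^sub>R jE + Qplus (oct_of 1) \<in> F4_orbit X))
   \<and> (\<forall>m\<in>{1..12}. \<forall>n\<in>{1..12}. m \<noteq> n \<longrightarrow>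
        (\<forall>Y\<in>canonical_forms m. \<forall>Z\<in>canonical_forms n. Z \<notin> F4_orbit Y))"
  apply (intro conjI)
  subgoal by (meson F4_orbitI canonical_reach)
  subgoal by (intro ballI allI impI conjI) (simp_all only: orbit_regular)
  subgoal by (intro ballI allI impI) (rule orbit_complex; simp)
  subgoal by (rule orbits_disjoint)
  subgoal by (rule orbits_disjoint)
  subgoal by (intro ballI allI impI) (rule orbit_double)
  subgoal by (intro ballI allI impI, elim exE) (rule orbit_triple)
  subgoal using canonical_forms_separated by blast
  done

end
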